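(* Suppose $x$ is an element of a $C^*$-algebra $\mathcal{A}$, and let $M_x:\mathcal{A}\to\mathcal{A}$ be the operator $M_x(a)=x^*ax$. (1) If $M_x$ is weakly compact, and $T:\mathcal{A}\to\mathcal{A}$ is an operator with $0 \leq T \leq M_x$, then $T$ is compact. (2) If $S:\mathcal{A}\to\mathcal{A}$ is a weakly compact operator with $0 \leq M_x \leq S$, then $M_x$ is compact.
   Context: Operators are bounded linear maps; $T\ge 0$ means that $T$ maps positive elements to positive elements, and $T\le S$ means $S-T\ge 0$. *)

theory Defs
  imports "HOL-Analysis.Analysis"
begin

class complex_normed_vector = real_normed_vector +
  fixes scaleC :: "complex \<Rightarrow> 'a \<Rightarrow> 'a" (infixr "*\<^sub>C" 75)
  assumes scaleR_scaleC: "r *\<^sub>R x = complex_of_real r *\<^sub>C x"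
    and scaleC_add_right: "c *\<^sub>C (x + y) = c *\<^sub>C x + c *\<^sub>C y"
    and scaleC_add_left: "(c + d) *\<^sub>C x = c *\<^sub>C x + d *\<^sub>C x"
    and scaleC_scaleC: "c *\<^sub>C d *\<^sub>C x = (c * d) *\<^sub>C x"
    and norm_scaleC: "norm (c *\<^sub>C x) = cmod c * norm x"

instantiation complex :: complex_normed_vector
begin

definition scaleC_complex :: "complex \<Rightarrow> complex \<Rightarrow> complex" where
  "scaleC_complex c z = c * z"

instance
  by standard (simp_all add: scaleC_complex_def scaleR_conv_of_real algebra_simps norm_mult)

end

(* C*-algebras need not be unital: real_normed_algebra does not require a unit. *)
class cstar_algebra = complex_normed_vector + real_normed_algebra + banach +
  fixes star :: "'a \<Rightarrow> 'a" ("_\<^sup>\<star>" [1000] 999)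
  assumes scaleC_mult_left: "(c *\<^sub>C x) * y = c *\<^sub>C (x * y)"
    and scaleC_mult_right: "x * (c *\<^sub>C y) = c *\<^sub>C (x * y)"
    and star_star: "(x\<^sup>\<star>)\<^sup>\<star> = x"
    and star_add: "(x + y)\<^sup>\<star> = x\<^sup>\<star> + y\<^sup>\<star>"
    and star_scaleC: "(c *\<^sub>C x)\<^sup>\<star> = cnj c *\<^sub>C x\<^sup>\<star>"
    and star_mult: "(x * y)\<^sup>\<star> = y\<^sup>\<star> * x\<^sup>\<star>"
    and cstar_identity: "norm (x\<^sup>\<star> * x) = (norm x)\<^sup>2"

definition bounded_clinear ::
  "('a::complex_normed_vector \<Rightarrow> 'b::complex_normed_vector) \<Rightarrow> bool" where
  "bounded_clinear T \<longleftrightarrow> bounded_linear T \<and> (\<forall>c x. T (c *\<^sub>C x) = c *\<^sub>C T x)"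

definition weak_topology :: "'a::complex_normed_vector topology" where
  "weak_topology =
    topology_generated_by {f -` U |(f :: 'a \<Rightarrow> complex) U. bounded_clinear f \<and> open U}"

definition compact_operator ::
  "('a::complex_normed_vector \<Rightarrow> 'b::complex_normed_vector) \<Rightarrow> bool" where
  "compact_operator T \<longleftrightarrow> bounded_clinear T \<and> compact (closure (T ` cball 0 1))"

definition weakly_compact_operator ::
  "('a::complex_normed_vector \<Rightarrow> 'b::complex_normed_vector) \<Rightarrow> bool" where
  "weakly_compact_operator T \<longleftrightarrow>
    bounded_clinear T \<and> compactin weak_topology (weak_topology closure_of (T ` cball 0 1))"

(* Positivity as a = b* b; unlike the spectral form, this makes sense verbatim without a unit. *)
definition positive_element :: "'a::cstar_algebra \<Rightarrow> bool" where
  "positive_element a \<longleftrightarrow> (\<exists>b. a = b\<^sup>\<star> * b)"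

definition positive_map :: "('a::cstar_algebra \<Rightarrow> 'b::cstar_algebra) \<Rightarrow> bool" where
  "positive_map T \<longleftrightarrow> (\<forall>a. positive_element a \<longrightarrow> positive_element (T a))"

(* The operator order; not the pointwise order on functions. *)
definition op_le :: "('a::cstar_algebra \<Rightarrow> 'b::cstar_algebra) \<Rightarrow> ('a \<Rightarrow> 'b) \<Rightarrow> bool"
    (infix "\<preceq>" 50) where
  "T \<preceq> S \<longleftrightarrow> positive_map (\<lambda>a. S a - T a)"

definition conj_op :: "'a::cstar_algebra \<Rightarrow> 'a \<Rightarrow> 'a" where
  "conj_op x a = x\<^sup>\<star> * a * x"

end

theory Submission
  imports Defs
begin

text \<open>
  Weak compactness enters through one consequence (\<open>no_orthogonal_sequence\<close>): if a weakly compact \<open>S\<close>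
  majorizes \<open>a \<mapsto> x\<^sup>* a x\<close>, then there is no sequence of mutually orthogonal self-adjoint \<open>b\<^sub>n\<close> of norm 1
  with \<open>\<parallel>b\<^sub>n x\<parallel>\<close> bounded away from 0. For the partial sums \<open>c\<^sub>k\<close> of the \<open>b\<^sub>n\<^sup>2\<close> are bounded and increasing, so
  \<open>S c\<^sub>k\<close> has a weak cluster point, which Mazur's theorem (\<open>weak_closure_convex\<close>) approximates in norm by
  images of elements between \<open>c\<^sub>m\<close> and \<open>c\<^sub>M\<close>; hence \<open>\<parallel>x\<^sup>* b\<^sub>n\<^sup>2 x\<parallel> = \<parallel>b\<^sub>n x\<parallel>\<^sup>2\<close> becomes arbitrarily small.

  The absence of such sequences forces the part of \<open>x x\<^sup>*\<close> above any \<open>\<epsilon>\<close> to be finite dimensional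
  (\<open>finite_projection_exhausts\<close>): there is a finite sum \<open>p\<close> of orthogonal minimal projections with
  \<open>\<parallel>(1 - p) x\<parallel>\<^sup>2 \<le> \<epsilon>\<close>. Indeed an element that can be split indefinitely into orthogonal pieces would give an
  orthogonal sequence, and if one cannot be split then its square is a multiple of a minimal projection
  (\<open>unsplittable_square\<close>, \<open>unsplittable_minimal_projection\<close>). The corner cut out by \<open>p\<close> is finite
  dimensional (\<open>compact_corner_finite_projection\<close>).

  If now \<open>0 \<le> T \<le> M\<^sub>x\<close>, where \<open>M\<^sub>x a = x\<^sup>* a x\<close>, then the Cauchy--Schwarz inequality for positive maps shows
  that \<open>T\<close> is uniformly small on \<open>(1 - p) a\<close> and on \<open>a (1 - p)\<close>, so \<open>T\<close> is a norm limit of the compact maps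
  \<open>a \<mapsto> T (p a p)\<close> (\<open>compact_operator_if_orthogonally_small\<close>). The first part of the theorem is the case
  \<open>S = M\<^sub>x\<close>, the second the case \<open>T = M\<^sub>x\<close>.

  The underlying theory is developed on the unitization: the continuous functional calculus of one
  self-adjoint element \<open>h\<close> with \<open>\<parallel>h\<parallel> < 1\<close> comes from the unitary \<open>u = h + i (1 - h\<^sup>2)\<^sup>1\<^sup>/\<^sup>2\<close>, for which
  \<open>h = (u + u\<^sup>*) / 2\<close>, and an element is positive if and only if it has the form \<open>b\<^sup>* b\<close>
  (\<open>positive_element_iff\<close>), so that positive elements form a cone on which the norm is monotone.
\<close>

section \<open>Elementary identities in C*-algebras\<close>

lemma scaleC_one: "1 *\<^sub>C a = (a::'a::complex_normed_vector)"
  using scaleR_scaleC[of 1 a] by simp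

lemma scaleC_zero_left: "0 *\<^sub>C a = (0::'a::complex_normed_vector)"
  using scaleR_scaleC[of 0 a] by simp

lemma scaleC_zero_right: "c *\<^sub>C 0 = (0::'a::complex_normed_vector)"
  using norm_scaleC[of c "0::'a"] by simp

lemma scaleC_minus_one: "(-1) *\<^sub>C a = - (a::'a::complex_normed_vector)"
  using scaleR_scaleC[of "-1" a] by simp

lemma scaleC_minus_right: "c *\<^sub>C (- a) = - (c *\<^sub>C (a::'a::complex_normed_vector))"
  using scaleC_add_right[of c a "-a"] by (simp add: scaleC_zero_right eq_neg_iff_add_eq_0 add.commute)

lemma scaleC_minus_left: "(- c) *\<^sub>C a = - (c *\<^sub>C (a::'a::complex_normed_vector))"
  using scaleC_add_left[of c "-c" a] by (simp add: scaleC_zero_left eq_neg_iff_add_eq_0 add.commute)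

lemma scaleC_diff_right: "c *\<^sub>C (a - b) = c *\<^sub>C a - c *\<^sub>C (b::'a::complex_normed_vector)"
  using scaleC_add_right[of c a "-b"] by (simp add: scaleC_minus_right)

lemma scaleC_i_i: "\<i> *\<^sub>C \<i> *\<^sub>C a = - (a::'a::complex_normed_vector)"
  by (simp add: scaleC_scaleC scaleC_minus_one)

lemma scaleC_cartesian:
  "c *\<^sub>C a = Re c *\<^sub>R a + Im c *\<^sub>R (\<i> *\<^sub>C (a::'a::complex_normed_vector))"
proof -
  have "c *\<^sub>C a = (of_real (Re c) + of_real (Im c) * \<i>) *\<^sub>C a"
    by (rule arg_cong[where f="\<lambda>c. c *\<^sub>C a"]) (simp add: complex_eq_iff)
  then show ?thesis by (simp only: scaleC_add_left scaleR_scaleC scaleC_scaleC)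
qed

lemma scaleC_of_real_mult:
  "(r *\<^sub>R c) *\<^sub>C a = r *\<^sub>R (c *\<^sub>C (a::'a::complex_normed_vector))"
  by (simp add: scaleR_scaleC scaleC_scaleC scaleR_conv_of_real scaleC_complex_def)

lemma scaleC_scaleR: "c *\<^sub>C (r *\<^sub>R a) = r *\<^sub>R (c *\<^sub>C (a::'a::complex_normed_vector))"
  by (simp add: scaleR_scaleC scaleC_scaleC mult.commute)

lemma bounded_linear_scaleC: "bounded_linear (\<lambda>a::'a::complex_normed_vector. c *\<^sub>C a)"
  by (rule bounded_linear_intro[where K="cmod c"])
    (simp_all add: scaleC_add_right scaleC_scaleR norm_scaleC mult.commute)

lemma star_zero [simp]: "(0::'a::cstar_algebra)\<^sup>\<star> = 0"
  using star_add[of "0::'a" 0] by simp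

lemma star_minus [simp]: "(- a)\<^sup>\<star> = - (a::'a::cstar_algebra)\<^sup>\<star>"
  using star_add[of a "-a"] by (simp add: eq_neg_iff_add_eq_0 add.commute)

lemma star_diff [simp]: "(a - b)\<^sup>\<star> = a\<^sup>\<star> - (b::'a::cstar_algebra)\<^sup>\<star>"
  using star_add[of a "-b"] by simp

lemma star_scaleR [simp]: "(r *\<^sub>R a)\<^sup>\<star> = r *\<^sub>R (a::'a::cstar_algebra)\<^sup>\<star>"
  by (simp add: scaleR_scaleC star_scaleC)

lemma norm_star [simp]: "norm (a\<^sup>\<star>) = norm (a::'a::cstar_algebra)"
proof -
  have le: "norm b \<le> norm (b\<^sup>\<star>)" for b :: 'a
  proof (cases "b = 0")
    case False
    have "(norm b)\<^sup>2 \<le> norm (b\<^sup>\<star>) * norm b"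
      using norm_mult_ineq[of "b\<^sup>\<star>" b] by (simp add: cstar_identity)
    with False show ?thesis by (simp add: power2_eq_square)
  qed simp
  show ?thesis using le[of a] le[of "a\<^sup>\<star>"] by (simp add: star_star)
qed

lemma cstar_identity': "norm (a * a\<^sup>\<star>) = (norm (a::'a::cstar_algebra))\<^sup>2"
  using cstar_identity[of "a\<^sup>\<star>"] by (simp add: star_star)

lemma bounded_linear_star: "bounded_linear (star :: 'a::cstar_algebra \<Rightarrow> 'a)"
  by (rule bounded_linear_intro[where K=1]) (simp_all add: star_add)

lemma star_sum: "(\<Sum>i\<in>A. f i)\<^sup>\<star> = (\<Sum>i\<in>A. (f i :: 'a::cstar_algebra)\<^sup>\<star>)"
  using bounded_linear_star linear_sum bounded_linear.linear by blast

lemma star_one [simp]: "(1::'a::{cstar_algebra, real_normed_algebra_1})\<^sup>\<star> = 1"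
  by (metis mult.right_neutral mult_1 star_mult star_star)

lemma star_power: "((a::'a::{cstar_algebra, real_normed_algebra_1}) ^ n)\<^sup>\<star> = a\<^sup>\<star> ^ n"
  by (induction n) (simp_all add: star_mult power_commutes)

lemma norm_square_selfadjoint:
  "(a::'a::cstar_algebra)\<^sup>\<star> = a \<Longrightarrow> norm (a * a) = (norm a)\<^sup>2"
  using cstar_identity[of a] by simp

lemma norm_power_selfadjoint:
  fixes a :: "'a::{cstar_algebra, real_normed_algebra_1}"
  assumes "a\<^sup>\<star> = a"
  shows "norm (a ^ (2 ^ n)) = norm a ^ (2 ^ n)"
proof (induction n)
  case (Suc n)
  have "norm (a ^ (2 ^ Suc n)) = norm (a ^ (2 ^ n) * a ^ (2 ^ n))"
    by (simp add: power_add mult_2)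
  also have "\<dots> = (norm (a ^ (2 ^ n)))\<^sup>2"
    by (rule norm_square_selfadjoint) (simp add: star_power assms)
  also have "\<dots> = norm a ^ (2 ^ Suc n)"
    by (simp add: Suc power_mult[symmetric] mult.commute)
  finally show ?case .
qed simp

lemma star_mult_self_eq_0: "a\<^sup>\<star> * a = 0 \<Longrightarrow> (a::'a::cstar_algebra) = 0"
  using cstar_identity[of a] by simp


section \<open>The unitization\<close>

text \<open>
  The pair of \<open>a\<close> and \<open>c\<close> stands for \<open>a + c 1\<close>. The norm is the maximum of \<open>\<bar>c\<bar>\<close> and of the operator
  norm of \<open>b \<mapsto> a b + c b\<close>; the first term is what makes it a norm when the given algebra has a
  unit already, in which case the unitization is the direct sum with the complex numbers.
\<close>
datatype 'a unitization = Adjoin (base: 'a) (coeff1: complex)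

abbreviation embed :: "'a::zero \<Rightarrow> 'a unitization" where
  "embed a \<equiv> Adjoin a 0"

text \<open>The action of the unitization on the original algebra by multiplication from the left.\<close>
definition act :: "'a::cstar_algebra unitization \<Rightarrow> 'a \<Rightarrow> 'a" where
  "act v b = base v * b + coeff1 v *\<^sub>C b"

lemma bounded_linear_act: "bounded_linear (act v)"
  unfolding act_def
  by (intro bounded_linear_add bounded_linear_mult_right bounded_linear_scaleC)

instantiation unitization :: (cstar_algebra) real_normed_vector
begin

definition "(0 :: 'a unitization) = Adjoin 0 0"
definition "(v :: 'a unitization) + w = Adjoin (base v + base w) (coeff1 v + coeff1 w)"
definition "- (v :: 'a unitization) = Adjoin (- base v) (- coeff1 v)"
definition "(v :: 'a unitization) - w = Adjoin (base v - base w) (coeff1 v - coeff1 w)"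
definition "r *\<^sub>R (v :: 'a unitization) = Adjoin (r *\<^sub>R base v) (r *\<^sub>R coeff1 v)"
definition "norm (v :: 'a unitization) = max (onorm (act v)) (cmod (coeff1 v))"
definition "sgn (v :: 'a unitization) = inverse (norm v) *\<^sub>R v"
definition "dist (v :: 'a unitization) w = norm (v - w)"
definition "uniformity = (INF e\<in>{0<..}. principal {(v, w :: 'a unitization). dist v w < e})"
definition "open (S :: 'a unitization set) \<longleftrightarrow>
  (\<forall>v\<in>S. \<forall>\<^sub>F (v', w) in uniformity. v' = v \<longrightarrow> w \<in> S)"

lemma unitization_sel_simps [simp]:
  "base (0 :: 'a unitization) = 0" "coeff1 (0 :: 'a unitization) = 0"
  "base (v + w) = base v + base w" "coeff1 (v + w) = coeff1 v + coeff1 (w :: 'a unitization)"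
  "base (- v) = - base v" "coeff1 (- v) = - coeff1 (v :: 'a unitization)"
  "base (v - w) = base v - base w" "coeff1 (v - w) = coeff1 v - coeff1 (w :: 'a unitization)"
  "base (r *\<^sub>R v) = r *\<^sub>R base v" "coeff1 (r *\<^sub>R v) = r *\<^sub>R coeff1 (v :: 'a unitization)"
  by (simp_all add: zero_unitization_def plus_unitization_def uminus_unitization_def
      minus_unitization_def scaleR_unitization_def)

lemma onorm_act_eq_0:
  assumes "onorm (act (Adjoin a 0)) = 0"
  shows "a = (0::'a)"
proof -
  have "act (Adjoin a 0) (a\<^sup>\<star>) = 0"
    using assms onorm_eq_0[OF bounded_linear_act] by metis
  then have "(norm a)\<^sup>2 = 0"
    unfolding cstar_identity'[symmetric] by (simp add: act_def scaleC_zero_left)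
  then show ?thesis by simp
qed

instance
proof
  fix v w u :: "'a unitization" and r s :: real
  show "v + w + u = v + (w + u)" "v + w = w + v" "0 + v = v" "- v + v = 0" "v - w = v + - w"
    "r *\<^sub>R (v + w) = r *\<^sub>R v + r *\<^sub>R w" "(r + s) *\<^sub>R v = r *\<^sub>R v + s *\<^sub>R v"
    "r *\<^sub>R s *\<^sub>R v = (r * s) *\<^sub>R v" "1 *\<^sub>R v = v"
    by (rule unitization.expand; simp add: algebra_simps)+
  show "dist v w = norm (v - w)" "sgn v = inverse (norm v) *\<^sub>R v"
    "uniformity = (INF e\<in>{0<..}. principal {(v, w :: 'a unitization). dist v w < e})"
    by (simp_all add: dist_unitization_def sgn_unitization_def uniformity_unitization_def)
  show "open S \<longleftrightarrow> (\<forall>v\<in>S. \<forall>\<^sub>F (v', w) in uniformity. v' = v \<longrightarrow> w \<in> S)"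
    for S :: "'a unitization set"
    by (simp add: open_unitization_def)
  show "norm v = 0 \<longleftrightarrow> v = 0"
  proof
    assume "norm v = 0"
    moreover have "0 \<le> onorm (act v)" "0 \<le> cmod (coeff1 v)"
      by (simp_all add: onorm_pos_le[OF bounded_linear_act])
    ultimately have 0: "onorm (act v) = 0" and c: "coeff1 v = 0"
      unfolding norm_unitization_def by (auto simp: max_def split: if_splits)
    then have "base v = 0"
      using onorm_act_eq_0[of "base v"] by (cases v) auto
    with c show "v = 0" by (intro unitization.expand) simp
  next
    assume "v = 0"
    moreover have "act (0 :: 'a unitization) = (\<lambda>b. 0)" by (auto simp: act_def scaleC_zero_left)
    ultimately show "norm v = 0" by (simp add: norm_unitization_def onorm_zero)
  qed
  have "act (v + w) = (\<lambda>b. act v b + act w b)"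
    by (auto simp: act_def algebra_simps scaleC_add_left)
  then show "norm (v + w) \<le> norm v + norm w"
    using onorm_triangle[OF bounded_linear_act[of v] bounded_linear_act[of w]]
      norm_triangle_ineq[of "coeff1 v" "coeff1 w"]
    unfolding norm_unitization_def by auto
  have "act (r *\<^sub>R v) = (\<lambda>b. r *\<^sub>R act v b)"
    by (auto simp: act_def scaleR_right_distrib scaleC_of_real_mult)
  then show "norm (r *\<^sub>R v) = \<bar>r\<bar> * norm v"
    using onorm_scaleR[OF bounded_linear_act[of v], of r]
    unfolding norm_unitization_def by (simp add: norm_mult max_mult_distrib_left)
qed

end

lemma act_le_norm: "norm (act v b) \<le> norm v * norm b"
proof -
  have "onorm (act v) * norm b \<le> norm v * norm b"
    by (intro mult_right_mono) (simp_all add: norm_unitization_def)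
  with onorm[OF bounded_linear_act[of v], of b] show ?thesis by linarith
qed

lemma coeff1_le_norm: "cmod (coeff1 v) \<le> norm v"
  by (simp add: norm_unitization_def)

lemma norm_unitization_le:
  assumes "\<And>b. norm (act v b) \<le> C * norm b" "cmod (coeff1 v) \<le> C"
  shows "norm v \<le> C"
proof -
  have "0 \<le> C" using assms(2) norm_ge_zero order_trans by blast
  then show ?thesis
    unfolding norm_unitization_def using onorm_bound[of C "act v"] assms by auto
qed

instantiation unitization :: (cstar_algebra) real_normed_algebra_1
begin

definition "(1 :: 'a unitization) = Adjoin 0 1"
definition "(v :: 'a unitization) * w = Adjoin (base v * base w + coeff1 v *\<^sub>C base w + coeff1 w *\<^sub>C base v)
  (coeff1 v * coeff1 w)"

lemma unitization_ring_sel_simps [simp]: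
  "base (1 :: 'a unitization) = 0" "coeff1 (1 :: 'a unitization) = 1"
  "base (v * w) = base v * base w + coeff1 v *\<^sub>C base w + coeff1 w *\<^sub>C base (v :: 'a unitization)"
  "coeff1 (v * w) = coeff1 v * coeff1 (w :: 'a unitization)"
  by (simp_all add: one_unitization_def times_unitization_def)

lemma act_mult: "act (v * w) b = act v (act w b)"
  by (simp add: act_def algebra_simps scaleC_add_right scaleC_scaleC
      scaleC_mult_left scaleC_mult_right mult.commute)

instance
proof
  fix v w u :: "'a unitization" and r s :: real
  show "v * w * u = v * (w * u)" "(v + w) * u = v * u + w * u" "v * (w + u) = v * w + v * u"
    "1 * v = v" "v * 1 = v" "r *\<^sub>R v * w = r *\<^sub>R (v * w)" "v * r *\<^sub>R w = r *\<^sub>R (v * w)"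
    by (rule unitization.expand; simp add: algebra_simps scaleC_mult_left scaleC_mult_right
        scaleC_add_left scaleC_add_right scaleC_scaleC scaleC_zero_left scaleC_zero_right scaleC_one
        scaleC_scaleR scaleC_of_real_mult)+
  show "(0::'a unitization) \<noteq> 1"
    by (metis unitization_sel_simps(2) unitization_ring_sel_simps(2) zero_neq_one)
  show "norm (v * w) \<le> norm v * norm w"
  proof (rule norm_unitization_le)
    fix b
    have "norm (act v (act w b)) \<le> norm v * (norm w * norm b)"
      by (meson act_le_norm mult_left_mono norm_ge_zero order_trans)
    then show "norm (act (v * w) b) \<le> norm v * norm w * norm b"
      by (simp add: act_mult mult.assoc)
    show "cmod (coeff1 (v * w)) \<le> norm v * norm w"
      by (simp add: norm_mult mult_mono coeff1_le_norm)
  qed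
  have "norm (1::'a unitization) \<le> 1"
    by (rule norm_unitization_le) (simp_all add: act_def scaleC_one)
  moreover have "1 \<le> norm (1::'a unitization)"
    using coeff1_le_norm[of "1::'a unitization"] by simp
  ultimately show "norm (1::'a unitization) = 1" by simp
qed

end

lemma norm_embed: "norm (embed a) = norm (a::'a::cstar_algebra)"
proof (rule antisym)
  show "norm (embed a) \<le> norm a"
    by (rule norm_unitization_le) (simp_all add: act_def scaleC_zero_left norm_mult_ineq)
  have "(norm a)\<^sup>2 \<le> norm (embed a) * norm a"
    using act_le_norm[of "embed a" "a\<^sup>\<star>"]
    by (simp add: act_def scaleC_zero_left cstar_identity')
  then show "norm a \<le> norm (embed a)"
    by (cases "a = 0") (simp_all add: power2_eq_square)
qed

lemma embed_base: "coeff1 v = 0 \<Longrightarrow> embed (base v) = v"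
  by (cases v) simp

lemma norm_base: "coeff1 v = 0 \<Longrightarrow> norm (base v) = norm (v::'a::cstar_algebra unitization)"
  by (metis embed_base norm_embed)

lemma embed_simps:
  "embed (a + b) = embed a + embed (b::'a::cstar_algebra)"
  "embed (a - b) = embed a - embed b"
  "embed (- a) = - embed a"
  "embed (r *\<^sub>R a) = r *\<^sub>R embed a"
  "embed (a * b) = embed a * embed b"
  "embed 0 = (0 :: 'a unitization)"
  by (rule unitization.expand; simp add: scaleC_zero_left)+

lemma bounded_linear_coeff1: "bounded_linear (coeff1 :: 'a::cstar_algebra unitization \<Rightarrow> complex)"
  by (rule bounded_linear_intro[where K=1]) (simp_all add: coeff1_le_norm)

lemma bounded_linear_base: "bounded_linear (base :: 'a::cstar_algebra unitization \<Rightarrow> 'a)"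
proof (rule bounded_linear_intro[where K=2])
  fix v :: "'a unitization"
  define w :: "'a unitization" where "w = Adjoin 0 (coeff1 v)"
  have w: "norm w \<le> norm v"
    by (rule norm_unitization_le)
      (simp_all add: w_def act_def norm_scaleC mult_right_mono coeff1_le_norm)
  have "embed (base v) = v - w"
    by (rule unitization.expand) (simp add: w_def)
  then have "norm (base v) = norm (v - w)" by (metis norm_embed)
  also have "\<dots> \<le> norm v + norm w" by (rule norm_triangle_ineq4)
  finally show "norm (base v) \<le> norm v * 2" using w by simp
qed simp_all

instantiation unitization :: (cstar_algebra) cstar_algebra
begin

definition "c *\<^sub>C (v :: 'a unitization) = Adjoin (c *\<^sub>C base v) (c * coeff1 v)"
definition "(v :: 'a unitization)\<^sup>\<star> = Adjoin ((base v)\<^sup>\<star>) (cnj (coeff1 v))"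

lemma unitization_star_sel_simps [simp]:
  "base (c *\<^sub>C v) = c *\<^sub>C base v" "coeff1 (c *\<^sub>C v) = c * coeff1 (v :: 'a unitization)"
  "base (v\<^sup>\<star>) = (base v)\<^sup>\<star>" "coeff1 (v\<^sup>\<star>) = cnj (coeff1 (v :: 'a unitization))"
  by (simp_all add: scaleC_unitization_def star_unitization_def)

lemma star_act: "(act v b)\<^sup>\<star> * act v b = b\<^sup>\<star> * act (v\<^sup>\<star> * v) b"
proof -
  have "(act v b)\<^sup>\<star> * c = b\<^sup>\<star> * act (v\<^sup>\<star>) c" for c
    by (simp add: act_def star_add star_mult star_scaleC algebra_simps
        scaleC_mult_left scaleC_mult_right)
  then show ?thesis by (simp add: act_mult)
qed

instance
proof
  fix v w u :: "'a unitization" and c d :: complex and r :: real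
  show "r *\<^sub>R v = complex_of_real r *\<^sub>C v"
    by (rule unitization.expand) (simp add: scaleR_scaleC[where 'a='a] scaleR_conv_of_real[where 'a=complex])
  show "c *\<^sub>C (v + w) = c *\<^sub>C v + c *\<^sub>C w"
    "(c + d) *\<^sub>C v = c *\<^sub>C v + d *\<^sub>C v" "c *\<^sub>C d *\<^sub>C v = (c * d) *\<^sub>C v"
    "c *\<^sub>C v * w = c *\<^sub>C (v * w)" "v * c *\<^sub>C w = c *\<^sub>C (v * w)" "(v\<^sup>\<star>)\<^sup>\<star> = v"
    "(v + w)\<^sup>\<star> = v\<^sup>\<star> + w\<^sup>\<star>" "(c *\<^sub>C v)\<^sup>\<star> = cnj c *\<^sub>C v\<^sup>\<star>" "(v * w)\<^sup>\<star> = w\<^sup>\<star> * v\<^sup>\<star>"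
    by (rule unitization.expand; simp add: algebra_simps scaleC_mult_left scaleC_mult_right
        scaleC_add_left scaleC_add_right scaleC_scaleC star_add star_star star_mult star_scaleC)+
  have act_scaleC: "act (c *\<^sub>C v) b = c *\<^sub>C act v b" for c :: complex and v b
    by (simp add: act_def scaleC_add_right scaleC_scaleC scaleC_mult_left)
  show "norm (c *\<^sub>C v) = cmod c * norm v"
  proof (rule antisym)
    have le: "norm (c *\<^sub>C v) \<le> cmod c * norm v" for c and v :: "'a unitization"
      by (rule norm_unitization_le)
        (simp_all add: act_scaleC norm_scaleC norm_mult mult.assoc mult_left_mono act_le_norm
          coeff1_le_norm)
    show "norm (c *\<^sub>C v) \<le> cmod c * norm v" by (rule le)
    show "cmod c * norm v \<le> norm (c *\<^sub>C v)"
    proof (cases "c = 0")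
      case False
      then have "v = inverse c *\<^sub>C c *\<^sub>C v"
        by (intro unitization.expand) (simp add: scaleC_scaleC scaleC_one)
      then have "norm v \<le> cmod (inverse c) * norm (c *\<^sub>C v)" by (metis le)
      then have "cmod c * norm v \<le> cmod c * (cmod (inverse c) * norm (c *\<^sub>C v))"
        by (rule mult_left_mono) simp
      also have "\<dots> = cmod (c * inverse c) * norm (c *\<^sub>C v)"
        by (simp only: norm_mult mult.assoc)
      finally show ?thesis using False by simp
    qed simp
  qed
  have le: "(norm v)\<^sup>2 \<le> norm (v\<^sup>\<star> * v)" for v :: "'a unitization"
  proof -
    have "norm v \<le> sqrt (norm (v\<^sup>\<star> * v))"
    proof (rule norm_unitization_le)
      fix b
      have "(norm (act v b))\<^sup>2 = norm (b\<^sup>\<star> * act (v\<^sup>\<star> * v) b)"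
        by (simp only: cstar_identity[symmetric] star_act)
      also have "\<dots> \<le> norm b * (norm (v\<^sup>\<star> * v) * norm b)"
        using norm_mult_ineq[of "b\<^sup>\<star>" "act (v\<^sup>\<star> * v) b"]
          mult_left_mono[OF act_le_norm[of "v\<^sup>\<star> * v" b] norm_ge_zero[of b]]
        by simp
      finally have "norm (act v b) \<le> sqrt (norm (v\<^sup>\<star> * v) * (norm b)\<^sup>2)"
        by (intro real_le_rsqrt) (simp add: power2_eq_square ac_simps)
      then show "norm (act v b) \<le> sqrt (norm (v\<^sup>\<star> * v)) * norm b"
        by (simp add: real_sqrt_mult)
      have "(cmod (coeff1 v))\<^sup>2 \<le> norm (v\<^sup>\<star> * v)"
        using coeff1_le_norm[of "v\<^sup>\<star> * v"] by (simp add: norm_mult power2_eq_square)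
      then show "cmod (coeff1 v) \<le> sqrt (norm (v\<^sup>\<star> * v))" by (rule real_le_rsqrt)
    qed
    then have "(norm v)\<^sup>2 \<le> (sqrt (norm (v\<^sup>\<star> * v)))\<^sup>2" by (rule power_mono) simp
    then show ?thesis by simp
  qed
  have star_le: "norm v \<le> norm (v\<^sup>\<star>)" for v :: "'a unitization"
  proof (cases "v = 0")
    case False
    have "norm v * norm v \<le> norm (v\<^sup>\<star>) * norm v"
      using order_trans[OF le[of v] norm_mult_ineq[of "v\<^sup>\<star>" v]] by (simp add: power2_eq_square)
    with False show ?thesis by simp
  qed simp
  have "norm (v\<^sup>\<star>) \<le> norm v"
    using star_le[of "v\<^sup>\<star>"] \<open>(v\<^sup>\<star>)\<^sup>\<star> = v\<close> by simp
  then have "norm (v\<^sup>\<star> * v) \<le> norm v * norm v"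
    by (rule order_trans[OF norm_mult_ineq mult_right_mono]) simp
  then show "norm (v\<^sup>\<star> * v) = (norm v)\<^sup>2"
    using le[of v] by (simp add: power2_eq_square)
next
  fix X :: "nat \<Rightarrow> 'a unitization"
  assume X: "Cauchy X"
  have "Cauchy (\<lambda>n. base (X n))" "Cauchy (\<lambda>n. coeff1 (X n))"
    by (rule bounded_linear.Cauchy[OF bounded_linear_base X]
        bounded_linear.Cauchy[OF bounded_linear_coeff1 X])+
  then obtain a c where a: "(\<lambda>n. base (X n)) \<longlonglongrightarrow> a" and c: "(\<lambda>n. coeff1 (X n)) \<longlonglongrightarrow> c"
    using Cauchy_convergent unfolding convergent_def by metis
  have bound: "norm v \<le> norm (base v) + cmod (coeff1 v)" for v :: "'a unitization"
  proof (rule norm_unitization_le)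
    fix b
    have "norm (act v b) \<le> norm (base v) * norm b + cmod (coeff1 v) * norm b"
      unfolding act_def
      by (rule order_trans[OF norm_triangle_ineq]) (simp add: norm_mult_ineq norm_scaleC)
    then show "norm (act v b) \<le> (norm (base v) + cmod (coeff1 v)) * norm b"
      by (simp add: algebra_simps)
  qed simp
  have "(\<lambda>n. norm (base (X n) - a) + cmod (coeff1 (X n) - c)) \<longlonglongrightarrow> 0"
    using tendsto_add[OF tendsto_norm_zero[OF LIM_zero[OF a]] tendsto_norm_zero[OF LIM_zero[OF c]]]
    by simp
  moreover have "\<forall>\<^sub>F n in sequentially.
      norm (X n - Adjoin a c) \<le> norm (base (X n) - a) + cmod (coeff1 (X n) - c)"
    using bound[of "X n - Adjoin a c" for n] by (simp add: always_eventually)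
  ultimately have "(\<lambda>n. X n - Adjoin a c) \<longlonglongrightarrow> 0"
    by (rule Lim_null_comparison[rotated])
  then have "X \<longlonglongrightarrow> Adjoin a c" by (rule LIM_zero_cancel)
  then show "convergent X" by (rule convergentI)
qed

end

lemma embed_star: "embed (a\<^sup>\<star>) = (embed (a::'a::cstar_algebra))\<^sup>\<star>"
  by (rule unitization.expand) simp


section \<open>Polynomials in a self-adjoint element\<close>

text \<open>The value of a real polynomial at an element of a unital real algebra.\<close>
definition peval :: "real poly \<Rightarrow> 'a::real_algebra_1 \<Rightarrow> 'a" where
  "peval p h = fold_coeffs (\<lambda>a v. a *\<^sub>R 1 + h * v) p 0"

lemma peval_0 [simp]: "peval 0 h = 0"
  by (simp add: peval_def)

lemma peval_pCons [simp]: "peval (pCons a p) h = a *\<^sub>R 1 + h * peval p h"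
  by (cases "p = 0 \<and> a = 0") (auto simp: peval_def)

lemma peval_add: "peval (p + q) h = peval p h + peval q h"
  by (induction p q rule: poly_induct2) (simp_all add: algebra_simps)

lemma peval_smult: "peval (smult c p) h = c *\<^sub>R peval p h"
  by (induction p) (simp_all add: algebra_simps)

lemma peval_minus: "peval (- p) h = - peval p h"
  using peval_smult[of "-1" p h] by simp

lemma peval_diff: "peval (p - q) h = peval p h - peval q h"
  using peval_add[of p "-q" h] by (simp add: peval_minus)

lemma peval_mult: "peval (p * q) h = peval p h * peval q h"
  by (induction p) (simp_all add: peval_add peval_smult algebra_simps)

lemma peval_1 [simp]: "peval 1 h = 1"
  by (simp add: one_pCons)

lemma peval_power: "peval (p ^ n) h = peval p h ^ n"
  by (induction n) (simp_all add: peval_mult)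

lemma peval_monom: "peval (monom c n) h = c *\<^sub>R h ^ n"
  by (induction n) (simp_all add: monom_0 monom_Suc)

lemma peval_pcompose: "peval (pcompose p q) h = peval p (peval q h)"
  by (induction p) (simp_all add: pcompose_pCons peval_add peval_mult)

lemma peval_of_real: "peval p (of_real x) = (of_real (poly p x) :: 'a::real_algebra_1)"
  by (induction p) (simp_all add: of_real_def[symmetric])

lemma peval_intertwine:
  assumes "h * d = d * k"
  shows "peval p h * d = d * peval p k"
proof (induction p)
  case (pCons a p)
  have "h * peval p h * d = d * (k * peval p k)"
    by (metis assms mult.assoc pCons.IH)
  then show ?case by (simp add: algebra_simps)
qed simp

lemma star_peval:
  fixes h :: "'a::{cstar_algebra, real_normed_algebra_1}"
  assumes "h\<^sup>\<star> = h"
  shows "(peval p h)\<^sup>\<star> = peval p h"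
  by (induction p) (simp_all add: star_add star_mult assms peval_intertwine[of h h h])

lemma peval_eq_sum: "peval p h = (\<Sum>i\<le>degree p. coeff p i *\<^sub>R h ^ i)"
proof -
  have "peval p h = (\<Sum>i\<le>degree p. peval (monom (coeff p i) i) h)"
  proof -
    have "peval (\<Sum>i\<in>I. f i) h = (\<Sum>i\<in>I. peval (f i) h)" if "finite I" for I :: "nat set" and f
      using that by (induction I rule: finite_induct) (simp_all add: peval_add)
    then show ?thesis using poly_as_sum_of_monoms[of p] by (metis finite_atMost)
  qed
  then show ?thesis by (simp add: peval_monom)
qed

lemma coeff1_peval:
  assumes "coeff1 v = of_real r"
  shows "coeff1 (peval p v) = of_real (poly p r)"
  by (induction p) (simp_all add: assms scaleR_conv_of_real[where 'a=complex])

text \<open>The coefficients of a polynomial are at most its maximum on the unit circle: average over the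
  roots of unity of an order exceeding the degree.\<close>
lemma coeff_le_sup_circle:
  fixes p :: "real poly"
  assumes B: "\<And>z::complex. cmod z = 1 \<Longrightarrow> cmod (peval p z) \<le> B"
  shows "\<bar>coeff p i\<bar> \<le> B"
proof (cases "i \<le> degree p")
  case i: True
  define N where "N = Suc (degree p)"
  define w where "w k = exp (2 * of_real pi * \<i> * of_nat k / of_nat N)" for k :: nat
  have w_power: "w k ^ j = w (k * j)" for k j
    unfolding w_def by (simp add: exp_of_nat_mult[symmetric] field_simps)
  have w_add: "w k * w j = w (k + j)" for k j
    unfolding w_def by (simp add: exp_add[symmetric] add_divide_distrib distrib_left)
  have w_norm: "cmod (w k) = 1" for k
    unfolding w_def by (simp add: norm_exp_eq_Re)
  have sum_w: "(\<Sum>k<N. w (k * j)) = (if N dvd j then of_nat N else 0)" for j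
  proof -
    have w1: "w j = 1 \<longleftrightarrow> N dvd j"
      unfolding w_def using complex_root_unity_eq_1[of N j] by (simp add: N_def)
    have wN: "w j ^ N = 1"
      unfolding w_def using complex_root_unity[of N j] by (simp add: N_def)
    have "(\<Sum>k<N. w (k * j)) = (\<Sum>k<N. w j ^ k)"
      by (simp add: w_power mult.commute)
    also have "\<dots> = (if N dvd j then of_nat N else 0)"
      using w1 wN by (auto simp: geometric_sum)
    finally show ?thesis .
  qed
  have dvd: "N dvd j + (N - i) \<longleftrightarrow> j = i" if "j \<le> degree p" for j
  proof
    assume "N dvd j + (N - i)"
    then obtain c where c: "j + (N - i) = N * c" by (elim dvdE)
    have "0 < j + (N - i)" "j + (N - i) < N * 2" using that i by (auto simp: N_def)
    with c have "0 < c" "N * c < N * 2" by (auto intro: gr0I)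
    then have "c = 1" by simp
    with c i show "j = i" by (simp add: N_def)
  qed (use i in \<open>auto simp: N_def\<close>)
  have "(\<Sum>k<N. w (k * (N - i)) * peval p (w k)) =
      (\<Sum>k<N. \<Sum>j\<le>degree p. coeff p j *\<^sub>R w (k * (j + (N - i))))"
    by (simp add: peval_eq_sum sum_distrib_left w_power w_add mult_scaleR_right
        distrib_left add.commute)
  also have "\<dots> = (\<Sum>j\<le>degree p. coeff p j *\<^sub>R (\<Sum>k<N. w (k * (j + (N - i)))))"
    by (subst sum.swap) (simp add: scaleR_sum_right)
  also have "\<dots> = (\<Sum>j\<le>degree p. if j = i then coeff p i *\<^sub>R of_nat N else 0)"
    by (intro sum.cong refl) (simp add: sum_w dvd)
  also have "\<dots> = coeff p i *\<^sub>R of_nat N" using i by simp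
  finally have "real N * \<bar>coeff p i\<bar> = cmod (\<Sum>k<N. w (k * (N - i)) * peval p (w k))"
    by (simp add: mult.commute)
  also have "\<dots> \<le> (\<Sum>k<N. B)"
    by (rule sum_norm_le) (simp add: norm_mult w_norm B)
  finally have "real N * \<bar>coeff p i\<bar> \<le> real N * B" by simp
  then show ?thesis by (simp add: N_def)
next
  case False
  moreover have "0 \<le> B" using B[of 1] norm_ge_zero order_trans norm_one by blast
  ultimately show ?thesis by (simp add: coeff_eq_0)
qed

text \<open>If \<open>u\<close> is invertible then \<open>u\<^sup>n q((u + u\<^sup>-\<^sup>1) / 2)\<close> is a polynomial in \<open>u\<close> that does not depend on the
  algebra in which \<open>u\<close> lives.\<close>
lemma laurent_clear_denominators:
  assumes "degree q \<le> n"
  shows "\<exists>r. degree r \<le> 2 * n \<and>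
    (\<forall>u v::'a::real_algebra_1. u * v = 1 \<longrightarrow> v * u = 1 \<longrightarrow>
       peval r u = u ^ n * peval q ((1/2) *\<^sub>R (u + v))) \<and>
    (\<forall>u v::complex. u * v = 1 \<longrightarrow> peval r u = u ^ n * peval q ((1/2) *\<^sub>R (u + v)))"
  using assms
proof (induction n arbitrary: q)
  case 0
  then obtain c where "q = [:c:]" by (meson degree_eq_zeroE le_zero_eq)
  then show ?case by (intro exI[of _ q]) auto
next
  case (Suc n)
  obtain a p where q: "q = pCons a p" by (metis pCons_cases)
  have "degree p \<le> n" using Suc.prems q by (auto split: if_splits)
  then obtain r where r: "degree r \<le> 2 * n"
    "\<And>u v::'a. u * v = 1 \<Longrightarrow> v * u = 1 \<Longrightarrow> peval r u = u ^ n * peval p ((1/2) *\<^sub>R (u + v))"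
    "\<And>u v::complex. u * v = 1 \<Longrightarrow> peval r u = u ^ n * peval p ((1/2) *\<^sub>R (u + v))"
    using Suc.IH by blast
  define r' where "r' = monom a (Suc n) + [:1/2, 0, 1/2:] * r"
  have "degree ([:1/2, 0, 1/2:] * r) \<le> 2 * Suc n"
    by (rule order_trans[OF degree_mult_le]) (use r(1) in simp)
  moreover have "degree (monom a (Suc n)) \<le> 2 * Suc n"
    by (rule order_trans[OF degree_monom_le]) simp
  ultimately have "degree r' \<le> 2 * Suc n" unfolding r'_def by (rule degree_add_le[rotated])
  moreover have "peval r' u = u ^ Suc n * peval q ((1/2) *\<^sub>R (u + v))"
    if "u * v = 1" "v * u = 1" for u v :: 'a
  proof -
    have r': "peval r' u =
        a *\<^sub>R u ^ Suc n + ((1/2) *\<^sub>R 1 + u * (u * ((1/2) *\<^sub>R 1))) * peval r u"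
      unfolding r'_def peval_add peval_mult peval_monom by simp
    have "(1/2) *\<^sub>R 1 + u * (u * ((1/2) *\<^sub>R 1)) = u * ((1/2) *\<^sub>R (u + v))"
      using that by (simp add: algebra_simps)
    moreover have "u * ((1/2) *\<^sub>R (u + v)) * u ^ n = u ^ Suc n * ((1/2) *\<^sub>R (u + v))"
    proof -
      have "(u + v) * u ^ n = u ^ n * (u + v)"
        by (rule power_commuting_commutes[symmetric]) (simp add: that algebra_simps)
      then show ?thesis by (simp add: mult.assoc)
    qed
    ultimately have "peval r' u =
        a *\<^sub>R u ^ Suc n + u ^ Suc n * ((1/2) *\<^sub>R (u + v)) * peval p ((1/2) *\<^sub>R (u + v))"
      unfolding r' r(2)[OF that] by (simp only: mult.assoc[symmetric])
    then show ?thesis unfolding q peval_pCons distrib_left mult.assoc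
      by (simp only: mult_scaleR_right mult_1_right)
  qed
  moreover have "peval r' u = u ^ Suc n * peval q ((1/2) *\<^sub>R (u + v))"
    if "u * v = 1" for u v :: complex
  proof -
    have r': "peval r' u =
        a *\<^sub>R u ^ Suc n + ((1/2) *\<^sub>R 1 + u * (u * ((1/2) *\<^sub>R 1))) * peval r u"
      unfolding r'_def peval_add peval_mult peval_monom by simp
    have "(1/2) *\<^sub>R 1 + u * (u * ((1/2) *\<^sub>R 1)) = u * ((1/2) *\<^sub>R (u + v))"
      using that by (simp add: algebra_simps)
    then have "peval r' u =
        a *\<^sub>R u ^ Suc n + u ^ Suc n * ((1/2) *\<^sub>R (u + v)) * peval p ((1/2) *\<^sub>R (u + v))"
      unfolding r' r(3)[OF that] by (simp only: power_Suc mult.assoc mult.left_commute)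
    then show ?thesis unfolding q peval_pCons distrib_left mult.assoc
      by (simp only: mult_scaleR_right mult_1_right)
  qed
  ultimately show ?case by blast
qed

text \<open>The square root of \<open>1 - h\<^sup>2\<close> is given by the binomial series, which converges absolutely.\<close>
lemma ex_sqrt_one_minus_square:
  fixes h :: "'a::{cstar_algebra, real_normed_algebra_1}"
  assumes h: "h\<^sup>\<star> = h" "norm h < 1"
  shows "\<exists>s. s\<^sup>\<star> = s \<and> s * h = h * s \<and> s * s = 1 - h * h"
proof -
  define z where "z = - (h * h)"
  have z: "norm z < 1" "z\<^sup>\<star> = z" "z * h = h * z"
    using h by (auto simp: z_def norm_square_selfadjoint star_mult mult.assoc abs_square_less_1)
  define c :: "nat \<Rightarrow> real" where "c n = (1/2) gchoose n" for n
  define f where "f n = c n *\<^sub>R z ^ n" for n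
  have "summable (\<lambda>n. norm (c n * norm z ^ n))"
  proof (rule powser_insidea)
    show "summable (\<lambda>n. c n * ((norm z + 1) / 2) ^ n)"
      unfolding c_def using z(1) by (intro sums_summable[OF gen_binomial_real]) auto
    show "norm (norm z) < norm ((norm z + 1) / 2)" using z(1) by simp
  qed
  then have summ: "summable (\<lambda>n. norm (f n))"
    by (rule summable_comparison_test[rotated])
      (auto intro!: exI[of _ 0] mult_left_mono norm_power_ineq simp: f_def abs_mult)
  define s where "s = (\<Sum>n. f n)"
  have s: "f sums s" unfolding s_def by (simp add: summ summable_norm_cancel summable_sums)
  have "(\<lambda>n. (f n)\<^sup>\<star>) sums s\<^sup>\<star>" by (rule bounded_linear.sums[OF bounded_linear_star s])
  moreover have "(\<lambda>n. (f n)\<^sup>\<star>) = f"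
    by (simp add: f_def star_power z(2) fun_eq_iff)
  ultimately have "f sums s\<^sup>\<star>" by simp
  then have "s\<^sup>\<star> = s" using s by (rule sums_unique2)
  moreover have "s * h = h * s"
  proof -
    have "(\<lambda>n. f n * h) sums (s * h)" "(\<lambda>n. h * f n) sums (h * s)"
      by (rule sums_mult2[OF s] sums_mult[OF s])+
    moreover have "f n * h = h * f n" for n
      using power_commuting_commutes[of z h n] z(3) by (simp add: f_def)
    ultimately show ?thesis by (simp add: sums_unique2)
  qed
  moreover have "s * s = 1 + z"
  proof -
    have coef: "(\<Sum>i\<le>k. f i * f (k - i)) = ((1::real) gchoose k) *\<^sub>R z ^ k" for k
    proof -
      have "(\<Sum>i\<le>k. f i * f (k - i)) = (\<Sum>i\<le>k. (c i * c (k - i)) *\<^sub>R z ^ k)"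
        by (intro sum.cong refl) (simp add: f_def power_add[symmetric])
      also have "\<dots> = (\<Sum>i\<in>{0..k}. c i * c (k - i)) *\<^sub>R z ^ k"
        by (simp add: scaleR_sum_left atMost_atLeast0)
      also have "(\<Sum>i\<in>{0..k}. c i * c (k - i)) = (1::real) gchoose k"
        unfolding c_def by (subst gbinomial_Vandermonde) simp
      finally show ?thesis .
    qed
    have zero: "((1::real) gchoose k) *\<^sub>R z ^ k = 0" if "k \<notin> {..1}" for k
      using that binomial_gbinomial[of 1 k, where 'a=real] by (simp add: binomial_eq_0)
    have "(\<lambda>k. \<Sum>i\<le>k. f i * f (k - i)) sums (s * s)"
      unfolding s_def by (rule Cauchy_product_sums[OF summ summ])
    moreover have "(\<lambda>k. ((1::real) gchoose k) *\<^sub>R z ^ k) sums (\<Sum>k\<le>1. ((1::real) gchoose k) *\<^sub>R z ^ k)"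
      by (rule sums_finite) (use zero in auto)
    ultimately show ?thesis unfolding coef by (simp add: sums_iff)
  qed
  ultimately show ?thesis by (auto simp: z_def)
qed

text \<open>With the unitary \<open>u = h + i s\<close>, where \<open>s\<^sup>2 = 1 - h\<^sup>2\<close>, the element \<open>u\<^sup>n q(h)\<close> is a polynomial in \<open>u\<close> of
  degree at most \<open>2n\<close>; on the unit circle this polynomial has modulus \<open>\<bar>q(Re z)\<bar>\<close>.\<close>
lemma norm_peval_le_degree:
  fixes h :: "'a::{cstar_algebra, real_normed_algebra_1}"
  assumes h: "h\<^sup>\<star> = h" "norm h < 1"
    and B: "\<And>s. \<bar>s\<bar> \<le> 1 \<Longrightarrow> \<bar>poly q s\<bar> \<le> B" and q: "degree q \<le> n"
  shows "norm (peval q h) \<le> real (2 * n + 1) * B"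
proof -
  obtain s where s: "s\<^sup>\<star> = s" "s * h = h * s" "s * s = 1 - h * h"
    using ex_sqrt_one_minus_square[OF h] by blast
  define u v where "u = h + \<i> *\<^sub>C s" and "v = h - \<i> *\<^sub>C s"
  have uv: "u * v = 1" "v * u = 1"
    unfolding u_def v_def distrib_left distrib_right left_diff_distrib right_diff_distrib
      scaleC_mult_left scaleC_mult_right scaleC_i_i s(2) s(3) scaleC_add_right scaleC_diff_right
    by simp_all
  have star_u: "u\<^sup>\<star> = v"
    by (simp add: u_def v_def star_add star_scaleC h s scaleC_minus_left)
  have h_eq: "h = (1/2) *\<^sub>R (u + v)"
    by (simp add: u_def v_def scaleR_2[symmetric])
  have nu: "norm u = 1"
    using cstar_identity[of u] by (simp add: star_u uv abs_square_eq_1[of "norm u", simplified])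
  have nv: "norm v = 1" using norm_star[of u] by (simp add: star_u nu)
  obtain r where r: "degree r \<le> 2 * n"
    "peval r u = u ^ n * peval q ((1/2) *\<^sub>R (u + v))"
    "\<And>z w::complex. z * w = 1 \<Longrightarrow> peval r z = z ^ n * peval q ((1/2) *\<^sub>R (z + w))"
    using laurent_clear_denominators[OF q, where 'a='a] uv by blast
  have B0: "0 \<le> B" using B[of 0] by simp
  have coef: "\<bar>coeff r i\<bar> \<le> B" for i
  proof (rule coeff_le_sup_circle)
    fix z :: complex
    assume z: "cmod z = 1"
    have "z * cnj z = 1" using z by (simp add: complex_norm_square[symmetric])
    moreover have "(1/2) *\<^sub>R (z + cnj z) = of_real (Re z)"
      by (simp add: complex_eq_iff)
    ultimately have "peval r z = z ^ n * of_real (poly q (Re z))"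
      using r(3)[of z "cnj z"] by (simp add: peval_of_real)
    then have "cmod (peval r z) = \<bar>poly q (Re z)\<bar>" by (simp add: norm_mult norm_power z)
    also have "\<dots> \<le> B" using abs_Re_le_cmod[of z] z by (intro B) simp
    finally show "cmod (peval r z) \<le> B" .
  qed
  have "norm (peval r u) \<le> (\<Sum>i\<le>degree r. B)"
    unfolding peval_eq_sum
  proof (rule sum_norm_le)
    fix i
    have "norm (u ^ i) \<le> 1" using norm_power_ineq[of u i] by (simp add: nu)
    then have "\<bar>coeff r i\<bar> * norm (u ^ i) \<le> B * 1" by (intro mult_mono coef B0) simp_all
    then show "norm (coeff r i *\<^sub>R u ^ i) \<le> B" by simp
  qed
  also have "\<dots> = (degree r + 1) * B" by (simp add: algebra_simps)
  also have "\<dots> \<le> real (2 * n + 1) * B" by (intro mult_right_mono B0) (use r(1) in simp)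
  finally have bound: "norm (peval r u) \<le> real (2 * n + 1) * B" .
  have "v ^ n * u ^ n = 1" for n
  proof (induction n)
    case (Suc n)
    have "v ^ Suc n * u ^ Suc n = v ^ n * (v * u) * u ^ n"
      by (simp add: power_Suc2[of v] mult.assoc del: power_Suc) (simp add: mult.assoc)
    then show ?case by (simp add: uv Suc)
  qed simp
  then have "peval q h = v ^ n * peval r u"
    unfolding r(2) h_eq[symmetric] mult.assoc[symmetric] by simp
  moreover have "norm (v ^ n) \<le> 1" using norm_power_ineq[of v n] by (simp add: nv)
  ultimately have "norm (peval q h) \<le> 1 * norm (peval r u)"
    using norm_mult_ineq[of "v ^ n" "peval r u"] mult_right_mono[of "norm (v ^ n)" 1 "norm (peval r u)"]
    by simp
  with bound show ?thesis by simp
qed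

text \<open>The factor linear in the degree disappears when the estimate is applied to large powers.\<close>
lemma norm_peval_le_strict:
  fixes h :: "'a::{cstar_algebra, real_normed_algebra_1}"
  assumes h: "h\<^sup>\<star> = h" "norm h < 1"
    and B: "\<And>s. \<bar>s\<bar> \<le> 1 \<Longrightarrow> \<bar>poly q s\<bar> \<le> B"
  shows "norm (peval q h) \<le> B"
proof (rule ccontr)
  define k where "k = peval q h"
  assume "\<not> norm (peval q h) \<le> B"
  then have Bk: "B < norm k" by (simp add: k_def)
  have B0: "0 \<le> B" using B[of 0] by simp
  define x where "x = B / norm k"
  define n where "n = degree q"
  have x: "0 \<le> x" "x < 1" using B0 Bk by (simp_all add: x_def divide_less_eq)
  have ineq: "1 \<le> (2 * (n * 2 ^ m) + 1) * x ^ (2 ^ m)" for m :: nat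
  proof -
    have "norm k ^ (2 ^ m) = norm (peval (q ^ (2 ^ m)) h)"
      unfolding k_def peval_power by (simp add: norm_power_selfadjoint star_peval h)
    also have "\<dots> \<le> real (2 * (n * 2 ^ m) + 1) * B ^ (2 ^ m)"
    proof (rule norm_peval_le_degree[OF h])
      show "\<bar>poly (q ^ (2 ^ m)) s\<bar> \<le> B ^ (2 ^ m)" if "\<bar>s\<bar> \<le> 1" for s
        using B[OF that] by (simp add: power_abs power_mono)
      show "degree (q ^ (2 ^ m)) \<le> n * 2 ^ m" unfolding n_def by (rule degree_power_le)
    qed
    finally have "norm k ^ (2 ^ m) \<le> real (2 * (n * 2 ^ m) + 1) * B ^ (2 ^ m)" .
    moreover have "0 < norm k ^ (2 ^ m)" using Bk B0 by (intro zero_less_power) linarith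
    ultimately show ?thesis by (simp add: x_def power_divide le_divide_eq algebra_simps)
  qed
  have "(\<lambda>N. real (2 * n) * (real N * x ^ N) + x ^ N) \<longlonglongrightarrow> real (2 * n) * 0 + 0"
    using x by (intro tendsto_intros powser_times_n_limit_0 LIMSEQ_power_zero) simp_all
  then have "(\<lambda>N::nat. (2 * (n * real N) + 1) * x ^ N) \<longlonglongrightarrow> 0"
    by (simp add: algebra_simps)
  moreover have "filterlim (\<lambda>m::nat. 2 ^ m :: nat) at_top sequentially"
    by (rule filterlim_subseq) (simp add: strict_mono_def)
  ultimately have "(\<lambda>m. (2 * (n * real (2 ^ m)) + 1) * x ^ (2 ^ m)) \<longlonglongrightarrow> 0"
    by (rule filterlim_compose)
  then have "(1::real) \<le> 0"
    by (rule LIMSEQ_le_const) (use ineq in \<open>simp add: add.commute\<close>)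
  then show False by simp
qed

lemma norm_peval_le:
  fixes h :: "'a::{cstar_algebra, real_normed_algebra_1}"
  assumes h: "h\<^sup>\<star> = h"
    and B: "\<And>s. \<bar>s\<bar> \<le> norm h \<Longrightarrow> \<bar>poly q s\<bar> \<le> B"
  shows "norm (peval q h) \<le> B"
proof (cases "h = 0")
  case True
  have "peval q (0::'a) = of_real (poly q 0)" using peval_of_real[of q 0, where 'a='a] by simp
  with B[of 0] True show ?thesis by simp
next
  case False
  define R where "R = norm h"
  have R: "R > 0" using False by (simp add: R_def)
  define k where "k = (1 / R) *\<^sub>R h"
  define p where "p = pcompose q [:0, R:]"
  have k: "k\<^sup>\<star> = k" "norm k = 1" using R h by (simp_all add: k_def R_def)
  have le: "norm (peval (pcompose p [:0, r:]) k) \<le> B" if r: "0 < r" "r < 1" for r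
  proof -
    have "norm (peval p (r *\<^sub>R k)) \<le> B"
    proof (rule norm_peval_le_strict)
      fix s :: real
      assume "\<bar>s\<bar> \<le> 1"
      then have "R * \<bar>s\<bar> \<le> R * 1" using R by (intro mult_left_mono) auto
      then have "\<bar>R * s\<bar> \<le> norm h" using R by (simp add: abs_mult R_def)
      then show "\<bar>poly p s\<bar> \<le> B" using B[of "R * s"] by (simp add: p_def poly_pcompose mult.commute)
    qed (use k r in simp_all)
    then show ?thesis by (simp add: peval_pcompose)
  qed
  have "continuous_on UNIV (\<lambda>r::real. peval p (r *\<^sub>R k))"
    by (induction p) (auto intro!: continuous_intros)
  then have "isCont (\<lambda>r::real. peval p (r *\<^sub>R k)) 1"
    by (simp add: continuous_on_eq_continuous_at)
  then have "((\<lambda>r. norm (peval p (r *\<^sub>R k))) \<longlongrightarrow> norm (peval p (1 *\<^sub>R k))) (at_left 1)"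
    unfolding isCont_def by (intro tendsto_norm) (rule filterlim_at_split[THEN iffD1, THEN conjunct1])
  moreover have "\<forall>\<^sub>F r in at_left (1::real). norm (peval p (r *\<^sub>R k)) \<le> B"
    unfolding eventually_at_left_field using le by (intro exI[of _ 0]) (auto simp: peval_pcompose)
  ultimately have "norm (peval p k) \<le> B" by (auto intro: tendsto_upperbound)
  moreover have "peval p k = peval q h" using R by (simp add: p_def peval_pcompose k_def)
  ultimately show ?thesis by simp
qed


section \<open>Continuous functional calculus\<close>

lemma uniform_limit_poly_exists:
  fixes f :: "real \<Rightarrow> real"
  assumes "continuous_on UNIV f"
  shows "\<exists>P. uniform_limit {-R..R} (\<lambda>n. poly (P n)) f sequentially"
proof -
  have "\<exists>p. \<forall>s\<in>{-R..R}. \<bar>f s - poly p s\<bar> < 1 / real (Suc n)" for n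
  proof -
    have "continuous_on {-R..R} f" using assms continuous_on_subset by blast
    then obtain g where g: "real_polynomial_function g"
      "\<And>s. s \<in> {-R..R} \<Longrightarrow> \<bar>f s - g s\<bar> < 1 / real (Suc n)"
      using Stone_Weierstrass_real_polynomial_function[of "{-R..R}" f "1 / real (Suc n)"] by auto
    then obtain a m where "g = (\<lambda>x. \<Sum>i\<le>m. a i * x ^ i)"
      unfolding real_polynomial_function_iff_sum by blast
    then have "g = poly (\<Sum>i\<le>m. monom (a i) i)" by (simp add: poly_sum poly_monom fun_eq_iff)
    with g(2) show ?thesis by blast
  qed
  then obtain P where P: "\<And>n s. s \<in> {-R..R} \<Longrightarrow> \<bar>f s - poly (P n) s\<bar> < 1 / real (Suc n)"
    by metis
  have "uniform_limit {-R..R} (\<lambda>n. poly (P n)) f sequentially"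
  proof (rule uniform_limitI)
    fix e :: real
    assume "0 < e"
    then obtain N where N: "1 / real (Suc N) < e" using nat_approx_posE by blast
    have "\<bar>f s - poly (P n) s\<bar> < e" if "s \<in> {-R..R}" "N \<le> n" for s n
    proof -
      have "1 / real (Suc n) \<le> 1 / real (Suc N)" using that(2) by (simp add: frac_le)
      with P[OF that(1), of n] N show ?thesis by linarith
    qed
    then show "\<forall>\<^sub>F n in sequentially. \<forall>s\<in>{-R..R}. dist (poly (P n) s) (f s) < e"
      unfolding eventually_sequentially dist_real_def
      by (intro exI[of _ N]) (simp add: abs_minus_commute)
  qed
  then show ?thesis by blast
qed

text \<open>\<open>cfc f h\<close> is \<open>f(h)\<close>: the limit of \<open>p\<^sub>n(h)\<close> for polynomials \<open>p\<^sub>n\<close> converging to \<open>f\<close>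
  uniformly on the interval from \<open>-\<parallel>h\<parallel>\<close> to \<open>\<parallel>h\<parallel>\<close>, which contains the spectrum. It is meaningful
  for self-adjoint \<open>h\<close> and continuous \<open>f\<close>.\<close>
definition cfc :: "(real \<Rightarrow> real) \<Rightarrow> 'a::{cstar_algebra, real_normed_algebra_1} \<Rightarrow> 'a" where
  "cfc f h = lim (\<lambda>n. peval
    ((SOME P. uniform_limit {- norm h..norm h} (\<lambda>n. poly (P n)) f sequentially) n) h)"

lemma peval_diff_tendsto_0:
  fixes h :: "'a::{cstar_algebra, real_normed_algebra_1}"
  assumes h: "h\<^sup>\<star> = h"
    and P: "uniform_limit {- norm h..norm h} (\<lambda>n. poly (P n)) f sequentially"
    and Q: "uniform_limit {- norm h..norm h} (\<lambda>n. poly (Q n)) f sequentially"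
    and e: "0 < e"
  shows "\<exists>N. \<forall>m\<ge>N. \<forall>n\<ge>N. norm (peval (P m) h - peval (Q n) h) < e"
proof -
  have e4: "0 < e / 4" using e by simp
  obtain N1 where N1: "\<And>n s. N1 \<le> n \<Longrightarrow> s \<in> {- norm h..norm h} \<Longrightarrow> \<bar>poly (P n) s - f s\<bar> < e / 4"
    using uniform_limitD[OF P e4] unfolding eventually_sequentially dist_real_def by blast
  obtain N2 where N2: "\<And>n s. N2 \<le> n \<Longrightarrow> s \<in> {- norm h..norm h} \<Longrightarrow> \<bar>poly (Q n) s - f s\<bar> < e / 4"
    using uniform_limitD[OF Q e4] unfolding eventually_sequentially dist_real_def by blast
  have "norm (peval (P m) h - peval (Q n) h) < e" if "max N1 N2 \<le> m" "max N1 N2 \<le> n" for m n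
  proof -
    have "norm (peval (P m - Q n) h) \<le> e / 2"
    proof (rule norm_peval_le[OF h])
      fix s
      assume "\<bar>s\<bar> \<le> norm h"
      then have "s \<in> {- norm h..norm h}" by auto
      then show "\<bar>poly (P m - Q n) s\<bar> \<le> e / 2"
        using N1[of m s] N2[of n s] that
        unfolding poly_diff by (simp add: abs_if split: if_splits)
    qed
    with e show ?thesis by (simp add: peval_diff)
  qed
  then show ?thesis by blast
qed

lemma cfc_tendsto:
  fixes h :: "'a::{cstar_algebra, real_normed_algebra_1}"
  assumes h: "h\<^sup>\<star> = h" and R: "norm h \<le> R"
    and P: "uniform_limit {-R..R} (\<lambda>n. poly (P n)) f sequentially"
  shows "(\<lambda>n. peval (P n) h) \<longlonglongrightarrow> cfc f h"
proof -
  have P': "uniform_limit {- norm h..norm h} (\<lambda>n. poly (P n)) f sequentially"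
    by (rule uniform_limit_on_subset[OF P]) (use R in auto)
  define Q where "Q = (SOME P. uniform_limit {- norm h..norm h} (\<lambda>n. poly (P n)) f sequentially)"
  have Q: "uniform_limit {- norm h..norm h} (\<lambda>n. poly (Q n)) f sequentially"
    unfolding Q_def by (rule someI[of _ P]) (rule P')
  have "Cauchy (\<lambda>n. peval (Q n) h)"
    by (rule CauchyI) (use peval_diff_tendsto_0[OF h Q Q] in blast)
  then have lim: "(\<lambda>n. peval (Q n) h) \<longlonglongrightarrow> cfc f h"
    unfolding cfc_def Q_def[symmetric] by (simp add: Cauchy_convergent_iff convergent_LIMSEQ_iff)
  have "(\<lambda>n. peval (P n) h - peval (Q n) h) \<longlonglongrightarrow> 0"
    by (rule LIMSEQ_I) (use peval_diff_tendsto_0[OF h P' Q] in force)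
  from tendsto_add[OF this lim] show ?thesis by simp
qed

lemma cfc_poly:
  assumes "h\<^sup>\<star> = h"
  shows "cfc (poly p) h = peval p h"
  using cfc_tendsto[OF assms order_refl uniform_limit_const, of p] LIMSEQ_unique tendsto_const
  by blast

lemma cfc_id: "h\<^sup>\<star> = h \<Longrightarrow> cfc (\<lambda>s. s) h = h"
  using cfc_poly[of h "[:0, 1:]"] by (simp add: poly_pCons[abs_def])

lemma cfc_const: "h\<^sup>\<star> = h \<Longrightarrow> cfc (\<lambda>s. c) h = c *\<^sub>R 1"
  using cfc_poly[of h "[:c:]"] by (simp add: poly_pCons[abs_def])

lemma cfc_norm_le:
  fixes h :: "'a::{cstar_algebra, real_normed_algebra_1}"
  assumes h: "h\<^sup>\<star> = h" and f: "continuous_on UNIV f"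
    and B: "\<And>s. \<bar>s\<bar> \<le> norm h \<Longrightarrow> \<bar>f s\<bar> \<le> B"
  shows "norm (cfc f h) \<le> B"
proof (rule field_le_epsilon)
  fix e :: real
  assume e: "0 < e"
  obtain P where P: "uniform_limit {- norm h..norm h} (\<lambda>n. poly (P n)) f sequentially"
    using uniform_limit_poly_exists[OF f] by blast
  have "\<forall>\<^sub>F n in sequentially. norm (peval (P n) h) \<le> B + e"
    using uniform_limitD[OF P e]
  proof (rule eventually_mono)
    fix n
    assume n: "\<forall>s\<in>{- norm h..norm h}. dist (poly (P n) s) (f s) < e"
    show "norm (peval (P n) h) \<le> B + e"
    proof (rule norm_peval_le[OF h])
      fix s
      assume s: "\<bar>s\<bar> \<le> norm h"
      then have "\<bar>poly (P n) s - f s\<bar> < e" using n by (simp add: dist_real_def abs_le_iff)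
      then show "\<bar>poly (P n) s\<bar> \<le> B + e" using B[OF s] by linarith
    qed
  qed
  then show "norm (cfc f h) \<le> B + e"
    by (rule tendsto_upperbound[OF tendsto_norm[OF cfc_tendsto[OF h order_refl P]]]) simp
qed

lemma cfc_add:
  assumes h: "h\<^sup>\<star> = h" and f: "continuous_on UNIV f" and g: "continuous_on UNIV g"
  shows "cfc (\<lambda>s. f s + g s) h = cfc f h + cfc g h"
proof -
  obtain P Q where P: "uniform_limit {- norm h..norm h} (\<lambda>n. poly (P n)) f sequentially"
    and Q: "uniform_limit {- norm h..norm h} (\<lambda>n. poly (Q n)) g sequentially"
    using uniform_limit_poly_exists[OF f] uniform_limit_poly_exists[OF g] by blast
  have "uniform_limit {- norm h..norm h} (\<lambda>n. poly (P n + Q n)) (\<lambda>s. f s + g s) sequentially"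
    using uniform_limit_add[OF P Q] by (simp add: poly_add[abs_def])
  from cfc_tendsto[OF h order_refl this]
  have "(\<lambda>n. peval (P n) h + peval (Q n) h) \<longlonglongrightarrow> cfc (\<lambda>s. f s + g s) h"
    by (simp add: peval_add)
  moreover have "(\<lambda>n. peval (P n) h + peval (Q n) h) \<longlonglongrightarrow> cfc f h + cfc g h"
    by (intro tendsto_add cfc_tendsto[OF h order_refl] P Q)
  ultimately show ?thesis by (rule LIMSEQ_unique)
qed

lemma cfc_mult:
  assumes h: "h\<^sup>\<star> = h" and f: "continuous_on UNIV f" and g: "continuous_on UNIV g"
  shows "cfc (\<lambda>s. f s * g s) h = cfc f h * cfc g h"
proof -
  obtain P Q where P: "uniform_limit {- norm h..norm h} (\<lambda>n. poly (P n)) f sequentially"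
    and Q: "uniform_limit {- norm h..norm h} (\<lambda>n. poly (Q n)) g sequentially"
    using uniform_limit_poly_exists[OF f] uniform_limit_poly_exists[OF g] by blast
  have bdd: "bounded (f ` {- norm h..norm h})" if "continuous_on UNIV f" for f :: "real \<Rightarrow> real"
    by (intro compact_imp_bounded compact_continuous_image continuous_on_subset[OF that]) auto
  have "uniform_limit {- norm h..norm h} (\<lambda>n. poly (P n * Q n)) (\<lambda>s. f s * g s) sequentially"
    using uniform_lim_mult[OF P Q bdd[OF f] bdd[OF g]] by (simp add: poly_mult[abs_def])
  from cfc_tendsto[OF h order_refl this]
  have "(\<lambda>n. peval (P n) h * peval (Q n) h) \<longlonglongrightarrow> cfc (\<lambda>s. f s * g s) h"
    by (simp add: peval_mult)
  moreover have "(\<lambda>n. peval (P n) h * peval (Q n) h) \<longlonglongrightarrow> cfc f h * cfc g h"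
    by (intro tendsto_mult cfc_tendsto[OF h order_refl] P Q)
  ultimately show ?thesis by (rule LIMSEQ_unique)
qed

lemma cfc_scaleR:
  assumes "h\<^sup>\<star> = h" "continuous_on UNIV f"
  shows "cfc (\<lambda>s. c * f s) h = c *\<^sub>R cfc f h"
  using cfc_mult[OF assms(1) continuous_on_const assms(2), of c] by (simp add: cfc_const assms(1))

lemma cfc_diff:
  assumes "h\<^sup>\<star> = h" "continuous_on UNIV f" "continuous_on UNIV g"
  shows "cfc (\<lambda>s. f s - g s) h = cfc f h - cfc g h"
proof -
  have "cfc (\<lambda>s. f s + (-1) * g s) h = cfc f h + cfc (\<lambda>s. (-1) * g s) h"
    by (intro cfc_add assms continuous_intros)
  also have "cfc (\<lambda>s. (-1) * g s) h = (-1) *\<^sub>R cfc g h" by (intro cfc_scaleR assms)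
  finally show ?thesis by simp
qed

lemma cfc_eq_0:
  assumes "h\<^sup>\<star> = h" "continuous_on UNIV f" "\<And>s. \<bar>s\<bar> \<le> norm h \<Longrightarrow> f s = 0"
  shows "cfc f h = 0"
  using cfc_norm_le[OF assms(1,2), of 0] assms(3) by simp

lemma star_cfc:
  assumes h: "h\<^sup>\<star> = h" and f: "continuous_on UNIV f"
  shows "(cfc f h)\<^sup>\<star> = cfc f h"
proof -
  obtain P where P: "uniform_limit {- norm h..norm h} (\<lambda>n. poly (P n)) f sequentially"
    using uniform_limit_poly_exists[OF f] by blast
  note lim = cfc_tendsto[OF h order_refl P]
  have "(\<lambda>n. (peval (P n) h)\<^sup>\<star>) \<longlonglongrightarrow> (cfc f h)\<^sup>\<star>"
    by (rule bounded_linear.tendsto[OF bounded_linear_star lim])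
  then show ?thesis using lim LIMSEQ_unique by (simp add: star_peval h)
qed

lemma cfc_intertwine:
  assumes h: "h\<^sup>\<star> = h" and k: "k\<^sup>\<star> = k" and f: "continuous_on UNIV f" and hd: "h * d = d * k"
  shows "cfc f h * d = d * cfc f k"
proof -
  define R where "R = max (norm h) (norm k)"
  obtain P where P: "uniform_limit {-R..R} (\<lambda>n. poly (P n)) f sequentially"
    using uniform_limit_poly_exists[OF f] by blast
  have "(\<lambda>n. peval (P n) h * d) \<longlonglongrightarrow> cfc f h * d"
    by (intro tendsto_mult tendsto_const cfc_tendsto[OF h _ P]) (simp add: R_def)
  moreover have "(\<lambda>n. d * peval (P n) k) \<longlonglongrightarrow> d * cfc f k"
    by (intro tendsto_mult tendsto_const cfc_tendsto[OF k _ P]) (simp add: R_def)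
  ultimately show ?thesis unfolding peval_intertwine[OF hd] by (rule LIMSEQ_unique)
qed

lemma cfc_peval:
  assumes h: "h\<^sup>\<star> = h" and f: "continuous_on UNIV f"
  shows "cfc f (peval q h) = cfc (\<lambda>s. f (poly q s)) h"
proof -
  define I where "I = {- norm h..norm h}"
  have "bounded (poly q ` I)"
    unfolding I_def by (intro compact_imp_bounded compact_continuous_image continuous_intros) simp
  then obtain C where C: "\<And>s. s \<in> I \<Longrightarrow> \<bar>poly q s\<bar> \<le> C"
    unfolding bounded_iff by auto
  define R where "R = max (norm (peval q h)) C"
  obtain P where P: "uniform_limit {-R..R} (\<lambda>n. poly (P n)) f sequentially"
    using uniform_limit_poly_exists[OF f] by blast
  have "(\<lambda>n. peval (P n) (peval q h)) \<longlonglongrightarrow> cfc f (peval q h)"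
    by (rule cfc_tendsto[OF star_peval[OF h] _ P]) (simp add: R_def)
  moreover have "uniform_limit I (\<lambda>n. poly (pcompose (P n) q)) (\<lambda>s. f (poly q s)) sequentially"
  proof (rule uniform_limitI)
    fix e :: real
    assume "0 < e"
    have "poly q s \<in> {-R..R}" if "s \<in> I" for s
      using C[OF that] unfolding R_def by auto
    then show "\<forall>\<^sub>F n in sequentially. \<forall>s\<in>I. dist (poly (pcompose (P n) q) s) (f (poly q s)) < e"
      using eventually_mono[OF uniform_limitD[OF P \<open>0 < e\<close>]] by (simp add: poly_pcompose)
  qed
  then have "(\<lambda>n. peval (pcompose (P n) q) h) \<longlonglongrightarrow> cfc (\<lambda>s. f (poly q s)) h"
    unfolding I_def by (rule cfc_tendsto[OF h order_refl])
  ultimately show ?thesis unfolding peval_pcompose by (rule LIMSEQ_unique)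
qed

lemma coeff1_cfc:
  fixes v :: "'a::cstar_algebra unitization"
  assumes v: "v\<^sup>\<star> = v" "coeff1 v = 0" and f: "continuous_on UNIV f" and f0: "f 0 = 0"
  shows "coeff1 (cfc f v) = 0"
proof -
  obtain P where P: "uniform_limit {- norm v..norm v} (\<lambda>n. poly (P n)) f sequentially"
    using uniform_limit_poly_exists[OF f] by blast
  have "(\<lambda>n. coeff1 (peval (P n) v)) \<longlonglongrightarrow> coeff1 (cfc f v)"
    by (rule bounded_linear.tendsto[OF bounded_linear_coeff1 cfc_tendsto[OF v(1) order_refl P]])
  then have "(\<lambda>n. complex_of_real (poly (P n) 0)) \<longlonglongrightarrow> coeff1 (cfc f v)"
    using coeff1_peval[of v 0] v(2) by simp
  moreover have "(\<lambda>n. poly (P n) 0) \<longlonglongrightarrow> f 0"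
    by (rule tendsto_uniform_limitI[OF P]) simp
  then have "(\<lambda>n. complex_of_real (poly (P n) 0)) \<longlonglongrightarrow> of_real (f 0)"
    by (rule tendsto_of_real)
  ultimately show ?thesis using LIMSEQ_unique f0 by fastforce
qed


section \<open>Positive elements\<close>

text \<open>Positivity of a self-adjoint element \<open>h\<close>, expressed as \<open>\<parallel>t - h\<parallel> \<le> t\<close> for some \<open>t\<close>, which is visibly
  preserved by sums. It says that the spectrum of \<open>h\<close> contains no negative number.\<close>
definition spectrally_positive :: "'a::{cstar_algebra, real_normed_algebra_1} \<Rightarrow> bool" where
  "spectrally_positive h \<longleftrightarrow> h\<^sup>\<star> = h \<and> (\<exists>t\<ge>0. norm (t *\<^sub>R 1 - h) \<le> t)"

lemma spectrally_positive_star: "spectrally_positive h \<Longrightarrow> h\<^sup>\<star> = h"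
  by (simp add: spectrally_positive_def)

lemma spectrally_positive_add:
  assumes "spectrally_positive h" "spectrally_positive k"
  shows "spectrally_positive (h + k)"
proof -
  obtain s t where st: "0 \<le> s" "norm (s *\<^sub>R 1 - h) \<le> s" "0 \<le> t" "norm (t *\<^sub>R 1 - k) \<le> t"
    using assms by (auto simp: spectrally_positive_def)
  have "norm ((s + t) *\<^sub>R 1 - (h + k)) \<le> norm (s *\<^sub>R 1 - h) + norm (t *\<^sub>R 1 - k)"
    using norm_triangle_ineq[of "s *\<^sub>R 1 - h" "t *\<^sub>R 1 - k"] by (simp add: algebra_simps)
  with st have "0 \<le> s + t" "norm ((s + t) *\<^sub>R 1 - (h + k)) \<le> s + t" by linarith+
  then show ?thesis using assms unfolding spectrally_positive_def by (auto simp: star_add)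
qed

lemma spectrally_positive_scaleR:
  assumes "spectrally_positive h" "0 \<le> r"
  shows "spectrally_positive (r *\<^sub>R h)"
proof -
  obtain t where t: "0 \<le> t" "norm (t *\<^sub>R 1 - h) \<le> t"
    using assms by (auto simp: spectrally_positive_def)
  have "(r * t) *\<^sub>R 1 - r *\<^sub>R h = r *\<^sub>R (t *\<^sub>R 1 - h)" by (simp add: scaleR_right_diff_distrib)
  then have "norm ((r * t) *\<^sub>R 1 - r *\<^sub>R h) \<le> r * t"
    using mult_left_mono[OF t(2) assms(2)] assms(2) by simp
  then show ?thesis
    using assms t unfolding spectrally_positive_def by (auto intro!: exI[of _ "r * t"])
qed

lemma spectrally_positive_square:
  assumes m: "m\<^sup>\<star> = m"
  shows "spectrally_positive (m * m)"
proof -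
  define t where "t = (norm m)\<^sup>2"
  have "norm (peval [:t, 0, -1:] m) \<le> t"
  proof (rule norm_peval_le[OF m])
    fix s
    assume "\<bar>s\<bar> \<le> norm m"
    then have "s\<^sup>2 \<le> t" unfolding t_def by (metis abs_le_square_iff abs_norm_cancel)
    then show "\<bar>poly [:t, 0, -1:] s\<bar> \<le> t" by (simp add: power2_eq_square)
  qed
  then show ?thesis
    unfolding spectrally_positive_def by (intro conjI exI[of _ t]) (simp_all add: star_mult m t_def)
qed

lemma spectrally_positive_norm_minus:
  assumes "D\<^sup>\<star> = D"
  shows "spectrally_positive (norm D *\<^sub>R 1 - D)"
  unfolding spectrally_positive_def by (intro conjI exI[of _ "norm D"]) (simp_all add: assms)

lemma cfc_spectrally_positive_eq_0:
  assumes k: "spectrally_positive k" and f: "continuous_on UNIV f" and f0: "\<And>s. 0 \<le> s \<Longrightarrow> f s = 0"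
  shows "cfc f k = 0"
proof -
  obtain t where t: "norm (t *\<^sub>R 1 - k) \<le> t" using k by (auto simp: spectrally_positive_def)
  define w where "w = t *\<^sub>R 1 - k"
  have w: "w\<^sup>\<star> = w" using spectrally_positive_star[OF k] by (simp add: w_def)
  have "cfc f k = cfc f (peval [:t, -1:] w)" by (simp add: w_def)
  also have "\<dots> = cfc (\<lambda>s. f (poly [:t, -1:] s)) w" by (rule cfc_peval[OF w f])
  also have "\<dots> = 0"
  proof (rule cfc_eq_0[OF w])
    show "continuous_on UNIV (\<lambda>s. f (poly [:t, -1:] s))"
      by (rule continuous_on_compose2[OF f]) (auto intro!: continuous_intros)
    show "f (poly [:t, -1:] s) = 0" if "\<bar>s\<bar> \<le> norm w" for s
      using that t by (intro f0) (auto simp: w_def)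
  qed
  finally show ?thesis .
qed

lemma cfc_max_0_eq_0:
  assumes "spectrally_positive (- k)"
  shows "cfc (\<lambda>s. max s 0) k = 0"
proof -
  have k: "(- k)\<^sup>\<star> = - k" by (rule spectrally_positive_star[OF assms])
  have "cfc (\<lambda>s. max s 0) (peval [:0, -1:] (- k)) = cfc (\<lambda>s. max (poly [:0, -1:] s) 0) (- k)"
    by (rule cfc_peval[OF k]) (intro continuous_intros)
  also have "\<dots> = 0"
    by (rule cfc_spectrally_positive_eq_0[OF assms]) (auto intro!: continuous_intros)
  finally show ?thesis by simp
qed

lemma cfc_pos_neg_parts:
  assumes h: "h\<^sup>\<star> = h"
  shows "h = cfc (\<lambda>s. max s 0) h - cfc (\<lambda>s. max (- s) 0) h"
proof -
  have "(\<lambda>s::real. s) = (\<lambda>s. max s 0 - max (- s) 0)" by (auto simp: max_def)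
  then have "cfc (\<lambda>s. s) h = cfc (\<lambda>s. max s 0 - max (- s) 0) h" by (rule arg_cong)
  then show ?thesis using h by (simp add: cfc_id cfc_diff continuous_intros)
qed

lemma cfc_max_0_sqrt:
  assumes h: "h\<^sup>\<star> = h"
  shows "cfc (\<lambda>s. max s 0) h = cfc (\<lambda>s. sqrt (max s 0)) h * cfc (\<lambda>s. sqrt (max s 0)) h"
proof -
  have "cfc (\<lambda>s. max s 0) h = cfc (\<lambda>s. sqrt (max s 0) * sqrt (max s 0)) h"
    by simp
  then show ?thesis using h by (simp only: cfc_mult continuous_intros)
qed

lemma cfc_sqrt_if_no_neg_part:
  assumes h: "h\<^sup>\<star> = h" and "cfc (\<lambda>s. max (- s) 0) h = 0"
  shows "cfc (\<lambda>s. sqrt (max s 0)) h * cfc (\<lambda>s. sqrt (max s 0)) h = h"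
proof -
  have "cfc (\<lambda>s. max s 0) h = h + cfc (\<lambda>s. max (- s) 0) h"
    using cfc_pos_neg_parts[OF h] by (simp only: eq_diff_eq)
  then show ?thesis by (simp only: cfc_max_0_sqrt[OF h, symmetric] assms(2) add_0_right)
qed

lemma selfadjoint_decomposition:
  fixes d :: "'a::cstar_algebra"
  obtains u v where "u\<^sup>\<star> = u" "v\<^sup>\<star> = v" "d = u + \<i> *\<^sub>C v"
proof
  define u v where "u = (1/2) *\<^sub>R (d + d\<^sup>\<star>)" and "v = (1/2) *\<^sub>R (\<i> *\<^sub>C (d\<^sup>\<star> - d))"
  show "u\<^sup>\<star> = u" by (simp add: u_def star_add star_star add.commute)
  show "v\<^sup>\<star> = v"
    by (simp add: v_def star_scaleC star_star scaleC_minus_left scaleC_diff_right)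
  have "\<i> *\<^sub>C v = (1/2) *\<^sub>R (d - d\<^sup>\<star>)"
    by (simp add: v_def scaleC_scaleR scaleC_i_i)
  then have "u + \<i> *\<^sub>C v = (1/2) *\<^sub>R (d + d)"
    unfolding u_def by (simp only: scaleR_add_right[symmetric]) simp
  then show "d = u + \<i> *\<^sub>C v" by (simp add: scaleR_2[symmetric])
qed

text \<open>With \<open>h = b\<^sup>* b\<close>, \<open>f(s) = max(-s, 0)\<close> and \<open>d = b f(h)\<close>, the element \<open>d\<^sup>* d = - f(h)\<^sup>3\<close> is negative
  while \<open>d d\<^sup>* = 2u\<^sup>2 + 2v\<^sup>2 - d\<^sup>* d\<close> is positive, where \<open>d = u + i v\<close>. As \<open>d\<close> intertwines the two,
  both vanish, so \<open>h\<close> has no negative part.\<close>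
theorem spectrally_positive_star_mult:
  fixes b :: "'a::{cstar_algebra, real_normed_algebra_1}"
  shows "spectrally_positive (b\<^sup>\<star> * b)"
proof -
  define h where "h = b\<^sup>\<star> * b"
  have h: "h\<^sup>\<star> = h" by (simp add: h_def star_mult star_star)
  define f :: "real \<Rightarrow> real" where "f s = max (- s) 0" for s
  have f_eq: "f = (\<lambda>s. max (- s) 0)" by (simp add: f_def fun_eq_iff)
  have f: "continuous_on UNIV f" unfolding f_def by (intro continuous_intros)
  define d where "d = b * cfc f h"
  have dd: "d\<^sup>\<star> * d = cfc f h * h * cfc f h"
    by (simp add: d_def star_mult star_cfc[OF h f] mult.assoc) (simp add: h_def mult.assoc)
  define m where "m = cfc (\<lambda>s. f s * sqrt (f s)) h"
  have m: "m\<^sup>\<star> = m" unfolding m_def by (intro star_cfc h continuous_intros f)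
  have "cfc f h * h * cfc f h = cfc (\<lambda>s. f s * s * f s) h"
    by (simp only: cfc_mult[OF h] cfc_id[OF h] f continuous_intros)
  also have "(\<lambda>s. f s * s * f s) = (\<lambda>s. (-1) * ((f s * sqrt (f s)) * (f s * sqrt (f s))))"
  proof
    fix s
    have "sqrt (f s) * sqrt (f s) = f s" by (simp add: f_def)
    then have "(f s * sqrt (f s)) * (f s * sqrt (f s)) = f s * f s * f s"
      by (metis mult.assoc mult.commute)
    moreover have "f s * s = - (f s * f s)" "0 \<le> f s" by (simp_all add: f_def max_def)
    ultimately show "f s * s * f s = (-1) * ((f s * sqrt (f s)) * (f s * sqrt (f s)))"
      by simp
  qed
  also have "cfc \<dots> h = - (m * m)"
    unfolding m_def
    by (subst cfc_scaleR[OF h], intro continuous_intros f, subst cfc_mult[OF h])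
      (auto intro!: continuous_intros f)
  finally have dd_m: "d\<^sup>\<star> * d = - (m * m)" using dd by simp
  obtain u v where uv: "u\<^sup>\<star> = u" "v\<^sup>\<star> = v" "d = u + \<i> *\<^sub>C v"
    by (rule selfadjoint_decomposition)
  have "d * d\<^sup>\<star> + d\<^sup>\<star> * d = (u * u + u * u) + (v * v + v * v)"
    unfolding uv(3) star_add star_scaleC uv(1,2) distrib_left distrib_right scaleC_mult_left
      scaleC_mult_right by (simp add: scaleC_minus_left scaleC_minus_right
        scaleC_add_right scaleC_diff_right scaleC_i_i)
  then have "d * d\<^sup>\<star> = (u * u + u * u) + (v * v + v * v) + m * m"
    using dd_m by (simp add: algebra_simps)
  then have pos: "spectrally_positive (d * d\<^sup>\<star>)"
    by (simp only: spectrally_positive_add spectrally_positive_square uv m)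
  have "d * d\<^sup>\<star> * d = d * (d\<^sup>\<star> * d)" by (simp add: mult.assoc)
  then have "cfc f (d * d\<^sup>\<star>) * d = d * cfc f (d\<^sup>\<star> * d)"
    by (intro cfc_intertwine f) (simp_all add: star_mult star_star)
  moreover have "cfc f (d * d\<^sup>\<star>) = 0"
    by (rule cfc_spectrally_positive_eq_0[OF pos f]) (simp add: f_def)
  ultimately have "d * cfc f (d\<^sup>\<star> * d) = 0" by simp
  moreover have "cfc f (d\<^sup>\<star> * d) = - (d\<^sup>\<star> * d)"
  proof -
    have sa: "(d\<^sup>\<star> * d)\<^sup>\<star> = d\<^sup>\<star> * d" by (simp add: star_mult star_star)
    have "cfc (\<lambda>s. max s 0) (d\<^sup>\<star> * d) = 0"
      by (rule cfc_max_0_eq_0) (simp add: dd_m spectrally_positive_square m)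
    moreover have "d\<^sup>\<star> * d = cfc (\<lambda>s. max s 0) (d\<^sup>\<star> * d) - cfc f (d\<^sup>\<star> * d)"
      unfolding f_eq by (rule cfc_pos_neg_parts[OF sa])
    moreover have "B = 0 \<Longrightarrow> A = B - C \<Longrightarrow> C = - A" for A B C :: 'a by simp
    ultimately show ?thesis by blast
  qed
  ultimately have "d * (d\<^sup>\<star> * d) = 0" by simp
  then have "(d\<^sup>\<star> * d)\<^sup>\<star> * (d\<^sup>\<star> * d) = 0" by (simp add: star_mult star_star mult.assoc)
  then have "d = 0" by (rule star_mult_self_eq_0[OF star_mult_self_eq_0])
  then have "m * m = 0" using dd_m by simp
  then have m0: "m = 0" using star_mult_self_eq_0[of m] m by simp
  have "cfc f h = 0"
  proof -
    have k: "(cfc f h)\<^sup>\<star> = cfc f h" by (rule star_cfc[OF h f])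
    have "(\<lambda>s. f s * f s) = (\<lambda>s. (f s * sqrt (f s)) * sqrt (f s))"
      by (simp add: f_def fun_eq_iff)
    then have "cfc (\<lambda>s. f s * f s) h = cfc (\<lambda>s. (f s * sqrt (f s)) * sqrt (f s)) h"
      by (rule arg_cong)
    also have "\<dots> = m * cfc (\<lambda>s. sqrt (f s)) h"
      unfolding m_def by (intro cfc_mult h continuous_intros f)
    finally have "(cfc f h)\<^sup>\<star> * cfc f h = 0" by (simp only: k cfc_mult[OF h f f] m0 mult_zero_left)
    then show ?thesis by (rule star_mult_self_eq_0)
  qed
  then have "cfc (\<lambda>s. sqrt (max s 0)) h * cfc (\<lambda>s. sqrt (max s 0)) h = h"
    unfolding f_eq by (rule cfc_sqrt_if_no_neg_part[OF h])
  moreover have "spectrally_positive (cfc (\<lambda>s. sqrt (max s 0)) h * cfc (\<lambda>s. sqrt (max s 0)) h)"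
    by (rule spectrally_positive_square, rule star_cfc[OF h], intro continuous_intros)
  ultimately show ?thesis unfolding h_def[symmetric] by (simp only:)
qed

lemma spectrally_positive_sqrt:
  assumes h: "spectrally_positive h"
  shows "cfc (\<lambda>s. sqrt (max s 0)) h * cfc (\<lambda>s. sqrt (max s 0)) h = h"
proof -
  have "cfc (\<lambda>s. max (- s) 0) h = 0"
    by (rule cfc_spectrally_positive_eq_0[OF h]) (auto intro!: continuous_intros)
  then show ?thesis by (rule cfc_sqrt_if_no_neg_part[OF spectrally_positive_star[OF h]])
qed

text \<open>In the order given by positivity, \<open>-D \<le> R \<le> D\<close> implies \<open>\<parallel>R\<parallel> \<le> \<parallel>D\<parallel>\<close>.\<close>
lemma norm_le_if_between:
  assumes minus: "spectrally_positive (D - R)" and plus: "spectrally_positive (D + R)"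
  shows "norm R \<le> norm D"
proof -
  define d where "d = norm D"
  have "((D + R) + (D - R))\<^sup>\<star> = (D + R) + (D - R)"
    by (rule spectrally_positive_star[OF spectrally_positive_add[OF plus minus]])
  moreover have "(D + R) + (D - R) = 2 *\<^sub>R D" by (simp add: scaleR_2)
  ultimately have "(2 *\<^sub>R D)\<^sup>\<star> = 2 *\<^sub>R D" by (simp only:)
  then have D: "D\<^sup>\<star> = D" by simp
  have R: "R\<^sup>\<star> = R"
    using spectrally_positive_star[OF plus] by (simp only: star_add D add_left_cancel)
  have dD: "spectrally_positive (d *\<^sub>R 1 - D)"
    unfolding d_def by (rule spectrally_positive_norm_minus[OF D])
  have p1: "spectrally_positive (d *\<^sub>R 1 - R)"
    using spectrally_positive_add[OF dD minus] by simp
  have p2: "spectrally_positive (d *\<^sub>R 1 + R)"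
    using spectrally_positive_add[OF dD plus] by simp
  have zero1: "cfc (\<lambda>s. max (s - d) 0) R = 0"
  proof -
    have "cfc (\<lambda>s. max (s - d) 0) (peval [:d, -1:] (d *\<^sub>R 1 - R)) =
        cfc (\<lambda>s. max (poly [:d, -1:] s - d) 0) (d *\<^sub>R 1 - R)"
      by (intro cfc_peval spectrally_positive_star[OF p1] continuous_intros)
    also have "\<dots> = 0"
      by (rule cfc_spectrally_positive_eq_0[OF p1]) (auto intro!: continuous_intros)
    finally show ?thesis by simp
  qed
  have zero2: "cfc (\<lambda>s. max (- s - d) 0) R = 0"
  proof -
    have "cfc (\<lambda>s. max (- s - d) 0) (peval [:- d, 1:] (d *\<^sub>R 1 + R)) =
        cfc (\<lambda>s. max (- poly [:- d, 1:] s - d) 0) (d *\<^sub>R 1 + R)"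
      by (intro cfc_peval spectrally_positive_star[OF p2] continuous_intros)
    also have "\<dots> = 0"
      by (rule cfc_spectrally_positive_eq_0[OF p2]) (auto intro!: continuous_intros)
    finally show ?thesis by simp
  qed
  have "0 \<le> d" by (simp add: d_def)
  then have "(\<lambda>s. max (- d) (min d s)) = (\<lambda>s. s - max (s - d) 0 + max (- s - d) 0)"
    by (auto simp: max_def min_def fun_eq_iff)
  then have "cfc (\<lambda>s. max (- d) (min d s)) R = cfc (\<lambda>s. s - max (s - d) 0 + max (- s - d) 0) R"
    by (rule arg_cong)
  also have "\<dots> = cfc (\<lambda>s. s) R - cfc (\<lambda>s. max (s - d) 0) R + cfc (\<lambda>s. max (- s - d) 0) R"
    by (simp only: cfc_add[OF R] cfc_diff[OF R] continuous_intros)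
  finally have "cfc (\<lambda>s. max (- d) (min d s)) R = R" by (simp add: zero1 zero2 cfc_id R)
  moreover have "norm (cfc (\<lambda>s. max (- d) (min d s)) R) \<le> d"
  proof (rule cfc_norm_le[OF R])
    show "continuous_on UNIV (\<lambda>s. max (- d) (min d s))" by (intro continuous_intros)
    show "\<bar>max (- d) (min d s)\<bar> \<le> d" for s using \<open>0 \<le> d\<close> by (auto simp: max_def min_def)
  qed
  ultimately show ?thesis unfolding d_def[symmetric] by (simp only:)
qed

text \<open>Spectral positivity in the unitization agrees with positivity in the original algebra, because the
  square root of an element of the original algebra again lies in it.\<close>
lemma positive_element_iff: "positive_element a \<longleftrightarrow> spectrally_positive (embed a)"
proof
  assume "positive_element a"
  then obtain b where "a = b\<^sup>\<star> * b" by (auto simp: positive_element_def)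
  then show "spectrally_positive (embed a)"
    using spectrally_positive_star_mult[of "embed b"] by (simp add: embed_simps embed_star)
next
  assume pos: "spectrally_positive (embed a)"
  note sa = spectrally_positive_star[OF pos]
  define k where "k = cfc (\<lambda>s. sqrt (max s 0)) (embed a)"
  have cont: "continuous_on UNIV (\<lambda>s. sqrt (max s 0))" by (intro continuous_intros)
  have k: "k * k = embed a" "k\<^sup>\<star> = k"
    unfolding k_def by (rule spectrally_positive_sqrt[OF pos] star_cfc[OF sa cont])+
  have "coeff1 k = 0" unfolding k_def by (rule coeff1_cfc[OF sa _ cont]) simp_all
  then have kb: "embed (base k) = k" by (rule embed_base)
  then have "embed ((base k)\<^sup>\<star> * base k) = embed a"
    by (simp only: embed_simps embed_star k)
  then have "a = (base k)\<^sup>\<star> * base k" by simp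
  then show "positive_element a" unfolding positive_element_def by blast
qed

lemma positive_element_star_mult: "positive_element (b\<^sup>\<star> * b)"
  by (auto simp: positive_element_def)

lemma positive_element_0: "positive_element 0"
  using positive_element_star_mult[of 0] by simp

lemma positive_element_square: "b\<^sup>\<star> = b \<Longrightarrow> positive_element (b * b)"
  using positive_element_star_mult[of b] by simp

lemma positive_element_add: "positive_element a \<Longrightarrow> positive_element b \<Longrightarrow> positive_element (a + b)"
  by (simp add: positive_element_iff embed_simps spectrally_positive_add)

lemma positive_element_scaleR: "positive_element a \<Longrightarrow> 0 \<le> r \<Longrightarrow> positive_element (r *\<^sub>R a)"
  by (simp add: positive_element_iff embed_simps spectrally_positive_scaleR)

lemma norm_le_if_positive_between:
  "positive_element (d - r) \<Longrightarrow> positive_element (d + r) \<Longrightarrow> norm r \<le> norm d"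
  unfolding positive_element_iff embed_simps by (metis norm_le_if_between norm_embed)

lemma norm_le_if_positive_le:
  assumes "positive_element a" "positive_element (b - a)"
  shows "norm a \<le> norm b"
proof (rule norm_le_if_positive_between[OF assms(2)])
  have "b + a = (b - a) + (a + a)" by simp
  then show "positive_element (b + a)" using assms by (metis positive_element_add)
qed

lemma positive_element_conj_op: "positive_element a \<Longrightarrow> positive_element (conj_op x a)"
  using positive_element_star_mult[of "b * x" for b]
  by (auto simp: positive_element_def conj_op_def star_mult mult.assoc)

text \<open>The Cauchy--Schwarz inequality in additive form, for positive maps with values in a C*-algebra.\<close>
lemma positive_map_cauchy_schwarz:
  fixes T :: "'a::cstar_algebra \<Rightarrow> 'b::cstar_algebra"
  assumes T: "bounded_clinear T" and pos: "positive_map T" and t: "0 < t"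
  shows "norm (T (b\<^sup>\<star> * c)) \<le> t * norm (T (b\<^sup>\<star> * b)) + norm (T (c\<^sup>\<star> * c)) / t"
proof -
  interpret bounded_linear T using T by (simp add: bounded_clinear_def)
  have T_scaleC: "T (z *\<^sub>C a) = z *\<^sub>C T a" for z a using T by (simp add: bounded_clinear_def)
  define D where "D = t *\<^sub>R T (b\<^sup>\<star> * b) + (1 / t) *\<^sub>R T (c\<^sup>\<star> * c)"
  define Q where "Q c = T (b\<^sup>\<star> * c) + T (c\<^sup>\<star> * b)" for c
  have between: "norm (Q c) \<le> norm (t *\<^sub>R T (b\<^sup>\<star> * b) + (1 / t) *\<^sub>R T (c\<^sup>\<star> * c))" for c
  proof (rule norm_le_if_positive_between)
    have expand: "positive_element (t *\<^sub>R T (b\<^sup>\<star> * b) + (1 / t) *\<^sub>R T (c\<^sup>\<star> * c) + s *\<^sub>R Q c)"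
      if "s * s = 1" for s
    proof -
      define e where "e = sqrt t *\<^sub>R b + (s / sqrt t) *\<^sub>R c"
      have "e\<^sup>\<star> * e = t *\<^sub>R (b\<^sup>\<star> * b) + (1 / t) *\<^sub>R (c\<^sup>\<star> * c) + s *\<^sub>R (b\<^sup>\<star> * c + c\<^sup>\<star> * b)"
        using t that unfolding e_def
        by (simp add: star_add algebra_simps)
      moreover have "positive_element (T (e\<^sup>\<star> * e))"
        using pos positive_element_star_mult by (auto simp: positive_map_def)
      ultimately show ?thesis by (simp add: Q_def add scaleR)
    qed
    show "positive_element (t *\<^sub>R T (b\<^sup>\<star> * b) + (1 / t) *\<^sub>R T (c\<^sup>\<star> * c) - Q c)"
      using expand[of "-1"] by simp
    show "positive_element (t *\<^sub>R T (b\<^sup>\<star> * b) + (1 / t) *\<^sub>R T (c\<^sup>\<star> * c) + Q c)"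
      using expand[of 1] by simp
  qed
  have D1: "norm (Q c) \<le> norm D" unfolding D_def by (rule between)
  have "(\<i> *\<^sub>C c)\<^sup>\<star> * \<i> *\<^sub>C c = c\<^sup>\<star> * c"
    by (simp add: star_scaleC scaleC_mult_left scaleC_mult_right scaleC_scaleC scaleC_one)
  then have D2: "norm (Q (\<i> *\<^sub>C c)) \<le> norm D" using between[of "\<i> *\<^sub>C c"] by (simp add: D_def)
  have "Q (\<i> *\<^sub>C c) = \<i> *\<^sub>C (T (b\<^sup>\<star> * c) - T (c\<^sup>\<star> * b))"
    by (simp add: Q_def star_scaleC scaleC_mult_left scaleC_mult_right T_scaleC scaleC_minus_left
        scaleC_diff_right linear_neg[OF linear])
  then have D3: "norm (T (b\<^sup>\<star> * c) - T (c\<^sup>\<star> * b)) \<le> norm D"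
    using D2 by (simp add: norm_scaleC)
  have "2 *\<^sub>R T (b\<^sup>\<star> * c) = Q c + (T (b\<^sup>\<star> * c) - T (c\<^sup>\<star> * b))"
    by (simp add: Q_def scaleR_2)
  then have "2 * norm (T (b\<^sup>\<star> * c)) \<le> norm (Q c) + norm (T (b\<^sup>\<star> * c) - T (c\<^sup>\<star> * b))"
    by (metis norm_scaleR abs_numeral norm_triangle_ineq)
  with D1 D3 have "norm (T (b\<^sup>\<star> * c)) \<le> norm D" by linarith
  also have "norm D \<le> norm (t *\<^sub>R T (b\<^sup>\<star> * b)) + norm ((1 / t) *\<^sub>R T (c\<^sup>\<star> * c))"
    unfolding D_def by (rule norm_triangle_ineq)
  also have "\<dots> = t * norm (T (b\<^sup>\<star> * b)) + norm (T (c\<^sup>\<star> * c)) / t" using t by simp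
  finally show ?thesis .
qed


section \<open>Sublinear functionals and Mazur's theorem\<close>

text \<open>Subadditive and positively homogeneous functionals on a real vector space.\<close>
definition sublinear :: "('a::real_vector \<Rightarrow> real) \<Rightarrow> bool" where
  "sublinear q \<longleftrightarrow> (\<forall>x y. q (x + y) \<le> q x + q y) \<and> (\<forall>t\<ge>0. \<forall>x. q (t *\<^sub>R x) = t * q x)"

lemma sublinearI:
  assumes add: "\<And>x y. q (x + y) \<le> q x + q y" and zero: "q 0 = 0"
    and le: "\<And>t x. 0 < t \<Longrightarrow> q (t *\<^sub>R x) \<le> t * q x"
  shows "sublinear q"
  unfolding sublinear_def
proof (intro conjI allI impI add)
  fix t :: real and x
  assume "0 \<le> t"
  show "q (t *\<^sub>R x) = t * q x"
  proof (cases "t = 0")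
    case False
    with \<open>0 \<le> t\<close> have t: "0 < t" by simp
    have "q ((1 / t) *\<^sub>R (t *\<^sub>R x)) \<le> (1 / t) * q (t *\<^sub>R x)" using t by (intro le) simp
    then have "t * q x \<le> q (t *\<^sub>R x)" using t by (simp add: field_simps)
    with le[OF t] show ?thesis by (simp add: antisym)
  qed (simp add: zero)
qed

lemma sublinear_0: "sublinear q \<Longrightarrow> q 0 = 0"
  unfolding sublinear_def by (metis order_refl mult_zero_left scaleR_zero_left)

lemma sublinear_ge: "sublinear q \<Longrightarrow> - q (- x) \<le> q x"
  using sublinear_0[of q] unfolding sublinear_def by (metis add.right_inverse add.commute diff_le_eq diff_0)

text \<open>A sublinear functional that dominates the height over a convex cone \<open>G\<close> in the product with the
  reals can be lowered so that it is at most \<open>-r\<close> at \<open>-g\<close> for every point \<open>(g, r)\<close> of the cone.\<close>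
lemma sublinear_below_cone:
  fixes q :: "'a::real_vector \<Rightarrow> real"
  assumes q: "sublinear q"
    and G0: "(0, 0) \<in> G"
    and G_add: "\<And>g r h s. (g, r) \<in> G \<Longrightarrow> (h, s) \<in> G \<Longrightarrow> (g + h, r + s) \<in> G"
    and G_scale: "\<And>t g r. 0 < t \<Longrightarrow> (g, r) \<in> G \<Longrightarrow> (t *\<^sub>R g, t * r) \<in> G"
    and G_le: "\<And>g r. (g, r) \<in> G \<Longrightarrow> r \<le> q g"
  shows "\<exists>p. sublinear p \<and> (\<forall>x. p x \<le> q x) \<and> (\<forall>(g, r)\<in>G. p (- g) \<le> - r)"
proof -
  have q_add: "q (x + y) \<le> q x + q y" and q_scale: "0 \<le> t \<Longrightarrow> q (t *\<^sub>R x) = t * q x" for x y t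
    using q by (auto simp: sublinear_def)
  define p where "p z = (INF (g, r)\<in>G. q (z + g) - r)" for z
  have lower: "- q (- z) \<le> q (z + g) - r" if "(g, r) \<in> G" for z g r
    using G_le[OF that] q_add[of "z + g" "- z"] by simp
  have bdd: "bdd_below ((\<lambda>(g, r). q (z + g) - r) ` G)" for z
    using lower by (intro bdd_belowI[of _ "- q (- z)"]) auto
  have p_le: "p z \<le> q (z + g) - r" if "(g, r) \<in> G" for z g r
    unfolding p_def using cINF_lower[OF bdd that, of z] by simp
  have p_ge: "c \<le> p z" if "\<And>g r. (g, r) \<in> G \<Longrightarrow> c \<le> q (z + g) - r" for c z
    unfolding p_def using G0 that by (intro cINF_greatest) auto
  have "p (x + y) \<le> p x + p y" for x y
  proof -
    have "p (x + y) - p y \<le> q (x + g) - r" if g: "(g, r) \<in> G" for g r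
    proof -
      have "p (x + y) - (q (x + g) - r) \<le> p y"
      proof (rule p_ge)
        fix h s
        assume h: "(h, s) \<in> G"
        have "p (x + y) \<le> q ((x + y) + (g + h)) - (r + s)" by (rule p_le[OF G_add[OF g h]])
        moreover have "q ((x + y) + (g + h)) \<le> q (x + g) + q (y + h)"
          using q_add[of "x + g" "y + h"] by (simp add: algebra_simps)
        ultimately show "p (x + y) - (q (x + g) - r) \<le> q (y + h) - s" by simp
      qed
      then show ?thesis by simp
    qed
    then have "p (x + y) - p y \<le> p x" by (rule p_ge)
    then show ?thesis by simp
  qed
  moreover have "p 0 = 0"
  proof (rule antisym)
    show "p 0 \<le> 0" using p_le[OF G0, of 0] by (simp add: sublinear_0[OF q])
    show "0 \<le> p 0" by (rule p_ge) (simp add: G_le)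
  qed
  moreover have "p (t *\<^sub>R x) \<le> t * p x" if t: "0 < t" for t x
  proof -
    have "p (t *\<^sub>R x) / t \<le> p x"
    proof (rule p_ge)
      fix g r
      assume g: "(g, r) \<in> G"
      have "p (t *\<^sub>R x) \<le> q (t *\<^sub>R x + t *\<^sub>R g) - t * r" by (rule p_le[OF G_scale[OF t g]])
      also have "\<dots> = t * (q (x + g) - r)"
        using q_scale[of t "x + g"] t by (simp add: scaleR_add_right right_diff_distrib)
      finally show "p (t *\<^sub>R x) / t \<le> q (x + g) - r" using t by (simp add: field_simps)
    qed
    then show ?thesis using t by (simp add: field_simps)
  qed
  ultimately have "sublinear p" by (intro sublinearI)
  moreover have "p x \<le> q x" for x using p_le[OF G0, of x] by simp
  moreover have "p (- g) \<le> - r" if "(g, r) \<in> G" for g r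
    using p_le[OF that, of "- g"] by (simp add: sublinear_0[OF q])
  ultimately show ?thesis by blast
qed

text \<open>Minimal sublinear functionals are linear.\<close>
theorem linear_below_sublinear:
  fixes q :: "'a::real_vector \<Rightarrow> real"
  assumes q: "sublinear q"
  shows "\<exists>f. linear f \<and> (\<forall>x. f x \<le> q x)"
proof -
  define A where "A = {p. sublinear p \<and> (\<forall>x. p x \<le> q x)}"
  define le where "le p p' \<longleftrightarrow> (\<forall>x. p' x \<le> p x)" for p p' :: "'a \<Rightarrow> real"
  have po: "partial_order_on A (relation_of le A)"
    by (rule partial_order_on_relation_ofI) (auto simp: le_def fun_eq_iff intro: order_trans antisym)
  have "\<exists>m\<in>A. \<forall>p\<in>A. le m p \<longrightarrow> p = m"
  proof (rule predicate_Zorn[OF po])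
    fix C
    assume "C \<in> Chains (relation_of le A)"
    then have CA: "C \<subseteq> A" and chain: "\<And>p p'. p \<in> C \<Longrightarrow> p' \<in> C \<Longrightarrow> le p p' \<or> le p' p"
      by (auto simp: Chains_def relation_of_def)
    show "\<exists>u\<in>A. \<forall>a\<in>C. le a u"
    proof (cases "C = {}")
      case True
      then show ?thesis using q by (auto simp: A_def intro!: bexI[of _ q])
    next
      case False
      define u where "u x = (INF p\<in>C. p x)" for x
      have sub: "sublinear p" and below: "p x \<le> q x" if "p \<in> C" for p x
        using CA that by (auto simp: A_def)
      have bdd: "bdd_below ((\<lambda>p. p x) ` C)" for x
      proof (rule bdd_belowI)
        fix r
        assume "r \<in> (\<lambda>p. p x) ` C"
        then obtain p where "p \<in> C" "r = p x" by blast
        then show "- q (- x) \<le> r" using sublinear_ge[OF sub, of p x] below[of p "- x"] by simp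
      qed
      have u_le: "u x \<le> p x" if "p \<in> C" for p x
        unfolding u_def using cINF_lower[OF bdd that] .
      have u_ge: "c \<le> u x" if "\<And>p. p \<in> C \<Longrightarrow> c \<le> p x" for c x
        unfolding u_def using False that by (intro cINF_greatest) auto
      have "u (x + y) \<le> u x + u y" for x y
      proof -
        have "u (x + y) - u y \<le> p x" if p: "p \<in> C" for p
        proof -
          have "u (x + y) - p x \<le> u y"
          proof (rule u_ge)
            fix p'
            assume p': "p' \<in> C"
            obtain r where r: "r \<in> C" "r x \<le> p x" "r y \<le> p' y"
              using chain[OF p p'] p p' by (auto simp: le_def)
            have "u (x + y) \<le> r (x + y)" by (rule u_le[OF r(1)])
            also have "\<dots> \<le> r x + r y" using sub[OF r(1)] by (simp add: sublinear_def)
            finally show "u (x + y) - p x \<le> p' y" using r by simp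
          qed
          then show ?thesis by simp
        qed
        then have "u (x + y) - u y \<le> u x" by (rule u_ge)
        then show ?thesis by simp
      qed
      moreover have "u 0 = 0"
        unfolding u_def using False by (simp add: sublinear_0[OF sub])
      moreover have "u (t *\<^sub>R x) \<le> t * u x" if t: "0 < t" for t x
      proof -
        have "u (t *\<^sub>R x) / t \<le> u x"
        proof (rule u_ge)
          fix p
          assume p: "p \<in> C"
          have "p (t *\<^sub>R x) = t * p x" using sub[OF p] t by (simp add: sublinear_def)
          with u_le[OF p, of "t *\<^sub>R x"] t show "u (t *\<^sub>R x) / t \<le> p x" by (simp add: field_simps)
        qed
        then show ?thesis using t by (simp add: field_simps)
      qed
      ultimately have "sublinear u" by (intro sublinearI)
      moreover have "u x \<le> q x" for x using False u_le below by (meson ex_in_conv order_trans)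
      ultimately show ?thesis using u_le by (auto simp: A_def le_def)
    qed
  qed
  then obtain m where m: "sublinear m" "\<And>x. m x \<le> q x"
    and minimal: "\<And>p. sublinear p \<Longrightarrow> (\<And>x. p x \<le> m x) \<Longrightarrow> p = m"
    unfolding A_def le_def by (auto; meson order_trans)
  have m_add: "m (x + y) \<le> m x + m y" and m_scale: "0 \<le> t \<Longrightarrow> m (t *\<^sub>R x) = t * m x" for x y t
    using m(1) by (auto simp: sublinear_def)
  have odd: "m (- x) = - m x" for x
  proof -
    \<comment> \<open>Lowering \<open>m\<close> along the ray over \<open>x\<close> must leave it unchanged.\<close>
    define G where "G = {(t *\<^sub>R x, t * m x) |t. 0 \<le> t}"
    have G: "(t *\<^sub>R x, t * m x) \<in> G" if "0 \<le> t" for t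
      using that by (auto simp: G_def)
    have "\<exists>p. sublinear p \<and> (\<forall>y. p y \<le> m y) \<and> (\<forall>(g, r)\<in>G. p (- g) \<le> - r)"
    proof (rule sublinear_below_cone[OF m(1)])
      show "(0, 0) \<in> G" using G[of 0] by simp
      show "(g + h, r + s) \<in> G" if gh: "(g, r) \<in> G" "(h, s) \<in> G" for g r h s
      proof -
        obtain a b where "g = a *\<^sub>R x" "r = a * m x" "h = b *\<^sub>R x" "s = b * m x" "0 \<le> a" "0 \<le> b"
          using gh by (auto simp: G_def)
        then show ?thesis using G[of "a + b"] by (simp add: algebra_simps)
      qed
      show "(t *\<^sub>R g, t * r) \<in> G" if gh: "0 < t" "(g, r) \<in> G" for t g r
      proof -
        obtain a where "g = a *\<^sub>R x" "r = a * m x" "0 \<le> a" using gh by (auto simp: G_def)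
        then show ?thesis using G[of "t * a"] gh(1) by (simp add: mult.assoc)
      qed
      show "r \<le> m g" if "(g, r) \<in> G" for g r using that m_scale by (auto simp: G_def)
    qed
    then obtain p where p: "sublinear p" "\<And>y. p y \<le> m y" and pG: "\<forall>(g, r)\<in>G. p (- g) \<le> - r"
      by blast
    have "p = m" by (rule minimal[OF p])
    with pG G[of 1] have "m (- x) \<le> - m x" by auto
    with sublinear_ge[OF m(1), of "- x"] show ?thesis by simp
  qed
  have "linear m"
  proof (rule linearI)
    fix x y and c :: real
    have "m (- x + - y) \<le> m (- x) + m (- y)" by (rule m_add)
    then have "m x + m y \<le> m (x + y)" using odd[of "x + y"] by (simp add: odd)
    with m_add[of x y] show "m (x + y) = m x + m y" by simp
    show "m (c *\<^sub>R x) = c *\<^sub>R m x"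
    proof (cases "0 \<le> c")
      case False
      then have "m ((- c) *\<^sub>R x) = - c * m x" by (intro m_scale) simp
      then show ?thesis using odd[of "c *\<^sub>R x"] by simp
    qed (simp add: m_scale)
  qed
  with m(2) show ?thesis by blast
qed

text \<open>Hahn--Banach separation of a point from a convex set at distance at least \<open>d\<close>. The cone is
  generated by the points \<open>(y - c, d)\<close> with \<open>c\<close> in \<open>C\<close>.\<close>
lemma separate_point_convex:
  fixes y :: "'a::real_normed_vector"
  assumes C: "convex C" "C \<noteq> {}" and d: "\<And>c. c \<in> C \<Longrightarrow> d \<le> norm (y - c)"
  shows "\<exists>f. linear f \<and> (\<forall>z. \<bar>f z\<bar> \<le> norm z) \<and> (\<forall>c\<in>C. f c + d \<le> f y)"
proof -
  define G where "G = {(t *\<^sub>R (y - c), t * d) |t c. 0 \<le> t \<and> c \<in> C}"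
  have G: "(t *\<^sub>R (y - c), t * d) \<in> G" if "0 \<le> t" "c \<in> C" for t c
    using that by (auto simp: G_def)
  have norm: "sublinear (norm :: 'a \<Rightarrow> real)"
    by (simp add: sublinear_def norm_triangle_ineq)
  have "\<exists>p. sublinear p \<and> (\<forall>x. p x \<le> norm x) \<and> (\<forall>(g, r)\<in>G. p (- g) \<le> - r)"
  proof (rule sublinear_below_cone[OF norm])
    show "(0, 0) \<in> G" using G[of 0] C(2) by auto
    show "(g + h, r + s) \<in> G" if gh: "(g, r) \<in> G" "(h, s) \<in> G" for g r h s
    proof -
      obtain a b c e where ab: "g = a *\<^sub>R (y - c)" "r = a * d" "h = b *\<^sub>R (y - e)" "s = b * d"
          "0 \<le> a" "0 \<le> b" "c \<in> C" "e \<in> C"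
        using gh by (auto simp: G_def)
      show ?thesis
      proof (cases "a + b = 0")
        case True
        then have "a = 0" "b = 0" using ab by auto
        then show ?thesis using ab G[of 0 c] by simp
      next
        case False
        then have pos: "0 < a + b" using ab by simp
        define w where "w = (a / (a + b)) *\<^sub>R c + (b / (a + b)) *\<^sub>R e"
        have "w \<in> C"
          unfolding w_def using ab pos
          by (intro convexD[OF C(1)]) (simp_all add: add_divide_distrib[symmetric])
        moreover have "(a + b) *\<^sub>R w = a *\<^sub>R c + b *\<^sub>R e"
          unfolding w_def using pos by (simp add: scaleR_add_right)
        then have "(a + b) *\<^sub>R (y - w) = g + h"
          by (simp add: ab scaleR_right_diff_distrib scaleR_add_left)
        ultimately show ?thesis using G[of "a + b" w] ab by (simp add: distrib_right)
      qed
    qed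
    show "(t *\<^sub>R g, t * r) \<in> G" if gh: "0 < t" "(g, r) \<in> G" for t g r
    proof -
      obtain a c where "g = a *\<^sub>R (y - c)" "r = a * d" "0 \<le> a" "c \<in> C" using gh by (auto simp: G_def)
      then show ?thesis using G[of "t * a" c] gh(1) by (simp add: mult.assoc)
    qed
    show "r \<le> norm g" if "(g, r) \<in> G" for g r
      using that d by (auto simp: G_def mult_left_mono)
  qed
  then obtain p where p: "sublinear p" "\<And>x. p x \<le> norm x" and pG: "\<forall>(g, r)\<in>G. p (- g) \<le> - r"
    by blast
  obtain f where f: "linear f" "\<And>x. f x \<le> p x" using linear_below_sublinear[OF p(1)] by blast
  have "\<bar>f z\<bar> \<le> norm z" for z
    using order_trans[OF f(2) p(2), of z] order_trans[OF f(2) p(2), of "- z"]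
    by (simp add: linear_neg[OF f(1)] abs_le_iff)
  moreover have "f c + d \<le> f y" if "c \<in> C" for c
  proof -
    have "f (- (y - c)) \<le> - d"
      using G[of 1 c] that pG f(2)[of "- (y - c)"] by force
    then show ?thesis by (simp add: linear_diff[OF f(1)])
  qed
  ultimately show ?thesis using f(1) by blast
qed

lemma bounded_clinear_complexify:
  fixes f :: "'a::complex_normed_vector \<Rightarrow> real"
  assumes f: "linear f" and le: "\<And>z. \<bar>f z\<bar> \<le> norm z"
  shows "bounded_clinear (\<lambda>z. Complex (f z) (- f (\<i> *\<^sub>C z)))"
  unfolding bounded_clinear_def
proof (intro conjI allI)
  note f_simps = linear_add[OF f] linear_diff[OF f] linear_scale[OF f] linear_neg[OF f]
  show "bounded_linear (\<lambda>z. Complex (f z) (- f (\<i> *\<^sub>C z)))"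
  proof (rule bounded_linear_intro[where K=2])
    fix z
    have "cmod (Complex (f z) (- f (\<i> *\<^sub>C z))) \<le> \<bar>f z\<bar> + \<bar>f (\<i> *\<^sub>C z)\<bar>"
      using cmod_le[of "Complex (f z) (- f (\<i> *\<^sub>C z))"] by simp
    also have "\<dots> \<le> norm z + norm (\<i> *\<^sub>C z)" by (intro add_mono le)
    finally show "cmod (Complex (f z) (- f (\<i> *\<^sub>C z))) \<le> norm z * 2" by (simp add: norm_scaleC)
  qed (simp_all add: f_simps scaleC_add_right scaleC_scaleR complex_eq_iff)
  show "Complex (f (c *\<^sub>C z)) (- f (\<i> *\<^sub>C c *\<^sub>C z)) = c *\<^sub>C Complex (f z) (- f (\<i> *\<^sub>C z))" for c z
    unfolding scaleC_cartesian[of c z]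
    by (simp add: f_simps scaleC_add_right scaleC_scaleR scaleC_i_i scaleC_complex_def complex_eq_iff)
qed

lemma topspace_weak: "topspace (weak_topology :: 'a::complex_normed_vector topology) = UNIV"
proof -
  have "bounded_clinear (\<lambda>x::'a. 0::complex)"
    by (simp add: bounded_clinear_def bounded_linear_zero scaleC_zero_right)
  then have "(\<lambda>x::'a. 0::complex) -` UNIV \<in>
      {f -` U |(f :: 'a \<Rightarrow> complex) U. bounded_clinear f \<and> open U}"
    using open_UNIV by blast
  then show ?thesis unfolding weak_topology_def topology_generated_by_topspace by auto
qed

lemma openin_weak:
  "bounded_clinear (f :: 'a::complex_normed_vector \<Rightarrow> complex) \<Longrightarrow> open U \<Longrightarrow> openin weak_topology (f -` U)"
  unfolding weak_topology_def by (rule topology_generated_by_Basis) blast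

text \<open>Mazur: the weak closure of a convex set lies in its norm closure.\<close>
theorem weak_closure_convex:
  fixes C :: "'a::complex_normed_vector set"
  assumes C: "convex C" and y: "y \<in> weak_topology closure_of C"
  shows "y \<in> closure C"
proof (rule ccontr)
  assume "y \<notin> closure C"
  then obtain d where d: "0 < d" and far: "\<forall>c\<in>C. \<not> dist c y < d"
    unfolding closure_approachable by blast
  have d_le: "d \<le> norm (y - c)" if "c \<in> C" for c
    using far that by (simp add: dist_norm norm_minus_commute not_less)
  have "C \<noteq> {}" using y by (rule contrapos_pn) simp
  then obtain f where f: "linear f" "\<And>z. \<bar>f z\<bar> \<le> norm z" "\<And>c. c \<in> C \<Longrightarrow> f c + d \<le> f y"
    using separate_point_convex[OF C _ d_le] by blast
  define \<phi> where "\<phi> z = Complex (f z) (- f (\<i> *\<^sub>C z))" for z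
  have "bounded_clinear \<phi>" unfolding \<phi>_def by (rule bounded_clinear_complexify[OF f(1,2)])
  then have "openin weak_topology (\<phi> -` {w. f y - d < Re w})"
    by (rule openin_weak) (rule open_halfspace_Re_gt)
  moreover have "y \<in> \<phi> -` {w. f y - d < Re w}" using d by (simp add: \<phi>_def)
  ultimately have "\<exists>c. c \<in> C \<and> c \<in> \<phi> -` {w. f y - d < Re w}"
    using y unfolding in_closure_of by meson
  then obtain c where "c \<in> C" "c \<in> \<phi> -` {w. f y - d < Re w}" by blast
  then show False using f(3)[of c] by (simp add: \<phi>_def)
qed

lemma weak_cluster_point:
  fixes z :: "nat \<Rightarrow> 'a::complex_normed_vector"
  assumes K: "compactin weak_topology (weak_topology closure_of K)" and z: "\<And>n. z n \<in> K"
  shows "\<exists>y. \<forall>m. y \<in> weak_topology closure_of (z ` {m..})"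
proof -
  define F where "F m = weak_topology closure_of (z ` {m..})" for m
  have in_F: "z k \<in> F m" if "m \<le> k" for k m
    unfolding F_def by (rule subsetD[OF closure_of_subset]) (use that in \<open>auto simp: topspace_weak\<close>)
  have zK: "z k \<in> weak_topology closure_of K" for k
    by (rule subsetD[OF closure_of_subset]) (use z in \<open>auto simp: topspace_weak\<close>)
  have "weak_topology closure_of K \<inter> \<Inter> (range F) \<noteq> {}"
  proof (rule conjunct2[OF K[unfolded compactin_fip], rule_format], intro conjI ballI allI impI)
    show "closedin weak_topology C" if "C \<in> range F" for C
      using that by (auto simp: F_def)
    fix \<F>
    assume "finite \<F> \<and> \<F> \<subseteq> range F"
    then obtain J where J: "finite J" "\<F> = F ` J" by (meson finite_subset_image)
    have "z (Max (insert 0 J)) \<in> weak_topology closure_of K \<inter> \<Inter> \<F>"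
      using J in_F zK by auto
    then show "weak_topology closure_of K \<inter> \<Inter> \<F> \<noteq> {}" by blast
  qed
  then show ?thesis unfolding F_def by blast
qed


section \<open>Orthogonal sequences\<close>

text \<open>The square of an orthogonal sum is the sum of the squares, which are again orthogonal.\<close>
lemma norm_sum_orthogonal_power:
  fixes w :: "nat \<Rightarrow> 'a::cstar_algebra"
  assumes "\<And>n. (w n)\<^sup>\<star> = w n" "\<And>m n. m \<noteq> n \<Longrightarrow> w m * w n = 0"
  shows "norm (\<Sum>n<k. w n) ^ (2 ^ j) \<le> (\<Sum>n<k. norm (w n) ^ (2 ^ j))"
  using assms
proof (induction j arbitrary: w)
  case 0
  then show ?case by (simp add: norm_sum)
next
  case (Suc j)
  have "(\<Sum>n<k. w n)\<^sup>\<star> = (\<Sum>n<k. w n)" by (simp add: star_sum Suc.prems(1))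
  then have "(norm (\<Sum>n<k. w n))\<^sup>2 = norm ((\<Sum>n<k. w n) * (\<Sum>n<k. w n))"
    by (simp add: norm_square_selfadjoint)
  also have "(\<Sum>n<k. w n) * (\<Sum>n<k. w n) = (\<Sum>n<k. \<Sum>m<k. if m = n then w n * w n else 0)"
    unfolding sum_product by (intro sum.cong refl) (use Suc.prems(2) in auto)
  also have "\<dots> = (\<Sum>n<k. w n * w n)" by simp
  finally have "norm (\<Sum>n<k. w n) ^ (2 ^ Suc j) = norm (\<Sum>n<k. w n * w n) ^ (2 ^ j)"
    by (simp only: power_Suc power_mult)
  also have "\<dots> \<le> (\<Sum>n<k. norm (w n * w n) ^ (2 ^ j))"
  proof (rule Suc.IH)
    show "(w n * w n)\<^sup>\<star> = w n * w n" for n by (simp add: star_mult Suc.prems(1))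
    show "w m * w m * (w n * w n) = 0" if "m \<noteq> n" for m n
    proof -
      have "w m * w m * (w n * w n) = w m * (w m * w n) * w n" by (simp only: mult.assoc)
      then show ?thesis by (simp only: Suc.prems(2)[OF that] mult_zero_left mult_zero_right)
    qed
  qed
  also have "\<dots> = (\<Sum>n<k. norm (w n) ^ (2 ^ Suc j))"
    by (simp add: norm_square_selfadjoint Suc.prems(1) power_mult[symmetric])
  finally show ?case .
qed

lemma norm_sum_orthogonal_le_1:
  fixes w :: "nat \<Rightarrow> 'a::cstar_algebra"
  assumes "\<And>n. (w n)\<^sup>\<star> = w n" "\<And>m n. m \<noteq> n \<Longrightarrow> w m * w n = 0" "\<And>n. norm (w n) \<le> 1"
  shows "norm (\<Sum>n<k. w n) \<le> 1"
proof (rule ccontr)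
  define \<rho> where "\<rho> = norm (\<Sum>n<k. w n)"
  assume "\<not> norm (\<Sum>n<k. w n) \<le> 1"
  then have \<rho>: "1 < \<rho>" by (simp add: \<rho>_def)
  obtain j where j: "real k < \<rho> ^ j" using real_arch_pow[OF \<rho>] by blast
  have "\<rho> ^ j \<le> \<rho> ^ (2 ^ j)" using \<rho> by (intro power_increasing) (simp_all add: less_imp_le)
  also have "\<dots> \<le> (\<Sum>n<k. norm (w n) ^ (2 ^ j))"
    unfolding \<rho>_def by (rule norm_sum_orthogonal_power[OF assms(1,2)])
  also have "\<dots> \<le> (\<Sum>n<k. 1)" by (intro sum_mono power_le_one assms(3)) simp
  finally show False using j by simp
qed

text \<open>The partial sums \<open>c\<^sub>k\<close> of the \<open>b\<^sub>n\<^sup>2\<close> are bounded, so their images under \<open>S\<close> have a weak cluster point.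
  By Mazur's theorem it is a norm limit of points \<open>S z\<close> with \<open>c\<^sub>m \<le> z \<le> c\<^sub>M\<close>. Two such points, the second
  beyond \<open>c\<^sub>M\<^sub>+\<^sub>1\<close>, differ by at least \<open>b\<^sub>M\<^sup>2\<close>, while their images are close.\<close>
theorem no_orthogonal_sequence:
  fixes x :: "'a::cstar_algebra" and b :: "nat \<Rightarrow> 'a"
  assumes S: "weakly_compact_operator S" and le: "conj_op x \<preceq> S"
    and b: "\<And>n. (b n)\<^sup>\<star> = b n" "\<And>n. norm (b n) = 1" "\<And>m n. m \<noteq> n \<Longrightarrow> b m * b n = 0"
    and \<delta>: "0 < \<delta>" "\<And>n. \<delta> \<le> norm (b n * x)"
  shows False
proof -
  interpret S: bounded_linear S
    using S by (simp add: weakly_compact_operator_def bounded_clinear_def)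
  define c where "c k = (\<Sum>n<k. b n * b n)" for k
  have "norm (c k) \<le> 1" for k
    unfolding c_def
  proof (rule norm_sum_orthogonal_le_1)
    show "(b n * b n)\<^sup>\<star> = b n * b n" "norm (b n * b n) \<le> 1" for n
      by (simp_all add: star_mult b norm_square_selfadjoint)
    show "b m * b m * (b n * b n) = 0" if "m \<noteq> n" for m n
    proof -
      have "b m * b m * (b n * b n) = b m * (b m * b n) * b n" by (simp only: mult.assoc)
      then show ?thesis by (simp only: b(3)[OF that] mult_zero_left mult_zero_right)
    qed
  qed
  then have Sc: "S (c k) \<in> S ` cball 0 1" for k by simp
  have c_mono: "positive_element (c M - c m)" if "m \<le> M" for m M
    using that
  proof (induction M rule: dec_induct)
    case (step M)
    have "c (Suc M) - c m = (c M - c m) + b M * b M" by (simp add: c_def)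
    then show ?case
      by (simp only: step.IH positive_element_square[OF b(1)] positive_element_add)
  qed (simp add: positive_element_0)
  define E where "E m = {z. \<exists>M. positive_element (z - c m) \<and> positive_element (c M - z)}" for m
  have convex_E: "convex (E m)" for m
  proof (rule convexI)
    fix y z and u v :: real
    assume "y \<in> E m" "z \<in> E m" and uv: "0 \<le> u" "0 \<le> v" "u + v = 1"
    then obtain M N where M: "positive_element (y - c m)" "positive_element (c M - y)"
      and N: "positive_element (z - c m)" "positive_element (c N - z)"
      by (auto simp: E_def)
    have mix: "u *\<^sub>R a + v *\<^sub>R a = a" for a :: 'a by (simp add: scaleR_add_left[symmetric] uv)
    have "u *\<^sub>R y + v *\<^sub>R z - c m = u *\<^sub>R (y - c m) + v *\<^sub>R (z - c m)"
      using mix[of "c m"] by (simp add: algebra_simps)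
    then have "positive_element (u *\<^sub>R y + v *\<^sub>R z - c m)"
      by (simp add: positive_element_add positive_element_scaleR uv M N)
    moreover define L where "L = max M N"
    have "c L - (u *\<^sub>R y + v *\<^sub>R z) =
        u *\<^sub>R ((c L - c M) + (c M - y)) + v *\<^sub>R ((c L - c N) + (c N - z))"
      using mix[of "c L"] by (simp add: algebra_simps)
    then have "positive_element (c L - (u *\<^sub>R y + v *\<^sub>R z))"
      by (simp only: positive_element_add positive_element_scaleR uv M N c_mono L_def
          max.cobounded1 max.cobounded2)
    ultimately show "u *\<^sub>R y + v *\<^sub>R z \<in> E m" by (auto simp: E_def)
  qed
  obtain y where y: "\<And>m. y \<in> weak_topology closure_of ((\<lambda>k. S (c k)) ` {m..})"
    using weak_cluster_point[of "S ` cball 0 1" "\<lambda>k. S (c k)"] S Sc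
    by (auto simp: weakly_compact_operator_def)
  have approx: "\<exists>z\<in>E m. norm (S z - y) < \<eta>" if "0 < \<eta>" for m \<eta>
  proof -
    have "(\<lambda>k. S (c k)) ` {m..} \<subseteq> S ` E m"
      using c_mono by (auto simp: E_def intro!: imageI exI[of _ "_ :: nat"])
    then have "y \<in> weak_topology closure_of (S ` E m)" using y closure_of_mono by blast
    moreover have "convex (S ` E m)" by (intro convex_linear_image S.linear convex_E)
    ultimately have "y \<in> closure (S ` E m)" by (rule weak_closure_convex[rotated])
    then show ?thesis using that unfolding closure_approachable dist_norm by blast
  qed
  define \<eta> where "\<eta> = \<delta>\<^sup>2 / 4"
  have \<eta>: "0 < \<eta>" using \<delta> by (simp add: \<eta>_def)
  obtain z M where z: "norm (S z - y) < \<eta>" "positive_element (c M - z)"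
    using approx[OF \<eta>, of 0] by (auto simp: E_def)
  obtain z' where z': "norm (S z' - y) < \<eta>" "positive_element (z' - c (Suc M))"
    using approx[OF \<eta>, of "Suc M"] by (auto simp: E_def)
  define w where "w = z' - z"
  have w_minus: "w - b M * b M = (z' - c (Suc M)) + (c M - z)" by (simp add: w_def c_def)
  have pos1: "positive_element (w - b M * b M)"
    unfolding w_minus by (intro positive_element_add z z')
  have bb: "positive_element (b M * b M)" by (rule positive_element_square[OF b(1)])
  have "positive_element w" using positive_element_add[OF pos1 bb] by simp
  then have pos2: "positive_element (S w - conj_op x w)"
    using le by (simp add: op_le_def positive_map_def)
  have "positive_element ((S w - conj_op x w) + conj_op x (w - b M * b M))"
    by (intro positive_element_add pos2 positive_element_conj_op pos1)
  moreover have "(S w - conj_op x w) + conj_op x (w - b M * b M) = S w - conj_op x (b M * b M)"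
    by (simp add: conj_op_def algebra_simps)
  ultimately have "norm (conj_op x (b M * b M)) \<le> norm (S w)"
    by (intro norm_le_if_positive_le positive_element_conj_op bb) simp
  also have "S w = (S z' - y) - (S z - y)" by (simp add: w_def S.diff)
  also have "norm \<dots> \<le> norm (S z' - y) + norm (S z - y)" by (rule norm_triangle_ineq4)
  also have "\<dots> < 2 * \<eta>" using z z' by simp
  finally have small: "norm (conj_op x (b M * b M)) < 2 * \<eta>" .
  have "conj_op x (b M * b M) = (b M * x)\<^sup>\<star> * (b M * x)"
    by (simp add: conj_op_def star_mult b mult.assoc)
  then have "norm (conj_op x (b M * b M)) = (norm (b M * x))\<^sup>2" by (simp add: cstar_identity)
  moreover have "\<delta>\<^sup>2 \<le> (norm (b M * x))\<^sup>2" using \<delta> by (intro power_mono) auto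
  ultimately have "\<delta>\<^sup>2 < 2 * (\<delta>\<^sup>2 / 4)" using small unfolding \<eta>_def by linarith
  moreover have "0 < \<delta>\<^sup>2" using \<delta>(1) by simp
  ultimately show False by linarith
qed


section \<open>Minimal projections\<close>

text \<open>A nonzero projection \<open>q\<close> of the original algebra, seen inside the unitization, whose corner \<open>q c q\<close>
  consists of the scalar multiples of \<open>q\<close>.\<close>
definition minimal_projection :: "'a::cstar_algebra unitization \<Rightarrow> bool" where
  "minimal_projection q \<longleftrightarrow> q \<noteq> 0 \<and> q\<^sup>\<star> = q \<and> q * q = q \<and> coeff1 q = 0 \<and>
    (\<forall>c. \<exists>\<mu>. q * c * q = \<mu> *\<^sub>C q)"

text \<open>There are no two nonzero orthogonal self-adjoint elements of the form \<open>a d a\<close>.\<close>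
definition unsplittable :: "'a::cstar_algebra \<Rightarrow> bool" where
  "unsplittable a \<longleftrightarrow> (\<forall>b c. b \<in> {a * d * a |d. True} \<longrightarrow> c \<in> {a * d * a |d. True} \<longrightarrow>
    b\<^sup>\<star> = b \<longrightarrow> c\<^sup>\<star> = c \<longrightarrow> b * c = 0 \<longrightarrow> b = 0 \<or> c = 0)"

lemma norm_projection_le_1:
  assumes "p\<^sup>\<star> = p" "p * p = (p::'a::cstar_algebra)"
  shows "norm p \<le> 1"
proof -
  have "norm p * norm p = norm p * 1"
    using norm_square_selfadjoint[OF assms(1)] by (simp add: assms(2) power2_eq_square)
  then show ?thesis by (auto simp only: mult_cancel_left)
qed

lemma norm_projection:
  assumes "p\<^sup>\<star> = p" "p * p = (p::'a::cstar_algebra)" "p \<noteq> 0"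
  shows "norm p = 1"
proof -
  have "norm p * norm p = norm p * 1"
    using norm_square_selfadjoint[OF assms(1)] by (simp add: assms(2) power2_eq_square)
  then show ?thesis using assms(3) by (simp only: mult_cancel_left) simp
qed

text \<open>Cutting \<open>h\<close> at a real number \<open>t\<close> gives the orthogonal elements \<open>h\<^sup>2 (h - t)\<^sub>+\<close> and \<open>h\<^sup>2 (t - h)\<^sub>+\<close>,
  one of which must vanish. As an interval is connected, both vanish for some \<open>t\<close>.\<close>
lemma unsplittable_square:
  fixes a :: "'a::{cstar_algebra, real_normed_algebra_1}"
  assumes a: "unsplittable a" and h_a: "h = a * d * a" and h: "h\<^sup>\<star> = h"
  shows "\<exists>t. h * h = t *\<^sub>R h"
proof -
  define R where "R = norm h"
  define F where "F t = cfc (\<lambda>s. max (s - t) 0) h" for t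
  define G where "G t = cfc (\<lambda>s. max (t - s) 0) h" for t
  have cF: "continuous_on UNIV (\<lambda>s::real. max (s - t) 0)"
    and cG: "continuous_on UNIV (\<lambda>s::real. max (t - s) 0)" for t
    by (intro continuous_intros)+
  have lipF: "1-lipschitz_on UNIV F"
  proof (rule lipschitz_onI)
    fix t u
    have "F t - F u = cfc (\<lambda>s. max (s - t) 0 - max (s - u) 0) h"
      unfolding F_def by (simp only: cfc_diff[OF h] cF)
    also have "norm \<dots> \<le> \<bar>t - u\<bar>"
    proof (rule cfc_norm_le[OF h])
      show "continuous_on UNIV (\<lambda>s. max (s - t) 0 - max (s - u) 0)" by (intro continuous_intros)
    qed (auto simp: max_def)
    finally show "dist (F t) (F u) \<le> 1 * dist t u" by (simp add: dist_norm)
  qed simp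
  have lipG: "1-lipschitz_on UNIV G"
  proof (rule lipschitz_onI)
    fix t u
    have "G t - G u = cfc (\<lambda>s. max (t - s) 0 - max (u - s) 0) h"
      unfolding G_def by (simp only: cfc_diff[OF h] cG)
    also have "norm \<dots> \<le> \<bar>t - u\<bar>"
    proof (rule cfc_norm_le[OF h])
      show "continuous_on UNIV (\<lambda>s. max (t - s) 0 - max (u - s) 0)" by (intro continuous_intros)
    qed (auto simp: max_def)
    finally show "dist (G t) (G u) \<le> 1 * dist t u" by (simp add: dist_norm)
  qed simp
  define A where "A = {t. h * F t * h = 0}"
  define B where "B = {t. h * G t * h = 0}"
  have "closed A"
    unfolding A_def
    by (intro closed_Collect_eq continuous_intros lipschitz_on_continuous_on[OF lipF])
  moreover have "closed B"
    unfolding B_def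
    by (intro closed_Collect_eq continuous_intros lipschitz_on_continuous_on[OF lipG])
  moreover have "{-R..R} \<subseteq> A \<union> B"
  proof
    fix t
    have "(h * F t * h) * (h * G t * h) = cfc (\<lambda>s. (s * max (s - t) 0 * s) * (s * max (t - s) 0 * s)) h"
      unfolding F_def G_def by (simp only: cfc_mult[OF h] cfc_id[OF h] cF cG continuous_intros)
    also have "(\<lambda>s. (s * max (s - t) 0 * s) * (s * max (t - s) 0 * s)) = (\<lambda>s. 0)"
      by (auto simp: max_def)
    finally have "(h * F t * h) * (h * G t * h) = 0" by (simp add: cfc_const h)
    moreover have "h * c * h \<in> {a * d * a |d. True}" for c
      unfolding h_a by (rule CollectI, rule exI[of _ "d * a * c * a * d"]) (simp add: mult.assoc)
    moreover have "(h * F t * h)\<^sup>\<star> = h * F t * h" "(h * G t * h)\<^sup>\<star> = h * G t * h"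
      unfolding F_def G_def by (simp_all only: star_mult h star_cfc[OF h cF] star_cfc[OF h cG] mult.assoc)
    ultimately show "t \<in> A \<union> B"
      using a unfolding unsplittable_def A_def B_def by blast
  qed
  moreover have "R \<in> A \<inter> {-R..R}"
  proof -
    have "F R = 0" unfolding F_def by (rule cfc_eq_0[OF h cF]) (auto simp: R_def)
    then show ?thesis by (simp add: A_def R_def)
  qed
  moreover have "- R \<in> B \<inter> {-R..R}"
  proof -
    have "G (- R) = 0" unfolding G_def by (rule cfc_eq_0[OF h cG]) (auto simp: R_def)
    then show ?thesis by (simp add: B_def R_def)
  qed
  moreover have "connected {-R..R}" by simp
  ultimately have "A \<inter> B \<inter> {-R..R} \<noteq> {}"
    unfolding connected_closed by blast
  then obtain t where t: "h * F t * h = 0" "h * G t * h = 0" by (auto simp: A_def B_def)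
  have "F t - G t = cfc (\<lambda>s. max (s - t) 0 - max (t - s) 0) h"
    unfolding F_def G_def by (simp only: cfc_diff[OF h] cF cG)
  also have "(\<lambda>s. max (s - t) 0 - max (t - s) 0) = (\<lambda>s. s - t)" by (auto simp: max_def)
  also have "cfc (\<lambda>s. s - t) h = h - t *\<^sub>R 1"
    by (simp only: cfc_diff[OF h] cfc_id[OF h] cfc_const[OF h] continuous_intros)
  finally have "h * (h - t *\<^sub>R 1) * h = h * F t * h - h * G t * h"
    by (metis left_diff_distrib right_diff_distrib)
  then have h3: "h * h * h = t *\<^sub>R (h * h)" using t by (simp add: algebra_simps)
  define w where "w = h * h - t *\<^sub>R h"
  have w: "w\<^sup>\<star> = w" by (simp add: w_def star_mult h)
  have "w * w = (h * h * h) * h - t *\<^sub>R (h * h * h) - t *\<^sub>R (h * h * h) + (t * t) *\<^sub>R (h * h)"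
    by (simp add: w_def algebra_simps)
  also have "\<dots> = 0" unfolding h3 mult_scaleR_left by (simp add: h3)
  finally have "w = 0" using star_mult_self_eq_0[of w] w by simp
  then show ?thesis unfolding w_def by auto
qed

text \<open>By the preceding lemma \<open>a\<^sup>2\<close> is a multiple of a projection \<open>q\<close>. A self-adjoint \<open>q c q\<close> is likewise a
  multiple of a projection \<open>r\<close> below \<open>q\<close>, and \<open>r (q - r) = 0\<close> forces \<open>r = 0\<close> or \<open>r = q\<close>.\<close>
lemma unsplittable_minimal_projection:
  fixes a :: "'a::cstar_algebra unitization"
  assumes a: "unsplittable a" "a\<^sup>\<star> = a" "a \<noteq> 0" "coeff1 a = 0"
  shows "\<exists>q d. minimal_projection q \<and> q = a * d * a"
proof -
  define h where "h = a * 1 * a"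
  have h: "h\<^sup>\<star> = h" by (simp add: h_def star_mult a)
  have h0: "h \<noteq> 0" using star_mult_self_eq_0[of a] a by (auto simp: h_def)
  obtain t where t: "h * h = t *\<^sub>R h" using unsplittable_square[OF a(1) h_def h] by blast
  have t0: "t \<noteq> 0" using star_mult_self_eq_0[of h] h h0 t by auto
  define q where "q = (1 / t) *\<^sub>R h"
  have q: "q \<noteq> 0" "q\<^sup>\<star> = q" "q * q = q" "coeff1 q = 0"
    using h h0 t t0 a by (simp_all add: q_def h_def)
  have q_a: "q = a * ((1 / t) *\<^sub>R 1) * a" by (simp add: q_def h_def)
  have sa: "\<exists>\<mu>::real. q * c * q = \<mu> *\<^sub>R q" if c: "c\<^sup>\<star> = c" for c
  proof -
    define k where "k = q * c * q"
    have k: "k\<^sup>\<star> = k" by (simp add: k_def star_mult q c mult.assoc)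
    have qk: "q * k = k" and kq: "k * q = k"
      unfolding k_def by (simp_all only: mult.assoc[symmetric] q) (simp only: mult.assoc q)
    have in_a: "k = a * (((1 / t) *\<^sub>R 1) * a * c * a * ((1 / t) *\<^sub>R 1)) * a"
      unfolding k_def q_a by (simp only: mult.assoc)
    obtain s where s: "k * k = s *\<^sub>R k" using unsplittable_square[OF a(1) in_a k] by blast
    show ?thesis
    proof (cases "s = 0")
      case True
      then have "k = 0" using s star_mult_self_eq_0[of k] k by simp
      then show ?thesis by (auto simp: k_def intro!: exI[of _ 0])
    next
      case False
      define r where "r = (1 / s) *\<^sub>R k"
      have r: "r\<^sup>\<star> = r" "r * r = r" "q * r = r" "r * q = r"
        using False by (simp_all add: r_def k s qk kq)
      have "r * (q - r) = 0" by (simp add: right_diff_distrib r)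
      moreover have "(q - r)\<^sup>\<star> = q - r" by (simp add: r q)
      moreover have "r = a * ((1 / s) *\<^sub>R (((1 / t) *\<^sub>R 1) * a * c * a * ((1 / t) *\<^sub>R 1))) * a"
        unfolding r_def by (subst in_a) simp
      moreover from this have "q - r = a * (((1 / t) *\<^sub>R 1) -
          ((1 / s) *\<^sub>R (((1 / t) *\<^sub>R 1) * a * c * a * ((1 / t) *\<^sub>R 1)))) * a"
        using q_a by (simp only: right_diff_distrib left_diff_distrib)
      ultimately have "r = 0 \<or> q - r = 0"
        using a(1) r(1) unfolding unsplittable_def by blast
      then have "k = 0 \<or> k = s *\<^sub>R q" using False by (auto simp: r_def)
      then show ?thesis unfolding k_def[symmetric] by (auto intro: exI[of _ 0])
    qed
  qed
  have "\<exists>\<mu>. q * c * q = \<mu> *\<^sub>C q" for c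
  proof -
    obtain u v where uv: "u\<^sup>\<star> = u" "v\<^sup>\<star> = v" "c = u + \<i> *\<^sub>C v"
      by (rule selfadjoint_decomposition)
    obtain \<mu> \<nu> :: real where "q * u * q = \<mu> *\<^sub>R q" "q * v * q = \<nu> *\<^sub>R q" using sa uv by metis
    then have "q * c * q = (of_real \<mu> + \<i> * of_real \<nu>) *\<^sub>C q"
      by (simp add: uv(3) distrib_left distrib_right scaleC_mult_left scaleC_mult_right
          scaleC_add_left scaleR_scaleC scaleC_scaleC)
    then show ?thesis by blast
  qed
  then have "minimal_projection q" using q by (simp add: minimal_projection_def)
  then show ?thesis using q_a by blast
qed

text \<open>Along an orthogonal sequence of self-adjoint \<open>b\<^sub>n\<close> of norm 1 in the original algebra, the norms of \<open>b\<^sub>n x\<close>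
  are not bounded away from 0. This is what the weak compactness of a majorant of \<open>a \<mapsto> x\<^sup>* a x\<close>
  provides.\<close>
definition orthogonally_small :: "'a::cstar_algebra unitization \<Rightarrow> bool" where
  "orthogonally_small x \<longleftrightarrow> (\<forall>b \<delta>. (\<forall>n::nat. coeff1 (b n) = 0 \<and> (b n)\<^sup>\<star> = b n \<and> norm (b n) = 1) \<longrightarrow>
    (\<forall>m n. m \<noteq> n \<longrightarrow> b m * b n = 0) \<longrightarrow> 0 < \<delta> \<longrightarrow> (\<exists>n. norm (b n * x) < \<delta>))"

lemma orthogonally_smallD:
  assumes "orthogonally_small x" "\<And>n::nat. coeff1 (b n) = 0" "\<And>n. (b n)\<^sup>\<star> = b n" "\<And>n. norm (b n) = 1"
    "\<And>m n. m \<noteq> n \<Longrightarrow> b m * b n = 0" "0 < \<delta>"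
  obtains n where "norm (b n * x) < \<delta>"
  using assms(1)[unfolded orthogonally_small_def, rule_format, of b \<delta>] assms(2-) by metis

text \<open>Splitting off orthogonal pieces again and again would produce an orthogonal sequence.\<close>
lemma unsplittable_exists:
  fixes e :: "'a::cstar_algebra unitization"
  assumes x: "orthogonally_small x" and e: "e\<^sup>\<star> = e" "e \<noteq> 0" "coeff1 e = 0"
    and \<delta>: "0 < \<delta>" "\<And>d. (e * d * e)\<^sup>\<star> = e * d * e \<Longrightarrow> \<delta> * norm (e * d * e) \<le> norm (e * d * e * x)"
  shows "\<exists>a d. unsplittable a \<and> a = e * d * e \<and> a\<^sup>\<star> = a \<and> a \<noteq> 0"
proof (rule ccontr)
  assume "\<not> ?thesis"
  then have split: "\<not> unsplittable a" if "a = e * d * e" "a\<^sup>\<star> = a" "a \<noteq> 0" for a d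
    using that by blast
  define P where "P bc \<longleftrightarrow> (case bc of (b, c) \<Rightarrow> b\<^sup>\<star> = b \<and> c\<^sup>\<star> = c \<and> b \<noteq> 0 \<and> c \<noteq> 0 \<and> b * c = 0 \<and>
    (\<exists>d. b = e * d * e) \<and> (\<exists>d. c = e * d * e))" for bc :: "'a unitization \<times> 'a unitization"
  have step: "\<exists>b c. P (b, c) \<and> (\<exists>d. b = a * d) \<and> (\<exists>d. c = a * d)"
    if a: "a = e * d * e" "a\<^sup>\<star> = a" "a \<noteq> 0" for a d
  proof -
    have "\<exists>b c. b \<in> {a * d * a |d. True} \<and> c \<in> {a * d * a |d. True} \<and> b\<^sup>\<star> = b \<and> c\<^sup>\<star> = c \<and>
        b * c = 0 \<and> b \<noteq> 0 \<and> c \<noteq> 0"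
      using split[OF a] unfolding unsplittable_def by meson
    then obtain b c where bc: "b \<in> {a * d * a |d. True}" "c \<in> {a * d * a |d. True}"
      "b\<^sup>\<star> = b" "c\<^sup>\<star> = c" "b * c = 0" "b \<noteq> 0" "c \<noteq> 0"
      by (elim exE conjE)
    have in_e: "\<exists>d. w = e * d * e" if w: "w \<in> {a * d * a |d. True}" for w
    proof -
      obtain f where "w = a * f * a" using w by blast
      then have "w = e * (d * e * f * e * d) * e" using a(1) by (simp only: mult.assoc)
      then show ?thesis by blast
    qed
    have in_a: "\<exists>d. w = a * d" if w: "w \<in> {a * d * a |d. True}" for w
    proof -
      obtain f where "w = a * f * a" using w by blast
      then have "w = a * (f * a)" by (simp only: mult.assoc)
      then show ?thesis by blast
    qed
    have "P (b, c)"
      unfolding P_def prod.case by (intro conjI bc in_e[OF bc(1)] in_e[OF bc(2)])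
    show ?thesis
      by (rule exI[of _ b], rule exI[of _ c], intro conjI \<open>P (b, c)\<close> in_a[OF bc(1)] in_a[OF bc(2)])
  qed
  have start: "\<exists>bc. P bc"
  proof -
    have "e * e \<noteq> 0" using star_mult_self_eq_0[of e] e by auto
    moreover have "e * e = e * 1 * e" "(e * e)\<^sup>\<star> = e * e" by (simp_all add: star_mult e)
    ultimately show ?thesis using step[of "e * e" 1] by blast
  qed
  have "\<exists>f. \<forall>n::nat. P (f n) \<and> ((\<exists>d. fst (f (Suc n)) = snd (f n) * d) \<and> (\<exists>d. snd (f (Suc n)) = snd (f n) * d))"
  proof (rule dependent_nat_choice)
    show "\<exists>bc. P bc" by (rule start)
    fix bc and n :: nat
    assume "P bc"
    then have "(\<exists>d. snd bc = e * d * e) \<and> (snd bc)\<^sup>\<star> = snd bc \<and> snd bc \<noteq> 0"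
      unfolding P_def by (cases bc) simp
    then obtain d where "snd bc = e * d * e" "(snd bc)\<^sup>\<star> = snd bc" "snd bc \<noteq> 0" by blast
    from step[OF this] obtain b c where "P (b, c)" "\<exists>d. b = snd bc * d" "\<exists>d. c = snd bc * d"
      by blast
    then show "\<exists>bc'. P bc' \<and> ((\<exists>d. fst bc' = snd bc * d) \<and> (\<exists>d. snd bc' = snd bc * d))"
      by (intro exI[of _ "(b, c)"]) simp
  qed
  then obtain f where f: "\<And>n::nat. P (f n)" "\<And>n. \<exists>d. fst (f (Suc n)) = snd (f n) * d"
    "\<And>n. \<exists>d. snd (f (Suc n)) = snd (f n) * d"
    by blast
  define b c where "b n = fst (f n)" and "c n = snd (f n)" for n
  have Pbc: "P (b n, c n)" for n using f(1)[of n] by (simp add: b_def c_def)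
  then have b: "(b n)\<^sup>\<star> = b n" "b n \<noteq> 0" "b n * c n = 0" "\<exists>d. b n = e * d * e" for n
    unfolding P_def prod.case by blast+
  have c_dvd: "\<exists>d. c n = c m * d" if "m \<le> n" for m n
    using that
  proof (induction n rule: dec_induct)
    case base
    show ?case by (rule exI[of _ 1]) simp
  next
    case (step n)
    obtain d where "c n = c m * d" using step.IH by blast
    moreover obtain d' where "c (Suc n) = c n * d'" using f(3)[of n] by (auto simp: c_def)
    ultimately have "c (Suc n) = c m * (d * d')" by (simp only: mult.assoc)
    then show ?case by blast
  qed
  have orth_less: "b m * b n = 0" if "m < n" for m n
  proof -
    obtain k where n: "n = Suc k" "m \<le> k" using \<open>m < n\<close> by (cases n) auto
    obtain d where "c k = c m * d" using c_dvd[OF n(2)] by blast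
    moreover obtain d' where "b n = c k * d'" using f(2)[of k] n by (auto simp: b_def c_def)
    ultimately have "b m * b n = (b m * c m) * (d * d')" by (simp only: mult.assoc)
    then show ?thesis by (simp add: b)
  qed
  have orth: "b m * b n = 0" if "m \<noteq> n" for m n
  proof (cases "m < n")
    case False
    then have "(b n * b m)\<^sup>\<star> = 0" using that orth_less[of n m] by simp
    then show ?thesis by (simp add: star_mult b)
  qed (rule orth_less)
  define \<beta> where "\<beta> n = (1 / norm (b n)) *\<^sub>R b n" for n
  have \<beta>: "coeff1 (\<beta> n) = 0 \<and> (\<beta> n)\<^sup>\<star> = \<beta> n \<and> norm (\<beta> n) = 1" for n
  proof -
    obtain d where "b n = e * d * e" using b(4) by blast
    then have "coeff1 (b n) = 0" by (simp add: e)
    then show ?thesis using b(1,2)[of n] by (simp add: \<beta>_def)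
  qed
  have "\<beta> m * \<beta> n = 0" if "m \<noteq> n" for m n by (simp add: \<beta>_def orth that)
  with \<beta> obtain n where n: "norm (\<beta> n * x) < \<delta>"
    using orthogonally_smallD[OF x, of \<beta> \<delta>] \<delta>(1) by metis
  obtain d where d: "b n = e * d * e" using b(4) by blast
  have "\<delta> * norm (b n) \<le> norm (b n * x)" using \<delta>(2)[of d] b(1)[of n] unfolding d .
  then have "\<delta> \<le> norm (\<beta> n * x)" using b(2)[of n] by (simp add: \<beta>_def le_divide_eq)
  with n show False by simp
qed

text \<open>Where \<open>x x\<^sup>*\<close> has a part larger than \<open>\<epsilon>\<close> there is a minimal projection on which \<open>x\<close> is large.\<close>
lemma minimal_projection_exists:
  fixes x p :: "'a::cstar_algebra unitization"
  assumes x: "orthogonally_small x" "coeff1 x = 0" and p: "p\<^sup>\<star> = p" "p * p = p"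
    and \<epsilon>: "0 < \<epsilon>" "\<epsilon> < (norm ((1 - p) * x))\<^sup>2"
  shows "\<exists>q. minimal_projection q \<and> p * q = 0 \<and> sqrt \<epsilon> \<le> norm (q * x)"
proof -
  define z where "z = (1 - p) * x"
  define y where "y = z * z\<^sup>\<star>"
  have y: "y\<^sup>\<star> = y" "coeff1 y = 0" by (simp_all add: y_def z_def star_mult star_star x)
  have norm_y: "\<epsilon> < norm y" using \<epsilon> by (simp add: y_def z_def cstar_identity')
  have pz: "p * z = 0" by (simp add: z_def algebra_simps mult.assoc[symmetric] p)
  have py: "p * y = 0" by (simp add: y_def mult.assoc[symmetric] pz)
  \<comment> \<open>\<open>g\<close> vanishes on the interval from \<open>-\<epsilon>\<close> to \<open>\<epsilon>\<close>, outside which \<open>r(s) = 1 / s\<close>.\<close>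
  define g :: "real \<Rightarrow> real" where "g s = s - max (- \<epsilon>) (min \<epsilon> s)" for s
  define r :: "real \<Rightarrow> real" where "r s = s / max (s * s) (\<epsilon> * \<epsilon>)" for s
  have g: "continuous_on UNIV g" unfolding g_def by (intro continuous_intros)
  have pos: "0 < max (s * s) (\<epsilon> * \<epsilon>)" for s using \<epsilon>(1) by (simp add: less_max_iff_disj)
  then have "max (s * s) (\<epsilon> * \<epsilon>) \<noteq> 0" for s by (metis less_irrefl)
  then have r: "continuous_on UNIV r"
    unfolding r_def by (intro continuous_intros) auto
  define e where "e = cfc g y"
  have e: "e\<^sup>\<star> = e" "coeff1 e = 0"
    unfolding e_def by (rule star_cfc[OF y(1) g], rule coeff1_cfc[OF y g])
      (use \<epsilon>(1) in \<open>simp add: g_def\<close>)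
  have "e \<noteq> 0"
  proof
    assume "e = 0"
    have clamp: "continuous_on UNIV (\<lambda>s. max (- \<epsilon>) (min \<epsilon> s))" by (intro continuous_intros)
    have "e = y - cfc (\<lambda>s. max (- \<epsilon>) (min \<epsilon> s)) y"
      unfolding e_def g_def by (simp only: cfc_diff[OF y(1)] cfc_id[OF y(1)] clamp continuous_on_id)
    then have "y = cfc (\<lambda>s. max (- \<epsilon>) (min \<epsilon> s)) y" using \<open>e = 0\<close> by simp
    moreover have "norm (cfc (\<lambda>s. max (- \<epsilon>) (min \<epsilon> s)) y) \<le> \<epsilon>"
      by (rule cfc_norm_le[OF y(1) clamp]) (use \<epsilon>(1) in \<open>auto simp: max_def min_def\<close>)
    ultimately have "norm y \<le> \<epsilon>" by (simp only:)
    with norm_y show False by simp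
  qed
  have gr: "g s * (s * r s) = g s" for s
  proof (cases "\<bar>s\<bar> \<le> \<epsilon>")
    case True
    then have "g s = 0" by (auto simp: g_def max_def min_def)
    then show ?thesis by simp
  next
    case False
    then have "\<epsilon> * \<epsilon> \<le> \<bar>s\<bar> * \<bar>s\<bar>" using \<epsilon>(1) by (intro mult_mono) auto
    then have "s * r s = 1" using False \<epsilon>(1) by (auto simp: r_def max_def)
    then show ?thesis by simp
  qed
  have eyr: "e * (y * cfc r y) = e"
  proof -
    have "e * (y * cfc r y) = cfc (\<lambda>s. g s * (s * r s)) y"
      unfolding e_def by (simp only: cfc_mult[OF y(1)] cfc_id[OF y(1)] g r continuous_intros)
    then show ?thesis by (simp only: gr) (simp add: e_def)
  qed
  have pe: "p * e = 0"
  proof -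
    have "e = cfc (\<lambda>s. s * (r s * g s)) y"
      unfolding e_def by (rule arg_cong[where f="\<lambda>f. cfc f y"]) (use gr in \<open>auto simp: mult_ac\<close>)
    also have "\<dots> = y * (cfc r y * e)"
      unfolding e_def by (simp only: cfc_mult[OF y(1)] cfc_id[OF y(1)] g r continuous_intros)
    finally have "p * e = (p * y) * (cfc r y * e)" by (metis mult.assoc)
    then show ?thesis by (simp add: py)
  qed
  then have "(p * e)\<^sup>\<star> = 0" by simp
  then have ep: "e * p = 0" by (simp add: star_mult e p)
  have norm_zr: "norm (z\<^sup>\<star> * cfc r y) \<le> 1 / sqrt \<epsilon>"
  proof -
    have "(norm (z\<^sup>\<star> * cfc r y))\<^sup>2 = norm ((z\<^sup>\<star> * cfc r y)\<^sup>\<star> * (z\<^sup>\<star> * cfc r y))"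
      by (simp only: cstar_identity)
    also have "(z\<^sup>\<star> * cfc r y)\<^sup>\<star> * (z\<^sup>\<star> * cfc r y) = cfc r y * (y * cfc r y)"
      by (simp only: star_mult star_star star_cfc[OF y(1) r]) (simp only: y_def mult.assoc)
    also have "\<dots> = cfc (\<lambda>s. r s * (s * r s)) y"
      by (simp only: cfc_mult[OF y(1)] cfc_id[OF y(1)] r continuous_intros)
    also have "norm \<dots> \<le> 1 / \<epsilon>"
    proof (rule cfc_norm_le[OF y(1)])
      show "continuous_on UNIV (\<lambda>s. r s * (s * r s))" by (intro continuous_intros r)
      fix s
      show "\<bar>r s * (s * r s)\<bar> \<le> 1 / \<epsilon>"
      proof (cases "\<bar>s\<bar> \<le> \<epsilon>")
        case True
        have le: "\<bar>s\<bar> * \<bar>s\<bar> \<le> \<epsilon> * \<epsilon>" using True by (intro mult_mono) auto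
        then have rs: "r s = s / (\<epsilon> * \<epsilon>)" by (simp add: r_def max_def)
        have "\<bar>s\<bar> * \<bar>s\<bar> * \<bar>s\<bar> \<le> \<epsilon> * \<epsilon> * \<epsilon>" using le True \<epsilon>(1) by (intro mult_mono) auto
        then show ?thesis using \<epsilon>(1) by (simp add: rs abs_mult field_simps)
      next
        case False
        then have "\<epsilon> * \<epsilon> \<le> \<bar>s\<bar> * \<bar>s\<bar>" using \<epsilon>(1) by (intro mult_mono) auto
        then have rs: "r s = 1 / s" using False \<epsilon>(1) by (auto simp: r_def max_def)
        show ?thesis using False \<epsilon>(1) by (simp add: rs frac_le)
      qed
    qed
    finally have "norm (z\<^sup>\<star> * cfc r y) \<le> sqrt (1 / \<epsilon>)" by (intro real_le_rsqrt) simp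
    then show ?thesis by (simp add: real_sqrt_divide)
  qed
  have lower: "sqrt \<epsilon> * norm (e * d * e) \<le> norm (e * d * e * x)" for d
  proof -
    define b where "b = e * d * e"
    have "b * p = 0" by (simp add: b_def mult.assoc ep)
    then have bz: "b * z = b * x" by (simp add: z_def algebra_simps mult.assoc[symmetric])
    have "b = b * (y * cfc r y)" unfolding b_def mult.assoc eyr by simp
    also have "\<dots> = (b * x) * (z\<^sup>\<star> * cfc r y)" unfolding bz[symmetric] y_def by (simp only: mult.assoc)
    finally have "norm b \<le> norm (b * x) * norm (z\<^sup>\<star> * cfc r y)" by (metis norm_mult_ineq)
    also have "\<dots> \<le> norm (b * x) * (1 / sqrt \<epsilon>)" by (intro mult_left_mono norm_zr) simp
    finally show ?thesis unfolding b_def[symmetric] using \<epsilon>(1) by (simp add: field_simps)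
  qed
  have "0 < sqrt \<epsilon>" using \<epsilon>(1) by simp
  from unsplittable_exists[OF x(1) e(1) \<open>e \<noteq> 0\<close> e(2) this lower]
  obtain a d where a: "unsplittable a" "a = e * d * e" "a\<^sup>\<star> = a" "a \<noteq> 0" by blast
  have "coeff1 a = 0" by (simp add: a(2) e)
  then obtain q d' where q: "minimal_projection q" "q = a * d' * a"
    using unsplittable_minimal_projection[OF a(1,3,4)] by blast
  have q_e: "q = e * (d * e * d' * e * d) * e" unfolding q(2) a(2) by (simp only: mult.assoc)
  have "norm q = 1" using q(1) by (intro norm_projection) (auto simp: minimal_projection_def)
  then have "sqrt \<epsilon> \<le> norm (q * x)"
    using lower[of "d * e * d' * e * d"] unfolding q_e[symmetric] by simp
  moreover have "p * q = 0" unfolding q_e by (simp add: mult.assoc[symmetric] pe)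
  ultimately show ?thesis using q(1) by blast
qed

text \<open>Finite sums of mutually orthogonal minimal projections.\<close>
inductive finite_projection :: "'a::cstar_algebra unitization \<Rightarrow> bool" where
  finite_projection_0: "finite_projection 0"
| finite_projection_add:
    "finite_projection p \<Longrightarrow> minimal_projection q \<Longrightarrow> p * q = 0 \<Longrightarrow> finite_projection (p + q)"

lemma finite_projection_projection:
  assumes "finite_projection p"
  shows "p\<^sup>\<star> = p \<and> p * p = p \<and> coeff1 p = 0"
  using assms
proof induction
  case (finite_projection_add p q)
  then have q: "q\<^sup>\<star> = q" "q * q = q" "coeff1 q = 0" by (auto simp: minimal_projection_def)
  have "q * p = (p * q)\<^sup>\<star>" unfolding star_mult using q finite_projection_add.IH by simp
  then have "q * p = 0" using finite_projection_add.hyps(3) by simp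
  then show ?case using finite_projection_add q by (simp add: star_add algebra_simps)
qed simp

text \<open>Otherwise minimal projections on which \<open>x\<close> is large could be split off one after another.\<close>
theorem finite_projection_exhausts:
  fixes x :: "'a::cstar_algebra unitization"
  assumes x: "orthogonally_small x" "coeff1 x = 0" and \<epsilon>: "0 < \<epsilon>"
  shows "\<exists>p. finite_projection p \<and> (norm ((1 - p) * x))\<^sup>2 \<le> \<epsilon>"
proof (rule ccontr)
  assume "\<not> ?thesis"
  then have large: "\<epsilon> < (norm ((1 - p) * x))\<^sup>2" if "finite_projection p" for p
    using that by (meson not_less)
  have "\<exists>p. \<forall>n::nat. finite_projection (p n) \<and>
    (\<exists>q. minimal_projection q \<and> p n * q = 0 \<and> sqrt \<epsilon> \<le> norm (q * x) \<and> p (Suc n) = p n + q)"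
  proof (rule dependent_nat_choice)
    show "\<exists>p :: 'a unitization. finite_projection p" using finite_projection_0 by blast
    fix p :: "'a unitization" and n :: nat
    assume p: "finite_projection p"
    obtain q where "minimal_projection q" "p * q = 0" "sqrt \<epsilon> \<le> norm (q * x)"
      using minimal_projection_exists[OF x _ _ \<epsilon> large[OF p]] finite_projection_projection[OF p]
      by blast
    then show "\<exists>p'. finite_projection p' \<and>
      (\<exists>q. minimal_projection q \<and> p * q = 0 \<and> sqrt \<epsilon> \<le> norm (q * x) \<and> p' = p + q)"
      using finite_projection_add[OF p] by blast
  qed
  then obtain p where p: "\<And>n::nat. finite_projection (p n)"
    and step: "\<And>n. \<exists>q. minimal_projection q \<and> p n * q = 0 \<and> sqrt \<epsilon> \<le> norm (q * x) \<and> p (Suc n) = p n + q"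
    by blast
  from step obtain q where q: "\<And>n. minimal_projection (q n)" "\<And>n. p n * q n = 0"
    "\<And>n. sqrt \<epsilon> \<le> norm (q n * x)" "\<And>n. p (Suc n) = p n + q n"
    by metis
  have proj: "(p n)\<^sup>\<star> = p n" "p n * p n = p n" for n
    using finite_projection_projection[OF p] by auto
  have q_sa: "(q n)\<^sup>\<star> = q n" "coeff1 (q n) = 0" "norm (q n) = 1" "q n * q n = q n" for n
    using q(1)[of n] norm_projection[of "q n"] by (auto simp: minimal_projection_def)
  have nested: "p m * p n = p m" if "m \<le> n" for m n
    using that
  proof (induction n rule: dec_induct)
    case (step n)
    have "p m * q n = p m * (p n * q n)" by (simp only: mult.assoc[symmetric] step.IH)
    then show ?case by (simp add: q distrib_left step.IH)
  qed (rule proj)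
  have p_q: "p m * q n = 0" if "m \<le> n" for m n
  proof -
    have "p m * q n = p m * (p n * q n)" by (simp only: mult.assoc[symmetric] nested[OF that])
    then show ?thesis by (simp add: q)
  qed
  have orth_less: "q m * q n = 0" if "m < n" for m n
  proof -
    have "q m * q n = p (Suc m) * q n - p m * q n" by (simp add: q distrib_right)
    then show ?thesis using that p_q[of m n] p_q[of "Suc m" n] by simp
  qed
  have orth: "q m * q n = 0" if "m \<noteq> n" for m n
  proof (cases "m < n")
    case False
    then have "(q n * q m)\<^sup>\<star> = 0" using that orth_less[of n m] by simp
    then show ?thesis by (simp add: star_mult q_sa)
  qed (rule orth_less)
  have "0 < sqrt \<epsilon>" using \<epsilon> by simp
  obtain n where "norm (q n * x) < sqrt \<epsilon>"
    by (rule orthogonally_smallD[OF x(1) q_sa(2) q_sa(1) q_sa(3) orth \<open>0 < sqrt \<epsilon>\<close>])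
  with q(3)[of n] show False by simp
qed

text \<open>The map \<open>a \<mapsto> p a q\<close> sends the unit ball into a compact set.\<close>
definition compact_corner :: "'a::cstar_algebra unitization \<Rightarrow> 'a unitization \<Rightarrow> bool" where
  "compact_corner p q \<longleftrightarrow> (\<exists>K. compact K \<and> (\<forall>a. norm a \<le> 1 \<longrightarrow> p * a * q \<in> K))"

lemma compact_corner_add_left:
  assumes "compact_corner p r" "compact_corner q r"
  shows "compact_corner (p + q) r"
proof -
  obtain K L where K: "compact K" "\<And>a. norm a \<le> 1 \<Longrightarrow> p * a * r \<in> K"
    and L: "compact L" "\<And>a. norm a \<le> 1 \<Longrightarrow> q * a * r \<in> L"
    using assms unfolding compact_corner_def by blast
  have "(p + q) * a * r \<in> {k + l |k l. k \<in> K \<and> l \<in> L}" if "norm a \<le> 1" for a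
    unfolding distrib_right using K(2)[OF that] L(2)[OF that] by blast
  then show ?thesis
    unfolding compact_corner_def using compact_sums[OF K(1) L(1)]
    by (intro exI[of _ "{k + l |k l. k \<in> K \<and> l \<in> L}"] conjI allI impI)
qed

lemma compact_corner_add_right:
  assumes "compact_corner p r" "compact_corner p q"
  shows "compact_corner p (r + q)"
proof -
  obtain K L where K: "compact K" "\<And>a. norm a \<le> 1 \<Longrightarrow> p * a * r \<in> K"
    and L: "compact L" "\<And>a. norm a \<le> 1 \<Longrightarrow> p * a * q \<in> L"
    using assms unfolding compact_corner_def by blast
  have "p * a * (r + q) \<in> {k + l |k l. k \<in> K \<and> l \<in> L}" if "norm a \<le> 1" for a
    unfolding distrib_left using K(2)[OF that] L(2)[OF that] by blast
  then show ?thesis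
    unfolding compact_corner_def using compact_sums[OF K(1) L(1)]
    by (intro exI[of _ "{k + l |k l. k \<in> K \<and> l \<in> L}"] conjI allI impI)
qed

text \<open>Fix \<open>v = p a\<^sub>0 q \<noteq> 0\<close>. For any \<open>w = p a q\<close> minimality makes \<open>v\<^sup>* v\<close> a nonzero multiple of \<open>q\<close> and
  \<open>w v\<^sup>*\<close> a multiple of \<open>p\<close>, so \<open>w\<close> is a multiple of \<open>v\<close>.\<close>
lemma compact_corner_minimal:
  assumes p: "minimal_projection p" and q: "minimal_projection q"
  shows "compact_corner p q"
proof (cases "\<forall>a. p * a * q = 0")
  case True
  then show ?thesis unfolding compact_corner_def by (intro exI[of _ "{0}"]) simp
next
  case False
  then obtain a0 where a0: "p * a0 * q \<noteq> 0" by blast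
  have pq: "p\<^sup>\<star> = p" "p * p = p" "q\<^sup>\<star> = q" "q * q = q" "norm p = 1" "norm q = 1"
    using p q norm_projection by (auto simp: minimal_projection_def)
  define v where "v = p * a0 * q"
  have v_star: "v\<^sup>\<star> = q * a0\<^sup>\<star> * p" by (simp add: v_def star_mult pq mult.assoc)
  have pv: "p * v = v" unfolding v_def by (simp only: mult.assoc[symmetric] pq)
  obtain \<mu> where "q * (a0\<^sup>\<star> * p * a0) * q = \<mu> *\<^sub>C q"
    using q unfolding minimal_projection_def by blast
  moreover have "v\<^sup>\<star> * v = q * (a0\<^sup>\<star> * (p * p) * a0) * q"
    unfolding v_star by (simp only: v_def mult.assoc)
  ultimately have vv: "v\<^sup>\<star> * v = \<mu> *\<^sub>C q" by (simp only: pq)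
  have \<mu>: "\<mu> \<noteq> 0"
    using vv star_mult_self_eq_0[of v] a0 by (auto simp: v_def scaleC_zero_left)
  define K where "K = (\<lambda>c. c *\<^sub>C v) ` cball 0 (1 / norm v)"
  have "bounded_linear (\<lambda>c. c *\<^sub>C v)"
    by (rule bounded_linear_intro[where K="norm v"])
      (simp_all add: scaleC_add_left scaleC_of_real_mult norm_scaleC)
  then have "compact K"
    unfolding K_def
    by (intro compact_continuous_image compact_cball linear_continuous_on)
  moreover have "p * a * q \<in> K" if a: "norm a \<le> 1" for a
  proof -
    define w where "w = p * a * q"
    have wq: "w * q = w" unfolding w_def by (simp only: mult.assoc pq)
    obtain \<nu> where \<nu>: "p * (a * q * a0\<^sup>\<star>) * p = \<nu> *\<^sub>C p"
      using p unfolding minimal_projection_def by blast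
    have "w * v\<^sup>\<star> = p * (a * (q * q) * a0\<^sup>\<star>) * p"
      unfolding v_star w_def by (simp only: mult.assoc)
    then have "w * v\<^sup>\<star> = \<nu> *\<^sub>C p" by (simp only: pq \<nu>)
    then have "w * (v\<^sup>\<star> * v) = \<nu> *\<^sub>C v"
      by (simp only: mult.assoc[symmetric] scaleC_mult_left pv)
    then have "\<mu> *\<^sub>C w = \<nu> *\<^sub>C v" by (simp only: vv scaleC_mult_right wq)
    then have "inverse \<mu> *\<^sub>C \<mu> *\<^sub>C w = inverse \<mu> *\<^sub>C \<nu> *\<^sub>C v" by (rule arg_cong)
    then have w: "w = (inverse \<mu> * \<nu>) *\<^sub>C v" using \<mu> by (simp add: scaleC_scaleC scaleC_one)
    have "norm w \<le> norm p * norm a * norm q"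
      unfolding w_def
      by (rule order_trans[OF norm_mult_ineq mult_right_mono[OF norm_mult_ineq norm_ge_zero]])
    then have "norm w \<le> 1" using a by (simp add: pq)
    then have "cmod (inverse \<mu> * \<nu>) * norm v \<le> 1" by (simp only: w norm_scaleC)
    then have "inverse \<mu> * \<nu> \<in> cball 0 (1 / norm v)"
      using a0 by (simp add: v_def pos_le_divide_eq)
    then show ?thesis unfolding K_def w_def[symmetric] using w by blast
  qed
  ultimately show ?thesis unfolding compact_corner_def by blast
qed

lemma compact_corner_finite_projection:
  assumes "finite_projection p" "finite_projection q"
  shows "compact_corner p q"
proof -
  have zero: "compact_corner 0 r" "compact_corner r 0" for r :: "'a unitization"
    unfolding compact_corner_def by (rule exI[of _ "{0}"], simp)+
  have minimal: "compact_corner p r" if "minimal_projection r" for r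
    using assms(1)
  proof induction
    case (finite_projection_add p q)
    show ?case
      by (rule compact_corner_add_left[OF finite_projection_add.IH
            compact_corner_minimal[OF finite_projection_add.hyps(2) that]])
  qed (rule zero)
  show ?thesis
    using assms(2)
  proof induction
    case (finite_projection_add q r)
    show ?case
      by (rule compact_corner_add_right[OF finite_projection_add.IH
            minimal[OF finite_projection_add.hyps(2)]])
  qed (rule zero)
qed

text \<open>Take \<open>e = f(v\<^sup>* v)\<close> with \<open>f(s) = s\<^sup>2 / (s\<^sup>2 + \<epsilon>\<^sup>2)\<close> and \<open>\<epsilon> = \<eta>\<^sup>2\<close>; then \<open>\<bar>s\<bar> (1 - f(s))\<^sup>2 \<le> \<epsilon>\<close>.\<close>
lemma right_approximate_unit:
  fixes v :: "'a::cstar_algebra unitization"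
  assumes v: "coeff1 v = 0" and \<eta>: "0 < \<eta>"
  shows "\<exists>e. e\<^sup>\<star> = e \<and> coeff1 e = 0 \<and> norm e \<le> 1 \<and> norm (v - v * e) \<le> \<eta>"
proof -
  define h where "h = v\<^sup>\<star> * v"
  have h: "h\<^sup>\<star> = h" "coeff1 h = 0" by (simp_all add: h_def star_mult star_star v)
  define \<epsilon> where "\<epsilon> = \<eta>\<^sup>2"
  have \<epsilon>: "0 < \<epsilon>" using \<eta> by (simp add: \<epsilon>_def)
  define f :: "real \<Rightarrow> real" where "f s = s * s / (s * s + \<epsilon> * \<epsilon>)" for s
  have pos: "0 < s * s + \<epsilon> * \<epsilon>" for s using \<epsilon> by (intro add_nonneg_pos) simp_all
  then have "s * s + \<epsilon> * \<epsilon> \<noteq> 0" for s by (metis less_irrefl)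
  then have f: "continuous_on UNIV f" unfolding f_def by (intro continuous_intros) auto
  define e where "e = cfc f h"
  have e: "e\<^sup>\<star> = e" "coeff1 e = 0"
    unfolding e_def by (rule star_cfc[OF h(1) f], rule coeff1_cfc[OF h f]) (simp add: f_def)
  have "norm e \<le> 1"
    unfolding e_def
    by (rule cfc_norm_le[OF h(1) f]) (use pos in \<open>simp add: f_def abs_mult divide_le_eq less_imp_le\<close>)
  moreover have "norm (v - v * e) \<le> \<eta>"
  proof -
    have "v - v * e = v * (1 - e)" by (simp add: right_diff_distrib)
    then have "(norm (v - v * e))\<^sup>2 = norm ((v * (1 - e))\<^sup>\<star> * (v * (1 - e)))"
      by (simp only: cstar_identity)
    also have "(v * (1 - e))\<^sup>\<star> * (v * (1 - e)) = (1 - e) * (h * (1 - e))"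
      by (simp only: star_mult star_diff star_one e h_def mult.assoc)
    also have "1 - e = cfc (\<lambda>s. 1 - f s) h"
      by (simp only: cfc_diff[OF h(1)] cfc_const[OF h(1)] f continuous_on_const e_def scaleR_one)
    also have "cfc (\<lambda>s. 1 - f s) h * (h * cfc (\<lambda>s. 1 - f s) h) = cfc (\<lambda>s. (1 - f s) * (s * (1 - f s))) h"
      by (simp only: cfc_mult[OF h(1)] cfc_id[OF h(1)] f continuous_intros)
    also have "norm \<dots> \<le> \<epsilon>"
    proof (rule cfc_norm_le[OF h(1)])
      show "continuous_on UNIV (\<lambda>s. (1 - f s) * (s * (1 - f s)))" by (intro continuous_intros f)
      fix s :: real
      define w where "w = s * s + \<epsilon> * \<epsilon>"
      have w: "0 < w" using pos by (simp add: w_def)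
      have "f s = (w - \<epsilon> * \<epsilon>) / w" by (simp add: f_def w_def)
      then have "1 - f s = \<epsilon> * \<epsilon> / w" using w by (simp add: diff_divide_distrib)
      then have eq: "\<bar>(1 - f s) * (s * (1 - f s))\<bar> = \<epsilon> * (\<epsilon> * \<bar>s\<bar>) * (\<epsilon> * \<epsilon>) / (w * w)"
        using w \<epsilon> by (simp add: abs_mult)
      have "0 \<le> (\<bar>s\<bar> - \<epsilon>)\<^sup>2" by simp
      then have "2 * (\<epsilon> * \<bar>s\<bar>) \<le> w" by (simp add: w_def power2_eq_square algebra_simps)
      moreover have "0 \<le> \<epsilon> * \<bar>s\<bar>" using \<epsilon> by simp
      ultimately have "\<epsilon> * \<bar>s\<bar> \<le> w" by linarith
      moreover have "\<epsilon> * \<epsilon> \<le> w" by (simp add: w_def)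
      ultimately have "(\<epsilon> * \<bar>s\<bar>) * (\<epsilon> * \<epsilon>) \<le> w * w" using w by (intro mult_mono) simp_all
      then have "\<epsilon> * ((\<epsilon> * \<bar>s\<bar>) * (\<epsilon> * \<epsilon>)) \<le> \<epsilon> * (w * w)" using \<epsilon> by (intro mult_left_mono) simp_all
      then show "\<bar>(1 - f s) * (s * (1 - f s))\<bar> \<le> \<epsilon>"
        unfolding eq using w by (simp add: divide_le_eq mult.assoc)
    qed
    finally show ?thesis using \<eta> unfolding \<epsilon>_def by (simp add: power2_le_iff_abs_le)
  qed
  ultimately show ?thesis using e by blast
qed


section \<open>Compactness\<close>

lemma compact_operatorI_approx:
  fixes T :: "'a::complex_normed_vector \<Rightarrow> 'b::{complex_normed_vector, complete_space}"
  assumes T: "bounded_clinear T"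
    and approx: "\<And>e. 0 < e \<Longrightarrow> \<exists>K. compact K \<and> (\<forall>a. norm a \<le> 1 \<longrightarrow> (\<exists>k\<in>K. norm (T a - k) \<le> e))"
  shows "compact_operator T"
  unfolding compact_operator_def compact_eq_totally_bounded
proof (intro conjI T allI impI)
  show "complete (closure (T ` cball 0 1))" by (simp add: complete_eq_closed)
  fix e :: real
  assume e: "0 < e"
  then obtain K where K: "compact K" "\<And>a. norm a \<le> 1 \<Longrightarrow> \<exists>k\<in>K. norm (T a - k) \<le> e / 3"
    using approx[of "e / 3"] by auto
  obtain F where F: "finite F" "K \<subseteq> (\<Union>x\<in>F. ball x (e / 3))"
    using K(1) e unfolding compact_eq_totally_bounded by (metis divide_pos_pos zero_less_numeral)
  have "closure (T ` cball 0 1) \<subseteq> (\<Union>x\<in>F. ball x e)"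
  proof
    fix z
    assume "z \<in> closure (T ` cball 0 1)"
    then obtain a where a: "norm a \<le> 1" "dist (T a) z < e / 3"
      using e unfolding closure_approachable
      by (metis divide_pos_pos zero_less_numeral imageE mem_cball_0)
    obtain k where k: "k \<in> K" "norm (T a - k) \<le> e / 3" using K(2)[OF a(1)] by blast
    obtain f where f: "f \<in> F" "dist f k < e / 3" using F(2) k(1) by fastforce
    have "dist f z \<le> dist f k + dist (T a) k + dist (T a) z"
      by (metis add.assoc add_left_mono dist_commute dist_triangle order_trans)
    also have "\<dots> < e" using a(2) k(2) f(2) by (simp add: dist_norm)
    finally show "z \<in> (\<Union>x\<in>F. ball x e)" using f(1) by auto
  qed
  with F(1) show "\<exists>k. finite k \<and> closure (T ` cball 0 1) \<subseteq> (\<Union>x\<in>k. ball x e)" by blast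
qed

text \<open>Up to a small error, \<open>T\<close> factors through the corner of a finite projection \<open>p\<close>: by Cauchy--Schwarz,
  \<open>T\<close> is small on the elements \<open>(1 - p) a\<close> and \<open>a (1 - p)\<close>, because \<open>x\<^sup>* (1 - p) a (1 - p) x\<close> is small.\<close>
theorem compact_operator_if_orthogonally_small:
  fixes x :: "'a::cstar_algebra" and T :: "'a \<Rightarrow> 'a"
  assumes x: "orthogonally_small (embed x)"
    and T: "bounded_clinear T" and pos: "positive_map T" and le: "T \<preceq> conj_op x"
  shows "compact_operator T"
proof (rule compact_operatorI_approx[OF T])
  interpret T: bounded_linear T using T by (simp add: bounded_clinear_def)
  obtain B where B: "0 < B" "\<And>a. norm (T a) \<le> norm a * B" using T.pos_bounded by blast
  fix e :: real
  assume e: "0 < e"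
  define t where "t = e / (4 * B)"
  define \<epsilon> where "\<epsilon> = t * (e / 4)"
  \<comment> \<open>These choices give \<open>t B + \<epsilon> / t = e / 2\<close>, the bound that Cauchy--Schwarz yields below.\<close>
  have t: "0 < t" and \<epsilon>: "0 < \<epsilon>" using e B by (simp_all add: t_def \<epsilon>_def)
  have half: "t * B + \<epsilon> / t = e / 2" using t B by (simp add: \<epsilon>_def) (simp add: t_def)
  obtain p where p: "finite_projection p" "(norm ((1 - p) * embed x))\<^sup>2 \<le> \<epsilon>"
    using finite_projection_exhausts[OF x _ \<epsilon>] by auto
  have proj: "p\<^sup>\<star> = p" "p * p = p" "coeff1 p = 0"
    using finite_projection_projection[OF p(1)] by auto
  have norm_p: "norm p \<le> 1" by (rule norm_projection_le_1[OF proj(1,2)])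
  have norm_1p: "norm (1 - p) \<le> 2" using norm_triangle_ineq4[of 1 p] norm_p by simp
  have T_small: "norm (T (c\<^sup>\<star> * c)) \<le> \<epsilon>" if c: "c = base (E * (1 - p))" "coeff1 E = 0" "norm E \<le> 1" for c E
  proof -
    have "embed c = E * (1 - p)" unfolding c(1) by (rule embed_base) (simp add: c)
    then have "norm (c * x) = norm (E * ((1 - p) * embed x))"
      by (metis norm_embed embed_simps(5) mult.assoc)
    also have "\<dots> \<le> norm E * norm ((1 - p) * embed x)" by (rule norm_mult_ineq)
    also have "\<dots> \<le> 1 * norm ((1 - p) * embed x)" by (intro mult_right_mono c) simp
    finally have sq: "(norm (c * x))\<^sup>2 \<le> (norm ((1 - p) * embed x))\<^sup>2"
      by (intro power_mono) simp_all
    have conj: "conj_op x (c\<^sup>\<star> * c) = (c * x)\<^sup>\<star> * (c * x)"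
      by (simp add: conj_op_def star_mult mult.assoc)
    have "norm (T (c\<^sup>\<star> * c)) \<le> norm (conj_op x (c\<^sup>\<star> * c))"
      using pos le positive_element_star_mult[of c]
      by (intro norm_le_if_positive_le) (auto simp: positive_map_def op_le_def)
    with sq p(2) show ?thesis unfolding conj cstar_identity by linarith
  qed
  have T_bound: "norm (T (c\<^sup>\<star> * c)) \<le> B" if "norm c \<le> 1" for c
  proof -
    have "norm (c\<^sup>\<star> * c) \<le> 1" using that by (simp add: cstar_identity power_le_one)
    then have "norm (c\<^sup>\<star> * c) * B \<le> 1 * B" using B(1) by (intro mult_right_mono) simp_all
    then show ?thesis using B(2)[of "c\<^sup>\<star> * c"] by linarith
  qed
  have norm_T_base: "norm (T (base v)) \<le> norm v * B" if "coeff1 v = 0" for v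
    using B(2)[of "base v"] by (simp add: norm_base that)
  have right: "norm (T (base (v * (1 - p)))) \<le> e / 2" if v: "coeff1 v = 0" "norm v \<le> 1" for v
  proof (rule field_le_epsilon)
    fix \<eta>' :: real
    assume "0 < \<eta>'"
    define \<eta> where "\<eta> = \<eta>' / (2 * B)"
    have \<eta>: "0 < \<eta>" using \<open>0 < \<eta>'\<close> B by (simp add: \<eta>_def)
    obtain E where E: "E\<^sup>\<star> = E" "coeff1 E = 0" "norm E \<le> 1" "norm (v - v * E) \<le> \<eta>"
      using right_approximate_unit[OF v(1) \<eta>] by blast
    define c where "c = base (E * (1 - p))"
    define b where "b = base (v\<^sup>\<star>)"
    \<comment> \<open>\<open>E\<close> is only needed to write \<open>v (1 - p)\<close> as a product \<open>b\<^sup>* c\<close> up to a small error.\<close>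
    have bc: "b\<^sup>\<star> * c = base (v * E * (1 - p))"
      using v E by (simp add: b_def c_def star_star scaleC_zero_left mult.assoc proj)
    have "norm b \<le> 1" using v by (simp add: b_def norm_base)
    have "norm (T (b\<^sup>\<star> * c)) \<le> t * norm (T (b\<^sup>\<star> * b)) + norm (T (c\<^sup>\<star> * c)) / t"
      by (rule positive_map_cauchy_schwarz[OF T pos t])
    also have "\<dots> \<le> t * B + \<epsilon> / t"
      using T_bound[OF \<open>norm b \<le> 1\<close>] T_small[OF c_def E(2,3)] t
      by (intro add_mono mult_left_mono divide_right_mono) simp_all
    finally have 1: "norm (T (base (v * E * (1 - p)))) \<le> e / 2" by (simp only: bc half)
    have "norm ((v - v * E) * (1 - p)) \<le> norm (v - v * E) * norm (1 - p)" by (rule norm_mult_ineq)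
    also have "\<dots> \<le> \<eta> * 2" using \<eta> by (intro mult_mono E norm_1p) simp_all
    finally have "norm ((v - v * E) * (1 - p)) * B \<le> \<eta> * 2 * B" using B by (intro mult_right_mono) simp_all
    then have 2: "norm (T (base ((v - v * E) * (1 - p)))) \<le> \<eta>'"
      using norm_T_base[of "(v - v * E) * (1 - p)"] v E B(1) by (simp add: \<eta>_def)
    have "v * (1 - p) = v * E * (1 - p) + (v - v * E) * (1 - p)" by (simp add: left_diff_distrib)
    then have "T (base (v * (1 - p))) = T (base (v * E * (1 - p))) + T (base ((v - v * E) * (1 - p)))"
      by (simp only: unitization_sel_simps T.add)
    then have "norm (T (base (v * (1 - p)))) \<le>
        norm (T (base (v * E * (1 - p)))) + norm (T (base ((v - v * E) * (1 - p))))"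
      by (simp only: norm_triangle_ineq)
    with 1 2 show "norm (T (base (v * (1 - p)))) \<le> e / 2 + \<eta>'" by linarith
  qed
  have left: "norm (T (base ((1 - p) * v))) \<le> e / 2" if v: "coeff1 v = 0" "norm v \<le> 1" for v
  proof (rule field_le_epsilon)
    fix \<eta>' :: real
    assume "0 < \<eta>'"
    define \<eta> where "\<eta> = \<eta>' / (2 * B)"
    have \<eta>: "0 < \<eta>" using \<open>0 < \<eta>'\<close> B by (simp add: \<eta>_def)
    have "coeff1 (v\<^sup>\<star>) = 0" by (simp add: v)
    then obtain E where E: "E\<^sup>\<star> = E" "coeff1 E = 0" "norm E \<le> 1" "norm (v\<^sup>\<star> - v\<^sup>\<star> * E) \<le> \<eta>"
      using right_approximate_unit[OF _ \<eta>] by blast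
    have "(v - E * v)\<^sup>\<star> = v\<^sup>\<star> - v\<^sup>\<star> * E" by (simp add: star_mult E(1))
    then have E_left: "norm (v - E * v) \<le> \<eta>" using E(4) norm_star[of "v - E * v"] by simp
    define b where "b = base (E * (1 - p))"
    define c where "c = base v"
    have "b\<^sup>\<star> = base ((1 - p) * E)"
      unfolding b_def unitization_star_sel_simps[symmetric] star_mult by (simp only: star_diff star_one proj E)
    then have bc: "b\<^sup>\<star> * c = base ((1 - p) * E * v)"
      using v E by (simp add: c_def scaleC_zero_left proj)
    have "norm c \<le> 1" using v by (simp add: c_def norm_base)
    have "norm (T (b\<^sup>\<star> * c)) \<le> (1 / t) * norm (T (b\<^sup>\<star> * b)) + norm (T (c\<^sup>\<star> * c)) / (1 / t)"
      using t by (intro positive_map_cauchy_schwarz[OF T pos]) simp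
    also have "\<dots> \<le> (1 / t) * \<epsilon> + B / (1 / t)"
      using T_bound[OF \<open>norm c \<le> 1\<close>] T_small[OF b_def E(2,3)] t
      by (intro add_mono mult_left_mono divide_right_mono) simp_all
    also have "\<dots> = e / 2" using half by (simp add: mult.commute)
    finally have 1: "norm (T (base ((1 - p) * E * v))) \<le> e / 2" by (simp only: bc)
    have "norm ((1 - p) * (v - E * v)) \<le> norm (1 - p) * norm (v - E * v)" by (rule norm_mult_ineq)
    also have "\<dots> \<le> 2 * \<eta>" using \<eta> by (intro mult_mono E_left norm_1p) simp_all
    finally have "norm ((1 - p) * (v - E * v)) * B \<le> 2 * \<eta> * B" using B by (intro mult_right_mono) simp_all
    then have 2: "norm (T (base ((1 - p) * (v - E * v)))) \<le> \<eta>'"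
      using norm_T_base[of "(1 - p) * (v - E * v)"] v E B(1) by (simp add: \<eta>_def)
    have "(1 - p) * v = (1 - p) * E * v + (1 - p) * (v - E * v)"
      by (simp add: right_diff_distrib mult.assoc)
    then have "T (base ((1 - p) * v)) = T (base ((1 - p) * E * v)) + T (base ((1 - p) * (v - E * v)))"
      by (simp only: unitization_sel_simps T.add)
    then have "norm (T (base ((1 - p) * v))) \<le>
        norm (T (base ((1 - p) * E * v))) + norm (T (base ((1 - p) * (v - E * v))))"
      by (simp only: norm_triangle_ineq)
    with 1 2 show "norm (T (base ((1 - p) * v))) \<le> e / 2 + \<eta>'" by linarith
  qed
  obtain L where L: "compact L" "\<And>v. norm v \<le> 1 \<Longrightarrow> p * v * p \<in> L"
    using compact_corner_finite_projection[OF p(1) p(1)] unfolding compact_corner_def by blast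
  define K where "K = (\<lambda>v. T (base v)) ` L"
  have "compact K"
    unfolding K_def
    by (intro compact_continuous_image L linear_continuous_on
        bounded_linear_compose[OF T.bounded_linear_axioms bounded_linear_base])
  moreover have "\<exists>k\<in>K. norm (T a - k) \<le> e" if a: "norm a \<le> 1" for a
  proof
    define v where "v = embed a"
    have v: "coeff1 v = 0" "norm v \<le> 1" "base v = a" using a by (simp_all add: v_def norm_embed)
    show "T (base (p * v * p)) \<in> K" unfolding K_def using L(2)[OF v(2)] by (rule imageI)
    have "norm (p * v) \<le> norm p * norm v" by (rule norm_mult_ineq)
    also have "\<dots> \<le> 1" using norm_p v(2) by (simp add: mult_le_one)
    finally have pv: "coeff1 (p * v) = 0" "norm (p * v) \<le> 1" by (simp_all add: v)
    have "v = p * v * p + (1 - p) * v + p * v * (1 - p)"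
      by (simp add: left_diff_distrib right_diff_distrib)
    then have "T (base v) = T (base (p * v * p + (1 - p) * v + p * v * (1 - p)))" by (rule arg_cong)
    then have "T a - T (base (p * v * p)) = T (base ((1 - p) * v)) + T (base (p * v * (1 - p)))"
      by (simp only: unitization_sel_simps T.add v(3)) simp
    also have "norm \<dots> \<le> norm (T (base ((1 - p) * v))) + norm (T (base (p * v * (1 - p))))"
      by (rule norm_triangle_ineq)
    also have "\<dots> \<le> e" using left[OF v(1,2)] right[OF pv] by linarith
    finally show "norm (T a - T (base (p * v * p))) \<le> e" .
  qed
  ultimately show "\<exists>K. compact K \<and> (\<forall>a. norm a \<le> 1 \<longrightarrow> (\<exists>k\<in>K. norm (T a - k) \<le> e))" by blast
qed

lemma bounded_clinear_conj_op: "bounded_clinear (conj_op x)"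
  unfolding bounded_clinear_def conj_op_def
proof (intro conjI allI)
  show "bounded_linear (\<lambda>a. x\<^sup>\<star> * a * x)"
    using bounded_linear_compose[OF bounded_linear_mult_left bounded_linear_mult_right] by blast
  show "x\<^sup>\<star> * c *\<^sub>C a * x = c *\<^sub>C (x\<^sup>\<star> * a * x)" for c a
    by (simp only: scaleC_mult_left scaleC_mult_right)
qed

lemma orthogonally_small_if_weakly_compact:
  assumes S: "weakly_compact_operator S" and le: "conj_op x \<preceq> S"
  shows "orthogonally_small (embed x)"
  unfolding orthogonally_small_def
proof (intro allI impI)
  fix b :: "nat \<Rightarrow> 'a unitization" and \<delta> :: real
  assume b: "\<forall>n. coeff1 (b n) = 0 \<and> (b n)\<^sup>\<star> = b n \<and> norm (b n) = 1"
    and orth: "\<forall>m n. m \<noteq> n \<longrightarrow> b m * b n = 0" and \<delta>: "0 < \<delta>"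
  have eb: "embed (base (b n)) = b n" for n using b by (simp add: embed_base)
  show "\<exists>n. norm (b n * embed x) < \<delta>"
  proof (rule ccontr)
    assume "\<not> ?thesis"
    then have large: "\<delta> \<le> norm (b n * embed x)" for n by (simp add: not_less)
    show False
    proof (rule no_orthogonal_sequence[OF S le, of "\<lambda>n. base (b n)" \<delta>])
      show "(base (b n))\<^sup>\<star> = base (b n)" for n
        unfolding unitization_star_sel_simps[symmetric] using b by simp
      show "norm (base (b n)) = 1" for n using b by (simp add: norm_base)
      show "base (b m) * base (b n) = 0" if "m \<noteq> n" for m n
      proof -
        have "embed (base (b m) * base (b n)) = embed 0"
          unfolding embed_simps eb using orth that by simp
        then show ?thesis by simp
      qed
      show "\<delta> \<le> norm (base (b n) * x)" for n
        using large[of n] norm_embed[of "base (b n) * x"] by (simp only: embed_simps eb)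
    qed (rule \<delta>)
  qed
qed

theorem proposition2p3p1:
  fixes x :: "'a::cstar_algebra"
  shows "(weakly_compact_operator (conj_op x) \<longrightarrow>
           (\<forall>T :: 'a \<Rightarrow> 'a. bounded_clinear T \<and> positive_map T \<and> T \<preceq> conj_op x
              \<longrightarrow> compact_operator T)) \<and>
         (\<forall>S :: 'a \<Rightarrow> 'a. weakly_compact_operator S \<and> positive_map (conj_op x) \<and> conj_op x \<preceq> S
              \<longrightarrow> compact_operator (conj_op x))"
proof (intro conjI allI impI)
  have refl: "conj_op x \<preceq> conj_op x"
    by (simp add: op_le_def positive_map_def positive_element_0)
  show "compact_operator T"
    if "weakly_compact_operator (conj_op x)"
      and T: "bounded_clinear T \<and> positive_map T \<and> T \<preceq> conj_op x" for T :: "'a \<Rightarrow> 'a"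
    using compact_operator_if_orthogonally_small[OF orthogonally_small_if_weakly_compact] that refl
    by blast
  show "compact_operator (conj_op x)"
    if "weakly_compact_operator S \<and> positive_map (conj_op x) \<and> conj_op x \<preceq> S" for S :: "'a \<Rightarrow> 'a"
    using compact_operator_if_orthogonally_small[OF orthogonally_small_if_weakly_compact, of S x "conj_op x"]
      that refl bounded_clinear_conj_op by blast
qed

end
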